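(* Let $(\Lambda,\le)$, $R$, $F$, $M$, the basic subset $D$, the function $f$, the basic module $V(D,f)$, the sets $\Gamma,\Omega$, the subgroups $H\unlhd I\le M$ and the linear character $\lambda:H\to F^*$ be as in the context. Suppose $R$ is finite and $F$ is a splitting field for $I$ over $\lambda$. Assume, in addition, that $\Lambda$ is well-ordered by $\geq$, the inverse order of $\leq$. Then $V(D,f)$ is multiplicity free if and only if $I/H$ is abelian (this is equivalent to $[\Omega,\Omega]\subseteq\Gamma$) and $D$ has no special triple.
   Context: Representation theory conventions: $F$ is a field; a $G$-module is a left $FG$-module, possibly infinite dimensional; $(X,Y)_G=\dim_F\mathrm{Hom}_{FG}(X,Y)$; $\mathrm{ind}_H^GW=FG\otimes_{FH}W$. Under the hypotheses $V(D,f)$ is a completely reducible module of finite length; multiplicity free means that no irreducible module occurs more than once (up to isomorphism) in its decomposition as a direct sum of irreducible submodules. McLain group: $R$ is a ring with $1\ne0$ (not necessarily commutative), $(\Lambda,\leq)$ is a non-empty totally ordered set, $\Phi=\{(\alpha,\beta)\in\Lambda\times\Lambda:\alpha<\beta\}$. $J$ is the free left $R$-module with basis $e_{\alpha\beta}$, $(\alpha,\beta)\in\Phi$, made into a ring by $(re_{\alpha\beta})(se_{\beta\gamma})=rs\,e_{\alpha\gamma}$ and $(re_{\alpha\beta})(se_{\gamma\delta})=0$ if $\beta\neq\gamma$, extended additively. $J$ is nil, and $M=\{1+x:x\in J\}$ is a group under multiplication. $M_{\alpha\beta}=\{1+re_{\alpha\beta}:r\in R\}$. A subset $\Delta\subseteq\Phi$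 is closed if $(\alpha,\beta),(\beta,\gamma)\in\Delta$ implies $(\alpha,\gamma)\in\Delta$; then $M(\Delta)=\langle M_{\alpha\beta}:(\alpha,\beta)\in\Delta\rangle$. For $\Delta\subseteq\Phi$, $[\Delta,\Delta]$ is the set of all $(\alpha,\beta)\in\Phi$ for which there is a chain $(\gamma_1,\gamma_2),\dots,(\gamma_{n-1},\gamma_n)\in\Delta$ with $n\geq3$, $\gamma_1=\alpha$, $\gamma_n=\beta$. A linear character (group homomorphism) $R^+\to F^*$ is right primitive if its kernel contains no right ideal of $R$ other than $(0)$. It is assumed throughout that $R$ admits a right primitive linear character $R^+\to F^*$. Elementary modules: let $(\alpha,\beta)\in\Phi$ and let $\mu:R^+\to F^*$ be right primitive. Let $L$ be the subgroup generated by all $M_{\gamma\delta}$ with $\alpha\le\gamma<\delta\le\beta$; let $P$ be the subgroup of $L$ generated by all $M_{\gamma\beta}$ with $\alpha\le\gamma<\beta$ and all $M_{\gamma\delta}$ with $\alpha<\gamma<\delta<\beta$. There is a $1$-dimensional $P$-module on which $1+re_{\alpha\beta}$ acts as $\mu(r)$ and all the other listed generators act trivially; $V(\alpha,\beta,\mu)$ is the $L$-module induced from it, viewed as an $M$-module through $M=N\rtimes L$, where $N$ is the normal subgroup generated by all $M_{\gamma\delta}$ with $\gamma<\alpha$ or $\delta>\beta$, and $N$ acts trivially. Basic modules: $D=\{(\alpha_1,\beta_1),\dots,(\alpha_m,\beta_m)\}\subseteq\Phi$ ($m\ge1$) is basic if the $\alpha_i$ are distinct and the $\beta_i$ are distinct.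 $f$ assigns to each $(\alpha_i,\beta_i)$ a right primitive linear character $\lambda_i:R^+\to F^*$. The basic $M$-module is $V(D,f)=V(\alpha_m,\beta_m,\lambda_m)\otimes_F\cdots\otimes_FV(\alpha_1,\beta_1,\lambda_1)$ with diagonal action. Notation attached to $(D,f)$: $\Gamma=\Phi\setminus\bigcup_i\{(\alpha_i,\gamma)\in\Phi:\gamma<\beta_i\}$ and $H=M(\Gamma)$. For each $i$, $H_i=M(\Phi\setminus\{(\alpha_i,\gamma)\in\Phi:\gamma<\beta_i\})$ and $\widehat{\lambda_i}:H_i\to F^*$ is the homomorphism with $1+re_{\alpha_i\beta_i}\mapsto\lambda_i(r)$ that is trivial on all $M_{\alpha\beta}$ with $(\alpha,\beta)\in\Phi\setminus\{(\alpha_i,\gamma)\in\Phi:\gamma\le\beta_i\}$. Then $H=\bigcap_iH_i$ and $\lambda=\widehat{\lambda_1}|_H\cdots\widehat{\lambda_m}|_H$. $\Omega=\{(\alpha,\gamma)\in\Phi:\exists\,(\alpha,\beta),(\gamma,\delta)\in D\text{ with }\alpha<\gamma<\beta<\delta\}$, $\Gamma_1=\Gamma\cup\Omega$ (a closed subset of $\Phi$), and $I=M(\Gamma_1)$; $H$ is normal in $I$. $F$ is a splitting field for $I$ over $\lambda$ if $(V,V)_I=1$ for every irreducible $I$-module $V$ lying over $\lambda$, i.e. whose restriction to $H$ has a $1$-dimensional submodule on which $H$ acts via $\lambda$. $D$ has a special triple if it contains three elements $(a_1,b_1),(a_2,b_2),(a_3,b_3)$ with $a_1<a_2<a_3=b_1<b_2<b_3$.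 *)

theory Defs
  imports
    "HOL-Algebra.AbelCoset"
    "HOL-Algebra.Generated_Groups"
    "HOL-Library.Poly_Mapping"
    "HOL-Library.Extended_Nat"
    "Jordan_Normal_Form.VS_Connect"
begin

section \<open>Modules for groups\<close>

text \<open>
  The coefficient field \<open>F\<close> is a type of class \<open>field\<close>; as an algebraic structure it is
  \<open>class_ring\<close>. A \<open>G\<close>-module (left \<open>FG\<close>-module) is a vector space together with a linear
  action of \<open>G\<close>; no finiteness is required. The fields \<open>mult\<close> and \<open>one\<close> of the module
  record play no role.
\<close>

record ('f, 'v, 'g) gmodule = "('f, 'v) module" +
  act :: "'g \<Rightarrow> 'v \<Rightarrow> 'v"

locale gmodule =
  G: Group.group G + vectorspace "class_ring :: 'f::field ring" V
  for G :: "('g, 'x) monoid_scheme" (structure) and V :: "('f::field, 'v, 'g, 'y) gmodule_scheme" +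
  assumes act_linear: "g \<in> carrier G \<Longrightarrow> act V g \<in> module_hom class_ring V V"
    and act_one: "v \<in> carrier V \<Longrightarrow> act V \<one> v = v"
    and act_mult: "\<lbrakk>g \<in> carrier G; h \<in> carrier G; v \<in> carrier V\<rbrakk>
      \<Longrightarrow> act V (g \<otimes> h) v = act V g (act V h v)"

definition gsubmodule ::
  "('g, 'x) monoid_scheme \<Rightarrow> ('f::field, 'v, 'g, 'y) gmodule_scheme \<Rightarrow> 'v set \<Rightarrow> bool" where
  "gsubmodule G V U \<longleftrightarrow>
     subspace class_ring U V \<and> (\<forall>g\<in>carrier G. \<forall>u\<in>U. act V g u \<in> U)"

definition irreducible_gmodule ::
  "('g, 'x) monoid_scheme \<Rightarrow> ('f::field, 'v, 'g, 'y) gmodule_scheme \<Rightarrow> bool" where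
  "irreducible_gmodule G V \<longleftrightarrow>
     gmodule G V \<and> carrier V \<noteq> {\<zero>\<^bsub>V\<^esub>} \<and>
     (\<forall>U. gsubmodule G V U \<longrightarrow> U = {\<zero>\<^bsub>V\<^esub>} \<or> U = carrier V)"

definition gmodule_hom ::
  "('g, 'x) monoid_scheme \<Rightarrow> ('f::field, 'v, 'g, 'y) gmodule_scheme
     \<Rightarrow> ('f, 'w, 'g, 'z) gmodule_scheme \<Rightarrow> ('v \<Rightarrow> 'w) set" where
  "gmodule_hom G X Y =
     {p \<in> module_hom class_ring X Y.
        \<forall>g\<in>carrier G. \<forall>x\<in>carrier X. p (act X g x) = act Y g (p x)}"

definition gmodule_iso ::
  "('g, 'x) monoid_scheme \<Rightarrow> ('f::field, 'v, 'g, 'y) gmodule_scheme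
     \<Rightarrow> ('f, 'w, 'g, 'z) gmodule_scheme \<Rightarrow> bool" where
  "gmodule_iso G X Y \<longleftrightarrow> (\<exists>p\<in>gmodule_hom G X Y. bij_betw p (carrier X) (carrier Y))"

text \<open>
  The vector space of homomorphisms; elements are extensional, so that each homomorphism
  is represented by exactly one HOL function.
\<close>

definition hom_space ::
  "('g, 'x) monoid_scheme \<Rightarrow> ('f::field, 'v, 'g, 'y) gmodule_scheme
     \<Rightarrow> ('f, 'w, 'g, 'z) gmodule_scheme \<Rightarrow> ('f, 'v \<Rightarrow> 'w) module" where
  "hom_space G X Y =
     \<lparr>carrier = gmodule_hom G X Y \<inter> extensional (carrier X),
      mult = (\<lambda>p q. \<lambda>x\<in>carrier X. \<zero>\<^bsub>Y\<^esub>),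
      one = (\<lambda>x\<in>carrier X. \<zero>\<^bsub>Y\<^esub>),
      zero = (\<lambda>x\<in>carrier X. \<zero>\<^bsub>Y\<^esub>),
      add = (\<lambda>p q. \<lambda>x\<in>carrier X. p x \<oplus>\<^bsub>Y\<^esub> q x),
      smult = (\<lambda>c p. \<lambda>x\<in>carrier X. c \<odot>\<^bsub>Y\<^esub> p x)\<rparr>"

text \<open>\<open>vectorspace.dim\<close> is meaningful for finite-dimensional spaces only.\<close>

definition edim :: "('f::field, 'v, 'y) module_scheme \<Rightarrow> enat" where
  "edim V = (if vectorspace.fin_dim class_ring V
             then enat (vectorspace.dim class_ring V) else \<infinity>)"

definition intertwining_number ::
  "('g, 'x) monoid_scheme \<Rightarrow> ('f::field, 'v, 'g, 'y) gmodule_scheme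
     \<Rightarrow> ('f, 'w, 'g, 'z) gmodule_scheme \<Rightarrow> enat" where
  "intertwining_number G X Y = edim (hom_space G X Y)"

text \<open>
  A decomposition of \<open>V\<close> as the internal direct sum of finitely many irreducible submodules.
\<close>

definition irreducible_decomposition ::
  "('g, 'x) monoid_scheme \<Rightarrow> ('f::field, 'v, 'g, 'y) gmodule_scheme \<Rightarrow> 'v set set \<Rightarrow> bool" where
  "irreducible_decomposition G V S \<longleftrightarrow>
     finite S \<and>
     (\<forall>U\<in>S. gsubmodule G V U \<and> irreducible_gmodule G (V\<lparr>carrier := U\<rparr>)) \<and>
     (\<forall>v\<in>carrier V. \<exists>!u. u \<in> (\<Pi>\<^sub>E U\<in>S. U) \<and> v = (\<Oplus>\<^bsub>V\<^esub>U\<in>S. u U))"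

text \<open>
  The first conjunct says that \<open>V\<close> is completely reducible of finite length. The second
  quantifies over all decompositions; by Krull-Schmidt they are all equivalent.
\<close>

definition multiplicity_free ::
  "('g, 'x) monoid_scheme \<Rightarrow> ('f::field, 'v, 'g, 'y) gmodule_scheme \<Rightarrow> bool" where
  "multiplicity_free G V \<longleftrightarrow>
     (\<exists>S. irreducible_decomposition G V S) \<and>
     (\<forall>S. irreducible_decomposition G V S \<longrightarrow>
        (\<forall>U\<in>S. \<forall>W\<in>S. U \<noteq> W \<longrightarrow>
           \<not> gmodule_iso G (V\<lparr>carrier := U\<rparr>) (V\<lparr>carrier := W\<rparr>)))"

definition one_dim_gmodule :: "('g \<Rightarrow> 'f) \<Rightarrow> ('f::field, 'f, 'g) gmodule" where
  "one_dim_gmodule \<chi> =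
     \<lparr>carrier = UNIV, mult = (*), one = 1, zero = 0, add = (+), smult = (*),
      act = (\<lambda>g v. \<chi> g * v)\<rparr>"

definition lies_over ::
  "'g set \<Rightarrow> ('g \<Rightarrow> 'f) \<Rightarrow> ('f::field, 'v, 'g, 'y) gmodule_scheme \<Rightarrow> bool" where
  "lies_over H \<chi> V \<longleftrightarrow>
     (\<exists>U. subspace class_ring U V \<and> edim (V\<lparr>carrier := U\<rparr>) = 1 \<and>
          (\<forall>h\<in>H. \<forall>u\<in>U. act V h u = \<chi> h \<odot>\<^bsub>V\<^esub> u))"

text \<open>
  HOL cannot quantify over the type carrying \<open>V\<close>. The type used here loses nothing: an
  irreducible \<open>G\<close>-module is cyclic, hence a quotient of \<open>FG\<close>, so it has an isomorphic copy
  whose carrier is a set of finitely supported functions from the type of \<open>G\<close> to \<open>F\<close> (with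
  arbitrary operations on that set).
\<close>

definition splitting_field_over ::
  "('g, 'x) monoid_scheme \<Rightarrow> 'g set \<Rightarrow> ('g \<Rightarrow> 'f::field) \<Rightarrow> bool" where
  "splitting_field_over G H \<chi> \<longleftrightarrow>
     (\<forall>V :: ('f, 'g \<Rightarrow>\<^sub>0 'f, 'g) gmodule.
        irreducible_gmodule G V \<and> lies_over H \<chi> V \<longrightarrow> intertwining_number G V V = 1)"


section \<open>Induced modules and tensor products\<close>

text \<open>The vector space with basis \<open>B\<close>, on which \<open>g\<close> acts by the map \<open>k g\<close> on basis elements.\<close>

definition free_gmodule :: "'b set \<Rightarrow> ('g \<Rightarrow> 'b \<Rightarrow> 'b) \<Rightarrow> ('f::field, 'b \<Rightarrow>\<^sub>0 'f, 'g) gmodule" where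
  "free_gmodule B k =
     \<lparr>carrier = {x. Poly_Mapping.keys x \<subseteq> B},
      mult = (\<lambda>x y. 0), one = 0, zero = 0, add = (+),
      smult = (\<lambda>c. Poly_Mapping.map ((*) c)),
      act = (\<lambda>g x. \<Sum>b\<in>Poly_Mapping.keys x.
                     Poly_Mapping.single (k g b) (Poly_Mapping.lookup x b))\<rparr>"

definition quotient_gmodule ::
  "('f::field, 'v, 'g, 'y) gmodule_scheme \<Rightarrow> 'v set \<Rightarrow> ('f, 'v set, 'g) gmodule" where
  "quotient_gmodule V N =
     \<lparr>carrier = a_rcosets\<^bsub>V\<^esub> N, mult = (\<lambda>A B. N), one = N, zero = N,
      add = set_add V,
      smult = (\<lambda>c A. \<Union>x\<in>A. N +>\<^bsub>V\<^esub> (c \<odot>\<^bsub>V\<^esub> x)),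
      act = (\<lambda>g A. \<Union>x\<in>A. N +>\<^bsub>V\<^esub> (act V g x))\<rparr>"

text \<open>The module with basis \<open>B\<close> modulo the subspace spanned by the relators \<open>E\<close>.\<close>

definition presented_gmodule ::
  "'b set \<Rightarrow> ('g \<Rightarrow> 'b \<Rightarrow> 'b) \<Rightarrow> ('b \<Rightarrow>\<^sub>0 'f) set \<Rightarrow> ('f::field, ('b \<Rightarrow>\<^sub>0 'f) set, 'g) gmodule" where
  "presented_gmodule B k E =
     quotient_gmodule (free_gmodule B k)
       (LinearCombinations.module.span class_ring (free_gmodule B k) E)"

text \<open>
  \<open>FG \<otimes>\<^bsub>FH\<^esub> W\<close>: the class of \<open>single (x, w) 1\<close> is the tensor of \<open>x \<in> G\<close> and \<open>w \<in> W\<close>. As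
  \<open>G\<close> is a basis of \<open>FG\<close>, the tensor product is presented by linearity in \<open>w\<close> and
  \<open>xh \<otimes> w = x \<otimes> hw\<close> for \<open>h \<in> H\<close>.
\<close>

definition induced_gmodule ::
  "('g, 'x) monoid_scheme \<Rightarrow> 'g set \<Rightarrow> ('f::field, 'v, 'g, 'y) gmodule_scheme
     \<Rightarrow> ('f, ('g \<times> 'v \<Rightarrow>\<^sub>0 'f) set, 'g) gmodule" where
  "induced_gmodule G H W =
     presented_gmodule (carrier G \<times> carrier W) (\<lambda>g (x, w). (g \<otimes>\<^bsub>G\<^esub> x, w))
       ({Poly_Mapping.single (x, w \<oplus>\<^bsub>W\<^esub> w') 1
           - Poly_Mapping.single (x, w) 1 - Poly_Mapping.single (x, w') 1
         | x w w'. x \<in> carrier G \<and> w \<in> carrier W \<and> w' \<in> carrier W}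
        \<union> {Poly_Mapping.single (x, c \<odot>\<^bsub>W\<^esub> w) 1 - Poly_Mapping.single (x, w) c
         | x c w. x \<in> carrier G \<and> w \<in> carrier W}
        \<union> {Poly_Mapping.single (x \<otimes>\<^bsub>G\<^esub> h, w) 1 - Poly_Mapping.single (x, act W h w) 1
         | x h w. x \<in> carrier G \<and> h \<in> H \<and> w \<in> carrier W})"

text \<open>
  The tensor product over \<open>F\<close> of a finite family of \<open>G\<close>-modules \<open>W i\<close>, \<open>i \<in> D\<close>, with diagonal
  action: the class of \<open>single t 1\<close> is the tensor of the \<open>t i\<close>. All factors have the same
  carrier type.
\<close>

definition tensor_gmodule ::
  "'i set \<Rightarrow> ('i \<Rightarrow> ('f::field, 'v, 'g, 'y) gmodule_scheme)
     \<Rightarrow> ('f, (('i \<Rightarrow> 'v) \<Rightarrow>\<^sub>0 'f) set, 'g) gmodule" where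
  "tensor_gmodule D W =
     presented_gmodule (\<Pi>\<^sub>E i\<in>D. carrier (W i)) (\<lambda>g t. \<lambda>i\<in>D. act (W i) g (t i))
       ({Poly_Mapping.single (t(i := u \<oplus>\<^bsub>W i\<^esub> v)) 1
           - Poly_Mapping.single (t(i := u)) 1 - Poly_Mapping.single (t(i := v)) 1
         | t i u v. t \<in> (\<Pi>\<^sub>E i\<in>D. carrier (W i)) \<and> i \<in> D
                    \<and> u \<in> carrier (W i) \<and> v \<in> carrier (W i)}
        \<union> {Poly_Mapping.single (t(i := c \<odot>\<^bsub>W i\<^esub> u)) 1 - Poly_Mapping.single (t(i := u)) c
         | t i c u. t \<in> (\<Pi>\<^sub>E i\<in>D. carrier (W i)) \<and> i \<in> D \<and> u \<in> carrier (W i)})"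


section \<open>The McLain group\<close>

text \<open>
  \<open>\<Lambda>\<close> is a type of class \<open>linorder\<close> and \<open>R\<close> a type of class \<open>ring_1\<close>. The ring \<open>J\<close> consists
  of the finitely supported \<open>x :: 'l \<times> 'l \<Rightarrow>\<^sub>0 'r\<close> with support in \<open>\<Phi>\<close>, and
  \<open>r e\<^sub>\<alpha>\<^sub>\<beta>\<close> is \<open>single (\<alpha>, \<beta>) r\<close>.
\<close>

definition Phi :: "('l::linorder \<times> 'l) set" where
  "Phi = {(\<alpha>, \<beta>). \<alpha> < \<beta>}"

definition J_mult :: "('l \<times> 'l \<Rightarrow>\<^sub>0 'r::ring_1) \<Rightarrow> ('l \<times> 'l \<Rightarrow>\<^sub>0 'r) \<Rightarrow> ('l \<times> 'l \<Rightarrow>\<^sub>0 'r)" where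
  "J_mult x y =
     (\<Sum>p\<in>Poly_Mapping.keys x. \<Sum>q\<in>Poly_Mapping.keys y.
        if snd p = fst q
        then Poly_Mapping.single (fst p, snd q) (Poly_Mapping.lookup x p * Poly_Mapping.lookup y q)
        else 0)"

text \<open>
  The element \<open>1 + x\<close> of the group \<open>M\<close> is represented by \<open>x \<in> J\<close>:
  \<open>(1 + x)(1 + y) = 1 + (x + y + xy)\<close>. So \<open>1 + r e\<^sub>\<alpha>\<^sub>\<beta>\<close> is also \<open>single (\<alpha>, \<beta>) r\<close>.
\<close>

definition McLain :: "('l::linorder \<times> 'l \<Rightarrow>\<^sub>0 'r::ring_1) monoid" where
  "McLain =
     \<lparr>carrier = {x. Poly_Mapping.keys x \<subseteq> Phi}, mult = (\<lambda>x y. x + y + J_mult x y), one = 0\<rparr>"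

definition McLain_sub :: "('l::linorder \<times> 'l) set \<Rightarrow> ('l \<times> 'l \<Rightarrow>\<^sub>0 'r::ring_1) set" where
  "McLain_sub \<Delta> = generate McLain {Poly_Mapping.single p r | p r. p \<in> \<Delta>}"

text \<open>\<open>[\<Delta>, \<Delta>]\<close>\<close>

definition chain_set :: "('l::linorder \<times> 'l) set \<Rightarrow> ('l \<times> 'l) set" where
  "chain_set \<Delta> =
     {(\<alpha>, \<beta>) \<in> Phi. \<exists>\<gamma>s. length \<gamma>s \<ge> 3 \<and> hd \<gamma>s = \<alpha> \<and> last \<gamma>s = \<beta> \<and>
        (\<forall>i. Suc i < length \<gamma>s \<longrightarrow> (\<gamma>s ! i, \<gamma>s ! Suc i) \<in> \<Delta>)}"

definition linear_character :: "('r::ring_1 \<Rightarrow> 'f::field) \<Rightarrow> bool" where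
  "linear_character \<mu> \<longleftrightarrow> \<mu> \<in> hom (add_monoid class_ring) (units_of class_ring)"

definition right_ideal :: "'r::ring_1 set \<Rightarrow> bool" where
  "right_ideal A \<longleftrightarrow> additive_subgroup A class_ring \<and> (\<forall>a\<in>A. \<forall>r. a * r \<in> A)"

definition right_primitive :: "('r::ring_1 \<Rightarrow> 'f::field) \<Rightarrow> bool" where
  "right_primitive \<mu> \<longleftrightarrow>
     linear_character \<mu> \<and> (\<forall>A. right_ideal A \<and> A \<subseteq> {r. \<mu> r = 1} \<longrightarrow> A = {0})"

text \<open>
  The linear character of \<open>M(\<Delta>)\<close> with \<open>1 + r e\<^sub>p \<mapsto> \<mu> r\<close> that is trivial on the other
  generators \<open>1 + r e\<^sub>q\<close>, \<open>q \<in> \<Delta> - {p}\<close>. It is unique if it exists, which it does for the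
  sets \<open>\<Delta>\<close> used below.
\<close>

definition extended_character ::
  "('l::linorder \<times> 'l) set \<Rightarrow> 'l \<times> 'l \<Rightarrow> ('r::ring_1 \<Rightarrow> 'f::field)
     \<Rightarrow> ('l \<times> 'l \<Rightarrow>\<^sub>0 'r) \<Rightarrow> 'f" where
  "extended_character \<Delta> p \<mu> =
     (THE \<chi>. \<chi> \<in> extensional (McLain_sub \<Delta>) \<and>
        \<chi> \<in> hom (McLain\<lparr>carrier := McLain_sub \<Delta>\<rparr>) (units_of class_ring) \<and>
        (\<forall>r. \<chi> (Poly_Mapping.single p r) = \<mu> r) \<and>
        (\<forall>q\<in>\<Delta> - {p}. \<forall>r. \<chi> (Poly_Mapping.single q r) = 1))"


section \<open>Basic modules\<close>

definition L_set :: "'l::linorder \<Rightarrow> 'l \<Rightarrow> ('l \<times> 'l) set" where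
  "L_set \<alpha> \<beta> = {(\<gamma>, \<delta>). \<alpha> \<le> \<gamma> \<and> \<gamma> < \<delta> \<and> \<delta> \<le> \<beta>}"

definition P_set :: "'l::linorder \<Rightarrow> 'l \<Rightarrow> ('l \<times> 'l) set" where
  "P_set \<alpha> \<beta> = {(\<gamma>, \<beta>) | \<gamma>. \<alpha> \<le> \<gamma> \<and> \<gamma> < \<beta>} \<union> {(\<gamma>, \<delta>). \<alpha> < \<gamma> \<and> \<gamma> < \<delta> \<and> \<delta> < \<beta>}"

definition N_set :: "'l::linorder \<Rightarrow> 'l \<Rightarrow> ('l \<times> 'l) set" where
  "N_set \<alpha> \<beta> = {(\<gamma>, \<delta>) \<in> Phi. \<gamma> < \<alpha> \<or> \<delta> > \<beta>}"

text \<open>The projection of \<open>M = N \<rtimes> L\<close> onto \<open>L\<close> with kernel \<open>N\<close>.\<close>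

definition L_projection ::
  "'l::linorder \<Rightarrow> 'l \<Rightarrow> ('l \<times> 'l \<Rightarrow>\<^sub>0 'r::ring_1) \<Rightarrow> ('l \<times> 'l \<Rightarrow>\<^sub>0 'r)" where
  "L_projection \<alpha> \<beta> m =
     (THE l. l \<in> McLain_sub (L_set \<alpha> \<beta>) \<and>
             (\<exists>n\<in>McLain_sub (N_set \<alpha> \<beta>). m = n \<otimes>\<^bsub>McLain\<^esub> l))"

definition elementary_module ::
  "'l::linorder \<Rightarrow> 'l \<Rightarrow> ('r::ring_1 \<Rightarrow> 'f::field)
     \<Rightarrow> ('f, (('l \<times> 'l \<Rightarrow>\<^sub>0 'r) \<times> 'f \<Rightarrow>\<^sub>0 'f) set, 'l \<times> 'l \<Rightarrow>\<^sub>0 'r) gmodule" where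
  "elementary_module \<alpha> \<beta> \<mu> =
     (let V = induced_gmodule (McLain\<lparr>carrier := McLain_sub (L_set \<alpha> \<beta>)\<rparr>)
                (McLain_sub (P_set \<alpha> \<beta>))
                (one_dim_gmodule (extended_character (P_set \<alpha> \<beta>) (\<alpha>, \<beta>) \<mu>))
      in V\<lparr>act := (\<lambda>m. act V (L_projection \<alpha> \<beta> m))\<rparr>)"

definition basic_subset :: "('l::linorder \<times> 'l) set \<Rightarrow> bool" where
  "basic_subset D \<longleftrightarrow> finite D \<and> D \<noteq> {} \<and> D \<subseteq> Phi \<and> inj_on fst D \<and> inj_on snd D"

definition basic_module ::
  "('l::linorder \<times> 'l) set \<Rightarrow> ('l \<times> 'l \<Rightarrow> 'r::ring_1 \<Rightarrow> 'f::field)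
     \<Rightarrow> ('f, (('l \<times> 'l \<Rightarrow> (('l \<times> 'l \<Rightarrow>\<^sub>0 'r) \<times> 'f \<Rightarrow>\<^sub>0 'f) set) \<Rightarrow>\<^sub>0 'f) set, 'l \<times> 'l \<Rightarrow>\<^sub>0 'r) gmodule"
  where
  "basic_module D f = tensor_gmodule D (\<lambda>(\<alpha>, \<beta>). elementary_module \<alpha> \<beta> (f (\<alpha>, \<beta>)))"

definition Gamma_set :: "('l::linorder \<times> 'l) set \<Rightarrow> ('l \<times> 'l) set" where
  "Gamma_set D = Phi - (\<Union>(\<alpha>, \<beta>)\<in>D. {(\<alpha>, \<gamma>) | \<gamma>. \<gamma> < \<beta>})"

definition Omega_set :: "('l::linorder \<times> 'l) set \<Rightarrow> ('l \<times> 'l) set" where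
  "Omega_set D =
     {(\<alpha>, \<gamma>) \<in> Phi. \<exists>\<beta> \<delta>. (\<alpha>, \<beta>) \<in> D \<and> (\<gamma>, \<delta>) \<in> D \<and> \<alpha> < \<gamma> \<and> \<gamma> < \<beta> \<and> \<beta> < \<delta>}"

definition H_group :: "('l::linorder \<times> 'l) set \<Rightarrow> ('l \<times> 'l \<Rightarrow>\<^sub>0 'r::ring_1) set" where
  "H_group D = McLain_sub (Gamma_set D)"

definition I_group :: "('l::linorder \<times> 'l) set \<Rightarrow> ('l \<times> 'l \<Rightarrow>\<^sub>0 'r::ring_1) set" where
  "I_group D = McLain_sub (Gamma_set D \<union> Omega_set D)"

text \<open>The factor for \<open>d \<in> D\<close> is the character of \<open>H\<^sub>d = M(Gamma_set {d})\<close> attached to \<open>f d\<close>.\<close>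

definition basic_character ::
  "('l::linorder \<times> 'l) set \<Rightarrow> ('l \<times> 'l \<Rightarrow> 'r::ring_1 \<Rightarrow> 'f::field)
     \<Rightarrow> ('l \<times> 'l \<Rightarrow>\<^sub>0 'r) \<Rightarrow> 'f" where
  "basic_character D f =
     (\<lambda>h\<in>H_group D. \<Prod>d\<in>D. extended_character (Gamma_set {d}) d (f d) h)"

definition special_triple :: "('l::linorder \<times> 'l) set \<Rightarrow> bool" where
  "special_triple D \<longleftrightarrow>
     (\<exists>a\<^sub>1 b\<^sub>1 a\<^sub>2 b\<^sub>2 a\<^sub>3 b\<^sub>3. (a\<^sub>1, b\<^sub>1) \<in> D \<and> (a\<^sub>2, b\<^sub>2) \<in> D \<and> (a\<^sub>3, b\<^sub>3) \<in> D \<and>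
        a\<^sub>1 < a\<^sub>2 \<and> a\<^sub>2 < a\<^sub>3 \<and> a\<^sub>3 = b\<^sub>1 \<and> b\<^sub>1 < b\<^sub>2 \<and> b\<^sub>2 < b\<^sub>3)"

end

theory Submission
  imports Defs "HOL-Algebra.Sylow" "HOL-Algebra.Multiplicative_Group"
begin

text \<open>
  The coset \<open>m H\<close> is determined by the entries of \<open>m\<inverse>\<close> outside \<open>\<Gamma>\<close>, so \<open>V(D,f)\<close> becomes a monomial
  module \<open>V\<close> with basis vectors \<open>\<delta> X\<close> indexed by families \<open>X\<close> of truncated rows. The vectors on
  which \<open>H\<close> acts by \<open>\<lambda>\<close> are spanned by the \<open>\<delta> X\<close> with \<open>X\<close> supported on \<open>\<Omega>\<close>, and \<open>I/H\<close> acts on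
  them as on a twisted regular module. Since \<open>\<delta> 0\<close> generates \<open>V\<close>, endomorphisms of \<open>V\<close> correspond to
  such vectors; by averaging over finite subgroups of \<open>H\<close>, every nonzero submodule contains a
  nonzero one.

  If \<open>V\<close> is multiplicity free, each irreducible summand meets the \<open>\<lambda>\<close>-space in an irreducible
  \<open>I\<close>-module over \<open>\<lambda>\<close>, on which all endomorphisms of \<open>V\<close> are scalar by the splitting hypothesis.
  So the components of \<open>\<delta> 0\<close> span the \<open>\<lambda>\<close>-space and are eigenvectors of \<open>I\<close>. Comparing \<open>x y \<delta> 0\<close>
  with \<open>y x \<delta> 0\<close> for \<open>x, y \<in> I\<close> then excludes chains in \<open>\<Omega>\<close> leading outside \<open>\<Gamma>\<close> and special
  triples. Conversely, without those, \<open>I\<close> acts by the translations \<open>\<delta> X \<mapsto> \<delta> (X + Y)\<close>. The finite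
  Fourier transform attached to a primitive character of \<open>R\<close> diagonalizes them and gives
  orthogonal idempotents of \<open>End V\<close> with irreducible images.
\<close>

section \<open>Modules for groups\<close>

text \<open>Elements of \<open>McLain\<close> are supported above the diagonal, so right
  multiplication changes an entry (a, b) only through earlier entries of row a. Hence rows cut off
  before the column b with (a, b) \<in> D can still be multiplied, and the entry at (a, b) changes
  by an amount depending on the truncated row alone; \<open>f (a, b)\<close> applied to it gives the
  monomial coefficients. But whether a basis vector can occur in a vector of the \<lambda>-space is
  tested by single generators whose indices come from that basis vector and from D. A finite
  subgroup is therefore enough; its order is a power of the order of R, which is nonzero in F by
  right primitivity. For x, y in I the product term of x y at a position (a, b) \<in> D comes from
  pairs (a, c), (c, b) \<in> \<Omega>. Such a pair amounts to a special triple with first element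
  (a, b): this is how triples enter, through the scalars rather than through I/H.\<close>

lemma gmodule_vectorspace: "gmodule G V \<Longrightarrow> vectorspace class_ring V"
  by (rule gmodule.axioms)

lemma gmodule_group: "gmodule G V \<Longrightarrow> Group.group G"
  by (rule gmodule.axioms)

lemma gmoduleI:
  fixes V :: "('f::field, 'v, 'g, 'y) gmodule_scheme"
  assumes "Group.group G" and "vectorspace class_ring V"
    and "\<And>g v. \<lbrakk>g \<in> carrier G; v \<in> carrier V\<rbrakk> \<Longrightarrow> act V g v \<in> carrier V"
    and "\<And>g v w. \<lbrakk>g \<in> carrier G; v \<in> carrier V; w \<in> carrier V\<rbrakk>
      \<Longrightarrow> act V g (v \<oplus>\<^bsub>V\<^esub> w) = act V g v \<oplus>\<^bsub>V\<^esub> act V g w"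
    and "\<And>g c v. \<lbrakk>g \<in> carrier G; v \<in> carrier V\<rbrakk> \<Longrightarrow> act V g (c \<odot>\<^bsub>V\<^esub> v) = c \<odot>\<^bsub>V\<^esub> act V g v"
    and "\<And>v. v \<in> carrier V \<Longrightarrow> act V \<one>\<^bsub>G\<^esub> v = v"
    and "\<And>g h v. \<lbrakk>g \<in> carrier G; h \<in> carrier G; v \<in> carrier V\<rbrakk>
      \<Longrightarrow> act V (g \<otimes>\<^bsub>G\<^esub> h) v = act V g (act V h v)"
  shows "gmodule G V"
  using assms by (auto intro!: gmodule.intro gmodule_axioms.intro simp: module_hom_def)

lemma gmodule_act:
  fixes V :: "('f::field, 'v, 'g, 'y) gmodule_scheme"
  assumes "gmodule G V" "g \<in> carrier G"
  shows "v \<in> carrier V \<Longrightarrow> act V g v \<in> carrier V"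
    and "\<lbrakk>v \<in> carrier V; w \<in> carrier V\<rbrakk> \<Longrightarrow> act V g (v \<oplus>\<^bsub>V\<^esub> w) = act V g v \<oplus>\<^bsub>V\<^esub> act V g w"
    and "v \<in> carrier V \<Longrightarrow> act V g (c \<odot>\<^bsub>V\<^esub> v) = c \<odot>\<^bsub>V\<^esub> act V g v"
  using gmodule.act_linear[OF assms] by (auto simp: module_hom_def)

lemma gsubmodule_iff:
  fixes V :: "('f::field, 'v, 'g, 'y) gmodule_scheme"
  assumes "gmodule G V"
  shows "gsubmodule G V U \<longleftrightarrow> U \<subseteq> carrier V \<and> \<zero>\<^bsub>V\<^esub> \<in> U \<and> (\<forall>u\<in>U. \<forall>v\<in>U. u \<oplus>\<^bsub>V\<^esub> v \<in> U)
    \<and> (\<forall>c. \<forall>u\<in>U. c \<odot>\<^bsub>V\<^esub> u \<in> U) \<and> (\<forall>g\<in>carrier G. \<forall>u\<in>U. act V g u \<in> U)"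
proof -
  have "vectorspace class_ring V" "module class_ring V"
    using gmodule_vectorspace[OF assms] by (auto simp: vectorspace_def)
  then show ?thesis
    by (auto simp: gsubmodule_def subspace_def submodule_def)
qed

lemma gmodule_gsubmodule:
  assumes "gmodule G V" "gsubmodule G V U"
  shows "gmodule G (V\<lparr>carrier := U\<rparr>)"
proof (rule gmoduleI)
  show "Group.group G" using assms(1) by (rule gmodule_group)
  show "vectorspace class_ring (V\<lparr>carrier := U\<rparr>)"
    using assms gmodule_vectorspace by (auto simp: gsubmodule_def intro: vectorspace.subspace_is_vs)
qed (use assms(2) gmodule_act[OF assms(1)] gmodule.act_one[OF assms(1)] gmodule.act_mult[OF assms(1)]
    in \<open>auto simp: gsubmodule_iff[OF assms(1)] subset_iff\<close>)

lemma gsubmodule_gsubmodule_iff: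
  assumes "gmodule G V" "gsubmodule G V U"
  shows "gsubmodule G (V\<lparr>carrier := U\<rparr>) W \<longleftrightarrow> W \<subseteq> U \<and> gsubmodule G V W"
  using assms(2) unfolding gsubmodule_iff[OF gmodule_gsubmodule[OF assms]] gsubmodule_iff[OF assms(1)]
  by auto

lemma irreducible_gsubmodule_iff:
  assumes "gmodule G V" "gsubmodule G V U"
  shows "irreducible_gmodule G (V\<lparr>carrier := U\<rparr>) \<longleftrightarrow> U \<noteq> {\<zero>\<^bsub>V\<^esub>} \<and>
    (\<forall>W. W \<subseteq> U \<and> gsubmodule G V W \<longrightarrow> W = {\<zero>\<^bsub>V\<^esub>} \<or> W = U)"
  using gmodule_gsubmodule[OF assms] gsubmodule_gsubmodule_iff[OF assms]
  by (auto simp: irreducible_gmodule_def)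

lemma gmodule_hom_iff:
  fixes X :: "('f::field, 'v, 'g, 'y) gmodule_scheme" and Y :: "('f, 'w, 'g, 'z) gmodule_scheme"
  shows "p \<in> gmodule_hom G X Y \<longleftrightarrow> (\<forall>x\<in>carrier X. p x \<in> carrier Y)
    \<and> (\<forall>x\<in>carrier X. \<forall>y\<in>carrier X. p (x \<oplus>\<^bsub>X\<^esub> y) = p x \<oplus>\<^bsub>Y\<^esub> p y)
    \<and> (\<forall>c. \<forall>x\<in>carrier X. p (c \<odot>\<^bsub>X\<^esub> x) = c \<odot>\<^bsub>Y\<^esub> p x)
    \<and> (\<forall>g\<in>carrier G. \<forall>x\<in>carrier X. p (act X g x) = act Y g (p x))"
  by (auto simp: gmodule_hom_def module_hom_def)

lemma gmodule_hom_mod_hom: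
  assumes "gmodule G X" "gmodule G Y" "p \<in> gmodule_hom G X Y"
  shows "mod_hom class_ring X Y p"
  using assms gmodule_vectorspace[OF assms(1)] gmodule_vectorspace[OF assms(2)]
  by (auto simp: mod_hom_def mod_hom_axioms_def vectorspace_def gmodule_hom_def)

lemma gmodule_hom_zero:
  assumes "gmodule G X" "gmodule G Y" "p \<in> gmodule_hom G X Y"
  shows "p \<zero>\<^bsub>X\<^esub> = \<zero>\<^bsub>Y\<^esub>"
  using mod_hom.f0_is_0[OF gmodule_hom_mod_hom[OF assms]] .

lemma gmodule_zero:
  assumes "gmodule G X"
  shows "\<zero>\<^bsub>X\<^esub> \<in> carrier X"
proof -
  interpret vectorspace class_ring X by (rule gmodule_vectorspace[OF assms])
  show ?thesis by simp
qed

lemma gsubmodule_image: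
  assumes "gmodule G X" "gmodule G Y" "p \<in> gmodule_hom G X Y" "gsubmodule G X U"
  shows "gsubmodule G Y (p ` U)"
proof -
  have sub: "U \<subseteq> carrier X"
    and "\<zero>\<^bsub>X\<^esub> \<in> U" "\<And>u v. u \<in> U \<Longrightarrow> v \<in> U \<Longrightarrow> u \<oplus>\<^bsub>X\<^esub> v \<in> U"
    "\<And>c u. u \<in> U \<Longrightarrow> c \<odot>\<^bsub>X\<^esub> u \<in> U" "\<And>g u. g \<in> carrier G \<Longrightarrow> u \<in> U \<Longrightarrow> act X g u \<in> U"
    using assms(4) unfolding gsubmodule_iff[OF assms(1)] by auto
  moreover have "p (u \<oplus>\<^bsub>X\<^esub> v) = p u \<oplus>\<^bsub>Y\<^esub> p v" "p (c \<odot>\<^bsub>X\<^esub> u) = c \<odot>\<^bsub>Y\<^esub> p u"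
    "g \<in> carrier G \<Longrightarrow> p (act X g u) = act Y g (p u)" "p u \<in> carrier Y"
    if "u \<in> U" "v \<in> U" for u v c g
    using assms(3) that sub unfolding gmodule_hom_iff by blast+
  ultimately show ?thesis
    unfolding gsubmodule_iff[OF assms(2)]
    using gmodule_hom_zero[OF assms(1-3)] by (auto simp: image_iff) metis+
qed

lemma gmodule_hom_inverse:
  assumes "gmodule G X" "gmodule G Y" and p: "p \<in> gmodule_hom G X Y" and bij: "bij_betw p (carrier X) (carrier Y)"
  shows "the_inv_into (carrier X) p \<in> gmodule_hom G Y X"
proof -
  let ?q = "the_inv_into (carrier X) p"
  interpret vectorspace class_ring X by (rule gmodule_vectorspace[OF assms(1)])
  have inj: "inj_on p (carrier X)" and im: "p ` carrier X = carrier Y"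
    using bij by (auto simp: bij_betw_def)
  have q: "?q y \<in> carrier X" "p (?q y) = y" if "y \<in> carrier Y" for y
    using the_inv_into_into[OF inj, of y "carrier X"] f_the_inv_into_f[OF inj, of y] im that by auto
  have eqI: "?q y = x" if "x \<in> carrier X" "p x = y" for x y
    using the_inv_into_f_eq[OF inj] that by auto
  show ?thesis
    unfolding gmodule_hom_iff
    using p q gmodule_act(1)[OF assms(1)] by (auto intro!: eqI simp: gmodule_hom_iff)
qed

lemma irreducible_gmodule_iso:
  assumes X: "gmodule G X" and Y: "gmodule G Y" and p: "p \<in> gmodule_hom G X Y"
    and bij: "bij_betw p (carrier X) (carrier Y)" and irr: "irreducible_gmodule G X"
  shows "irreducible_gmodule G Y"
  unfolding irreducible_gmodule_def
proof (intro conjI allI impI)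
  let ?q = "the_inv_into (carrier X) p"
  have q: "?q \<in> gmodule_hom G Y X" by (rule gmodule_hom_inverse[OF X Y p bij])
  have inj: "inj_on p (carrier X)" and im: "p ` carrier X = carrier Y"
    using bij by (auto simp: bij_betw_def)
  show "gmodule G Y" by fact
  show "carrier Y \<noteq> {\<zero>\<^bsub>Y\<^esub>}"
  proof
    assume *: "carrier Y = {\<zero>\<^bsub>Y\<^esub>}"
    have "x = \<zero>\<^bsub>X\<^esub>" if "x \<in> carrier X" for x
      using inj_onD[OF inj _ that gmodule_zero[OF X]] im that * gmodule_hom_zero[OF X Y p] by auto
    then have "carrier X = {\<zero>\<^bsub>X\<^esub>}" using gmodule_zero[OF X] by blast
    then show False using irr unfolding irreducible_gmodule_def by blast
  qed
  fix U assume U: "gsubmodule G Y U"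
  then have sub: "U \<subseteq> carrier Y" by (simp add: gsubmodule_iff[OF Y])
  have "U = p ` (?q ` U)"
  proof -
    have "p (?q y) = y" if "y \<in> U" for y
      using f_the_inv_into_f[OF inj, of y] im that sub by auto
    then show ?thesis by (force simp: image_image)
  qed
  moreover have "gsubmodule G X (?q ` U)" using gsubmodule_image[OF Y X q U] .
  then have "?q ` U = {\<zero>\<^bsub>X\<^esub>} \<or> ?q ` U = carrier X"
    using irr unfolding irreducible_gmodule_def by blast
  ultimately show "U = {\<zero>\<^bsub>Y\<^esub>} \<or> U = carrier Y"
    using im gmodule_hom_zero[OF X Y p] by auto
qed

lemma gmodule_hom_restrict:
  assumes "gmodule G X" "gmodule G Y" "p \<in> gmodule_hom G X Y" "gsubmodule G X U"
  shows "p \<in> gmodule_hom G (X\<lparr>carrier := U\<rparr>) (Y\<lparr>carrier := p ` U\<rparr>)"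
  using assms(3,4) unfolding gsubmodule_iff[OF assms(1)] gmodule_hom_iff by (auto simp: subset_iff)

lemma gmodule_hom_finsum:
  assumes X: "gmodule G X" and Y: "gmodule G Y" and p: "p \<in> gmodule_hom G X Y"
    and "finite A" "\<And>a. a \<in> A \<Longrightarrow> x a \<in> carrier X"
  shows "p (\<Oplus>\<^bsub>X\<^esub>a\<in>A. x a) = (\<Oplus>\<^bsub>Y\<^esub>a\<in>A. p (x a))"
proof -
  interpret X: vectorspace class_ring X by (rule gmodule_vectorspace[OF X])
  interpret Y: vectorspace class_ring Y by (rule gmodule_vectorspace[OF Y])
  show ?thesis
    using assms(4,5)
  proof (induction A rule: finite_induct)
    case empty
    then show ?case using gmodule_hom_zero[OF X Y p] by simp
  next
    case (insert a A)
    have "(\<Oplus>\<^bsub>X\<^esub>b\<in>A. x b) \<in> carrier X" by (rule X.finsum_closed) (use insert in auto)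
    moreover have "(\<Oplus>\<^bsub>Y\<^esub>b\<in>insert a A. p (x b)) = p (x a) \<oplus>\<^bsub>Y\<^esub> (\<Oplus>\<^bsub>Y\<^esub>b\<in>A. p (x b))"
      by (rule Y.finsum_insert) (use insert p in \<open>auto simp: gmodule_hom_iff\<close>)
    moreover have "(\<Oplus>\<^bsub>X\<^esub>b\<in>insert a A. x b) = x a \<oplus>\<^bsub>X\<^esub> (\<Oplus>\<^bsub>X\<^esub>b\<in>A. x b)"
      by (rule X.finsum_insert) (use insert in auto)
    ultimately show ?case using insert p by (simp add: gmodule_hom_iff)
  qed
qed

section \<open>Decompositions and multiplicities under isomorphisms\<close>

lemma irreducible_decomposition_iso:
  assumes X: "gmodule G X" and Y: "gmodule G Y" and p: "p \<in> gmodule_hom G X Y"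
    and bij: "bij_betw p (carrier X) (carrier Y)" and S: "irreducible_decomposition G X S"
  shows "irreducible_decomposition G Y ((`) p ` S)"
  unfolding irreducible_decomposition_def
proof (intro conjI ballI)
  let ?q = "the_inv_into (carrier X) p"
  have q: "?q \<in> gmodule_hom G Y X" by (rule gmodule_hom_inverse[OF X Y p bij])
  interpret X: vectorspace class_ring X by (rule gmodule_vectorspace[OF X])
  interpret Y: vectorspace class_ring Y by (rule gmodule_vectorspace[OF Y])
  have inj: "inj_on p (carrier X)" and im: "p ` carrier X = carrier Y"
    using bij by (auto simp: bij_betw_def)
  have fin: "finite S" and sub: "\<And>U. U \<in> S \<Longrightarrow> gsubmodule G X U"
    and irr: "\<And>U. U \<in> S \<Longrightarrow> irreducible_gmodule G (X\<lparr>carrier := U\<rparr>)"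
    and dec: "\<And>v. v \<in> carrier X \<Longrightarrow> \<exists>!u. u \<in> (\<Pi>\<^sub>E U\<in>S. U) \<and> v = (\<Oplus>\<^bsub>X\<^esub>U\<in>S. u U)"
    using S by (auto simp: irreducible_decomposition_def)
  have subX: "U \<subseteq> carrier X" if "U \<in> S" for U
    using sub[OF that] by (simp add: gsubmodule_iff[OF X])
  show "finite ((`) p ` S)" using fin by simp
  fix W assume "W \<in> (`) p ` S"
  then obtain U where U: "U \<in> S" "W = p ` U" by auto
  show "gsubmodule G Y W" unfolding U(2) by (rule gsubmodule_image[OF X Y p sub[OF U(1)]])
  show "irreducible_gmodule G (Y\<lparr>carrier := W\<rparr>)" unfolding U(2)
  proof (rule irreducible_gmodule_iso)
    show "gmodule G (X\<lparr>carrier := U\<rparr>)" by (rule gmodule_gsubmodule[OF X sub[OF U(1)]])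
    show "gmodule G (Y\<lparr>carrier := p ` U\<rparr>)"
      by (rule gmodule_gsubmodule[OF Y gsubmodule_image[OF X Y p sub[OF U(1)]]])
    show "p \<in> gmodule_hom G (X\<lparr>carrier := U\<rparr>) (Y\<lparr>carrier := p ` U\<rparr>)"
      by (rule gmodule_hom_restrict[OF X Y p sub[OF U(1)]])
    show "bij_betw p (carrier (X\<lparr>carrier := U\<rparr>)) (carrier (Y\<lparr>carrier := p ` U\<rparr>))"
      using inj_on_subset[OF inj subX[OF U(1)]] by (auto simp: bij_betw_def)
    show "irreducible_gmodule G (X\<lparr>carrier := U\<rparr>)" using irr U by blast
  qed
next
  let ?q = "the_inv_into (carrier X) p"
  have q: "?q \<in> gmodule_hom G Y X" by (rule gmodule_hom_inverse[OF X Y p bij])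
  interpret X: vectorspace class_ring X by (rule gmodule_vectorspace[OF X])
  interpret Y: vectorspace class_ring Y by (rule gmodule_vectorspace[OF Y])
  have inj: "inj_on p (carrier X)" and im: "p ` carrier X = carrier Y"
    using bij by (auto simp: bij_betw_def)
  have fin: "finite S" and sub: "\<And>U. U \<in> S \<Longrightarrow> gsubmodule G X U"
    and dec: "\<And>v. v \<in> carrier X \<Longrightarrow> \<exists>!u. u \<in> (\<Pi>\<^sub>E U\<in>S. U) \<and> v = (\<Oplus>\<^bsub>X\<^esub>U\<in>S. u U)"
    using S by (auto simp: irreducible_decomposition_def)
  have subX: "U \<subseteq> carrier X" if "U \<in> S" for U
    using sub[OF that] by (simp add: gsubmodule_iff[OF X])
  have pc: "p x \<in> carrier Y" if "x \<in> carrier X" for x using im that by auto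
  have injS: "inj_on ((`) p) S"
  proof (rule inj_onI)
    fix U V assume "U \<in> S" "V \<in> S" "p ` U = p ` V"
    then show "U = V" using inj_on_image_eq_iff[OF inj] subX by blast
  qed
  have qp: "?q (p x) = x" if "x \<in> carrier X" for x
    using the_inv_into_f_f[OF inj that] .
  have pq: "p (?q y) = y" "?q y \<in> carrier X" if "y \<in> carrier Y" for y
    using f_the_inv_into_f[OF inj, of y] the_inv_into_into[OF inj, of y "carrier X"] im that by auto
  have reindex: "(\<Oplus>\<^bsub>Y\<^esub>W\<in>(`) p ` S. f W) = (\<Oplus>\<^bsub>Y\<^esub>U\<in>S. f (p ` U))"
    if "\<And>U. U \<in> S \<Longrightarrow> f (p ` U) \<in> carrier Y" for f
    by (rule Y.add.finprod_reindex) (use that injS in \<open>auto simp: Y.add.finprod_reindex\<close>)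
  fix v assume v: "v \<in> carrier Y"
  obtain u where u: "u \<in> (\<Pi>\<^sub>E U\<in>S. U)" "?q v = (\<Oplus>\<^bsub>X\<^esub>U\<in>S. u U)"
    and uniq: "\<And>u'. u' \<in> (\<Pi>\<^sub>E U\<in>S. U) \<Longrightarrow> ?q v = (\<Oplus>\<^bsub>X\<^esub>U\<in>S. u' U) \<Longrightarrow> u' = u"
    using dec[OF pq(2)[OF v]] by metis
  have uX: "u U \<in> U" "u U \<in> carrier X" if "U \<in> S" for U using u(1) subX that by auto
  \<comment> \<open>The components of \<open>v\<close> are the images of the components
    \<open>u\<close> of its preimage. Since the summands of Y are indexed by images, each index is
    first sent back to the summand of X it comes from. Any other family pulls back to
    \<open>u\<close>, which gives uniqueness.\<close>
  let ?u = "\<lambda>W\<in>(`) p ` S. p (u (the_inv_into S ((`) p) W))"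
  have u1: "?u (p ` U) = p (u U)" if "U \<in> S" for U
    using that the_inv_into_f_f[OF injS that] by auto
  show "\<exists>!u. u \<in> (\<Pi>\<^sub>E W\<in>(`) p ` S. W) \<and> v = (\<Oplus>\<^bsub>Y\<^esub>W\<in>(`) p ` S. u W)"
  proof (rule ex1I[of _ ?u])
    have "(\<Oplus>\<^bsub>Y\<^esub>W\<in>(`) p ` S. ?u W) = (\<Oplus>\<^bsub>Y\<^esub>U\<in>S. ?u (p ` U))"
      by (rule reindex) (use u1 uX pc in auto)
    also have "\<dots> = (\<Oplus>\<^bsub>Y\<^esub>U\<in>S. p (u U))"
      by (rule Y.add.finprod_cong') (use u1 uX pc in auto)
    also have "\<dots> = p (\<Oplus>\<^bsub>X\<^esub>U\<in>S. u U)"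
      by (rule gmodule_hom_finsum[OF X Y p fin, symmetric]) (rule uX)
    also have "\<dots> = v" using pq(1)[OF v] u(2) by simp
    finally show "?u \<in> (\<Pi>\<^sub>E W\<in>(`) p ` S. W) \<and> v = (\<Oplus>\<^bsub>Y\<^esub>W\<in>(`) p ` S. ?u W)"
      using u1 uX(1) by (auto simp: PiE_iff extensional_def)
  next
    fix w assume w: "w \<in> (\<Pi>\<^sub>E W\<in>(`) p ` S. W) \<and> v = (\<Oplus>\<^bsub>Y\<^esub>W\<in>(`) p ` S. w W)"
    have wW: "w (p ` U) \<in> p ` U" "w (p ` U) \<in> carrier Y" if "U \<in> S" for U
    proof -
      show "w (p ` U) \<in> p ` U" using PiE_mem[OF conjunct1[OF w], of "p ` U"] that by blast
      then show "w (p ` U) \<in> carrier Y" using image_mono[OF subX[OF that], of p] im by auto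
    qed
    let ?w = "\<lambda>U\<in>S. ?q (w (p ` U))"
    have wU: "?w U \<in> U" "?w U \<in> carrier X" if "U \<in> S" for U
    proof -
      obtain x where "x \<in> U" "w (p ` U) = p x" using wW(1)[OF \<open>U \<in> S\<close>] by blast
      then show "?w U \<in> U" "?w U \<in> carrier X" using that subX[OF that] qp by auto
    qed
    have "v = (\<Oplus>\<^bsub>Y\<^esub>U\<in>S. w (p ` U))" using w reindex wW by simp
    then have "?q v = (\<Oplus>\<^bsub>X\<^esub>U\<in>S. ?q (w (p ` U)))"
      using gmodule_hom_finsum[OF Y X q fin] wW by simp
    also have "\<dots> = (\<Oplus>\<^bsub>X\<^esub>U\<in>S. ?w U)"
      by (rule X.add.finprod_cong') (use wU wW pq in auto)
    finally have qv: "?q v = (\<Oplus>\<^bsub>X\<^esub>U\<in>S. ?w U)" .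
    have "?w \<in> (\<Pi>\<^sub>E U\<in>S. U)"
      unfolding PiE_iff using wU(1) by simp
    then have "?w = u" using qv by (rule uniq)
    have wu: "?q (w (p ` U)) = u U" if "U \<in> S" for U
      using fun_cong[OF \<open>?w = u\<close>, of U] that by (metis (no_types, lifting) restrict_apply')
    have "w (p ` U) = p (u U)" if "U \<in> S" for U
      using wu[OF that] pq(1)[OF wW(2)[OF that]] by simp
    then have "w W = ?u W" if "W \<in> (`) p ` S" for W using that u1 by auto
    moreover have "w \<in> extensional ((`) p ` S)" using w by (simp add: PiE_def)
    ultimately show "w = ?u"
      by (intro extensionalityI[of _ "(`) p ` S"]) (auto simp only: restrict_extensional)
  qed
qed

lemma gmodule_hom_comp:
  assumes "p \<in> gmodule_hom G X Y" "q \<in> gmodule_hom G Y Z"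
  shows "q \<circ> p \<in> gmodule_hom G X Z"
  using assms by (auto simp: gmodule_hom_iff)

lemma multiplicity_free_iso:
  assumes X: "gmodule G X" and Y: "gmodule G Y" and p: "p \<in> gmodule_hom G X Y"
    and bij: "bij_betw p (carrier X) (carrier Y)" and mf: "multiplicity_free G X"
  shows "multiplicity_free G Y"
  unfolding multiplicity_free_def
proof (intro conjI allI impI ballI notI)
  show "\<exists>S. irreducible_decomposition G Y S"
    using mf irreducible_decomposition_iso[OF X Y p bij] by (auto simp: multiplicity_free_def)
next
  let ?q = "the_inv_into (carrier X) p"
  have q: "?q \<in> gmodule_hom G Y X" by (rule gmodule_hom_inverse[OF X Y p bij])
  have bijq: "bij_betw ?q (carrier Y) (carrier X)" by (rule bij_betw_the_inv_into[OF bij])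
  fix S U W assume S: "irreducible_decomposition G Y S" and UW: "U \<in> S" "W \<in> S" "U \<noteq> W"
    and "gmodule_iso G (Y\<lparr>carrier := U\<rparr>) (Y\<lparr>carrier := W\<rparr>)"
  then obtain r where r: "r \<in> gmodule_hom G (Y\<lparr>carrier := U\<rparr>) (Y\<lparr>carrier := W\<rparr>)" "bij_betw r U W"
    by (auto simp: gmodule_iso_def)
  have sub: "gsubmodule G Y U" "gsubmodule G Y W" using S UW by (auto simp: irreducible_decomposition_def)
  then have subY: "U \<subseteq> carrier Y" "W \<subseteq> carrier Y" by (auto simp: gsubmodule_iff[OF Y])
  have injq: "inj_on ?q (carrier Y)" using bijq by (simp add: bij_betw_def)
  have *: "?q ` U \<noteq> ?q ` W" using inj_on_image_eq_iff[OF injq subY] UW(3) by simp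
  have qU: "?q \<in> gmodule_hom G (Y\<lparr>carrier := U\<rparr>) (X\<lparr>carrier := ?q ` U\<rparr>)"
    "?q \<in> gmodule_hom G (Y\<lparr>carrier := W\<rparr>) (X\<lparr>carrier := ?q ` W\<rparr>)"
    using gmodule_hom_restrict[OF Y X q] sub by auto
  have bU: "bij_betw ?q U (?q ` U)" "bij_betw ?q W (?q ` W)"
    using inj_on_subset[OF injq] subY by (auto simp: bij_betw_def)
  have Us: "gmodule G (Y\<lparr>carrier := U\<rparr>)" "gmodule G (X\<lparr>carrier := ?q ` U\<rparr>)"
    using gmodule_gsubmodule[OF Y sub(1)] gmodule_gsubmodule[OF X gsubmodule_image[OF Y X q sub(1)]] by auto
  let ?t = "the_inv_into U ?q"
  have t: "?t \<in> gmodule_hom G (X\<lparr>carrier := ?q ` U\<rparr>) (Y\<lparr>carrier := U\<rparr>)"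
    using gmodule_hom_inverse[OF Us qU(1)] bU by auto
  \<comment> \<open>Conjugating \<open>r\<close> by \<open>?q\<close> turns two isomorphic summands
    of Y into two isomorphic summands of X.\<close>
  have "?q \<circ> (r \<circ> ?t) \<in> gmodule_hom G (X\<lparr>carrier := ?q ` U\<rparr>) (X\<lparr>carrier := ?q ` W\<rparr>)"
    using gmodule_hom_comp[OF gmodule_hom_comp[OF t r(1)] qU(2)] by simp
  moreover have "bij_betw (?q \<circ> (r \<circ> ?t)) (?q ` U) (?q ` W)"
    using bij_betw_trans[OF bij_betw_trans[OF bij_betw_the_inv_into[OF bU(1)] r(2)] bU(2)] by (simp add: o_assoc)
  ultimately have "gmodule_iso G (X\<lparr>carrier := ?q ` U\<rparr>) (X\<lparr>carrier := ?q ` W\<rparr>)"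
    by (auto simp: gmodule_iso_def)
  moreover have "irreducible_decomposition G X ((`) ?q ` S)"
    by (rule irreducible_decomposition_iso[OF Y X q bijq S])
  moreover have "?q ` U \<in> (`) ?q ` S" "?q ` W \<in> (`) ?q ` S" using UW by simp_all
  ultimately show False using mf * unfolding multiplicity_free_def by meson
qed

section \<open>Modules of finitely supported functions\<close>

abbreviation "keys \<equiv> Poly_Mapping.keys"
abbreviation "lookup \<equiv> Poly_Mapping.lookup"
abbreviation "single \<equiv> Poly_Mapping.single"

abbreviation scale :: "'f::field \<Rightarrow> ('b \<Rightarrow>\<^sub>0 'f) \<Rightarrow> ('b \<Rightarrow>\<^sub>0 'f)" where
  "scale c \<equiv> Poly_Mapping.map ((*) c)"

lemma lookup_scale [simp]: "lookup (scale c v) k = c * lookup v k"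
  by (simp add: Poly_Mapping.map.rep_eq when_def)

lemma keys_scale: "keys (scale c v) \<subseteq> keys v"
  by (auto simp: in_keys_iff)

lemma keys_subset:
  "keys v \<subseteq> B \<Longrightarrow> keys (scale c v) \<subseteq> B"
  "keys v \<subseteq> B \<Longrightarrow> keys w \<subseteq> B \<Longrightarrow> keys (v + w) \<subseteq> B"
  "keys v \<subseteq> B \<Longrightarrow> keys w \<subseteq> B \<Longrightarrow> keys (v - w) \<subseteq> B"
  using keys_scale[of c v] Poly_Mapping.keys_add[of v w] keys_diff[of v w] by blast+

lemma scale_simps [simp]:
  "scale c 0 = 0" "scale 0 v = 0" "scale 1 v = v" "scale c (v + w) = scale c v + scale c w"
  "scale c (v - w) = scale c v - scale c w" "scale c (scale d v) = scale (c * d) v"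
  "scale c (single k d) = single k (c * d)"
  by (auto intro!: poly_mapping_eqI simp: lookup_add lookup_minus algebra_simps lookup_single when_def)

lemma scale_add_left: "scale (c + d) v = scale c v + scale d v"
  by (auto intro!: poly_mapping_eqI simp: lookup_add algebra_simps)

lemma scale_sum: "scale c (\<Sum>a\<in>A. x a) = (\<Sum>a\<in>A. scale c (x a))"
  by (induction A rule: infinite_finite_induct) auto

lemma scale_minus_one: "scale (-1) v = - v"
  by (auto intro!: poly_mapping_eqI)

text \<open>Linear extension of a map given on basis vectors; the monomial actions and the
  comparison maps below are written with it.\<close>

definition plin :: "('b \<Rightarrow> 'c \<Rightarrow>\<^sub>0 'f::field) \<Rightarrow> ('b \<Rightarrow>\<^sub>0 'f) \<Rightarrow> ('c \<Rightarrow>\<^sub>0 'f)" where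
  "plin \<psi> x = (\<Sum>b\<in>keys x. scale (lookup x b) (\<psi> b))"

lemma plin_superset:
  assumes "finite A" "keys x \<subseteq> A"
  shows "plin \<psi> x = (\<Sum>b\<in>A. scale (lookup x b) (\<psi> b))"
  unfolding plin_def
  by (rule sum.mono_neutral_left) (use assms in \<open>auto simp: in_keys_iff\<close>)

lemma plin_zero [simp]: "plin \<psi> 0 = 0"
  by (simp add: plin_def)

lemma plin_add: "plin \<psi> (x + y) = plin \<psi> x + plin \<psi> y"
proof -
  let ?A = "keys x \<union> keys y"
  have "keys (x + y) \<subseteq> ?A" by (rule Poly_Mapping.keys_add)
  then show ?thesis
    by (simp add: plin_superset[of ?A] lookup_add scale_add_left sum.distrib)
qed

lemma plin_scale: "plin \<psi> (scale c x) = scale c (plin \<psi> x)"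
  by (simp add: plin_superset[OF _ keys_scale] plin_superset[of "keys x" x] scale_sum)

lemma plin_uminus: "plin \<psi> (- x) = - plin \<psi> x"
  using plin_scale[of \<psi> "-1" x] by (simp add: scale_minus_one)

lemma plin_minus: "plin \<psi> (x - y) = plin \<psi> x - plin \<psi> y"
  using plin_add[of \<psi> x "- y"] by (simp add: plin_uminus)

lemma plin_sum: "plin \<psi> (\<Sum>a\<in>A. x a) = (\<Sum>a\<in>A. plin \<psi> (x a))"
  by (induction A rule: infinite_finite_induct) (auto simp: plin_add)

lemma plin_single [simp]: "plin \<psi> (single b c) = scale c (\<psi> b)"
  by (cases "c = 0") (simp_all add: plin_def)

lemma plin_single_id: "plin (\<lambda>b. single b 1) x = x"
  by (auto intro!: poly_mapping_eqI simp: plin_def lookup_sum lookup_single when_def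
      sum.delta in_keys_iff)

lemma plin_cong:
  assumes "\<And>b. b \<in> keys x \<Longrightarrow> \<psi> b = \<phi> b"
  shows "plin \<psi> x = plin \<phi> x"
  by (simp add: plin_def assms)

lemma plin_plin: "plin \<phi> (plin \<psi> x) = plin (\<lambda>b. plin \<phi> (\<psi> b)) x"
  by (simp add: plin_def[of \<psi>] plin_def[of "\<lambda>b. plin \<phi> (\<psi> b)"] plin_sum plin_scale)

lemma lookup_plin: "lookup (plin \<psi> x) y =
    (\<Sum>b\<in>keys x. lookup x b * lookup (\<psi> b) y)"
  by (simp add: plin_def lookup_sum)

lemma keys_sum_subset:
  assumes "\<And>a. a \<in> A \<Longrightarrow> keys (x a) \<subseteq> Y"
  shows "keys (\<Sum>a\<in>A. x a) \<subseteq> Y"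
  using assms Poly_Mapping.keys_sum[of x A] by (rule_tac order_trans) (assumption, rule UN_least)

lemma keys_plin:
  assumes "\<And>b. b \<in> keys x \<Longrightarrow> keys (\<psi> b) \<subseteq> Y"
  shows "keys (plin \<psi> x) \<subseteq> Y"
  unfolding plin_def
  by (rule keys_sum_subset) (rule order_trans[OF keys_scale assms])

text \<open>Only the vector space part of the record is fixed, so the same facts serve modules with
  different actions.\<close>

definition pm_space :: "'b set \<Rightarrow> ('f::field, 'b \<Rightarrow>\<^sub>0 'f, 'y) module_scheme \<Rightarrow> bool" where
  "pm_space Y V \<longleftrightarrow> carrier V = {x. keys x \<subseteq> Y} \<and> zero V = 0 \<and> add V = (+)
     \<and> smult V = scale"

lemma pm_space_vectorspace:
  fixes V :: "('f::field, 'b \<Rightarrow>\<^sub>0 'f, 'y) module_scheme"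
  assumes "pm_space Y V"
  shows "vectorspace class_ring V"
proof -
  have [simp]: "carrier V = {x. keys x \<subseteq> Y}" "zero V = 0" "add V = (+)" "smult V = scale"
    using assms by (auto simp: pm_space_def)
  show ?thesis
  proof (rule vs_criteria)
    show "field (class_ring :: 'f ring)" by unfold_locales
    show "\<forall>v w. v \<in> carrier V \<and> w \<in> carrier V \<longrightarrow> v \<oplus>\<^bsub>V\<^esub> w \<in> carrier V"
      by (auto intro!: keys_subset del: subsetI)
    show "\<forall>v\<in>carrier V. \<exists>neg_v\<in>carrier V. v \<oplus>\<^bsub>V\<^esub> neg_v = \<zero>\<^bsub>V\<^esub>"
    proof
      fix v assume "v \<in> carrier V"
      then show "\<exists>neg_v\<in>carrier V. v \<oplus>\<^bsub>V\<^esub> neg_v = \<zero>\<^bsub>V\<^esub>" by (intro bexI[of _ "- v"]) auto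
    qed
    show "\<forall>c v. c \<in> carrier (class_ring :: 'f ring) \<and> v \<in> carrier V \<longrightarrow> c \<odot>\<^bsub>V\<^esub> v \<in> carrier V"
      by (auto intro!: keys_subset del: subsetI)
  qed (auto simp: algebra_simps scale_add_left)
qed

lemma pm_space_finsum:
  fixes V :: "('f::field, 'b \<Rightarrow>\<^sub>0 'f, 'y) module_scheme"
  assumes "pm_space Y V" "finite A" "\<And>a. a \<in> A \<Longrightarrow> x a \<in> carrier V"
  shows "(\<Oplus>\<^bsub>V\<^esub>a\<in>A. x a) = (\<Sum>a\<in>A. x a)"
proof -
  interpret vectorspace class_ring V by (rule pm_space_vectorspace[OF assms(1)])
  have [simp]: "zero V = 0" "add V = (+)" using assms(1) by (auto simp: pm_space_def)
  show ?thesis using assms(2,3)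
  proof (induction A rule: finite_induct)
    case (insert a A)
    then have "(\<Oplus>\<^bsub>V\<^esub>b\<in>insert a A. x b) = x a \<oplus>\<^bsub>V\<^esub> (\<Oplus>\<^bsub>V\<^esub>b\<in>A. x b)"
      by (intro finsum_insert) auto
    then show ?case using insert by simp
  qed simp
qed

section \<open>Free modules, transport of structure, monomial modules\<close>

lemma free_gmodule_pm_space: "pm_space B (free_gmodule B k)"
  by (simp add: pm_space_def free_gmodule_def)

lemma act_free_gmodule:
  "act (free_gmodule B k) g x = plin (\<lambda>b. single (k g b) 1) x"
  by (simp add: free_gmodule_def plin_def)

text \<open>Every module axiom of \<open>P\<close> becomes an axiom of \<open>W\<close> after
  applying the injective map \<open>p\<close>. This spares any reasoning about operations on cosets,
  which is how the operations of the presented modules are defined.\<close>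

lemma gmodule_transport:
  fixes P :: "('f::field, 'v, 'g, 'y) gmodule_scheme" and W :: "('f, 'w, 'g, 'z) gmodule_scheme"
  assumes W: "gmodule G W" and bij: "bij_betw p (carrier P) (carrier W)"
    and zero: "\<zero>\<^bsub>P\<^esub> \<in> carrier P" "p \<zero>\<^bsub>P\<^esub> = \<zero>\<^bsub>W\<^esub>"
    and add: "\<And>x y. \<lbrakk>x \<in> carrier P; y \<in> carrier P\<rbrakk> \<Longrightarrow> x \<oplus>\<^bsub>P\<^esub> y \<in> carrier P \<and> p (x \<oplus>\<^bsub>P\<^esub> y) = p x \<oplus>\<^bsub>W\<^esub> p y"
    and smult: "\<And>c x. x \<in> carrier P \<Longrightarrow> c \<odot>\<^bsub>P\<^esub> x \<in> carrier P \<and> p (c \<odot>\<^bsub>P\<^esub> x) = c \<odot>\<^bsub>W\<^esub> p x"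
    and act: "\<And>g x. \<lbrakk>g \<in> carrier G; x \<in> carrier P\<rbrakk> \<Longrightarrow> act P g x \<in> carrier P \<and> p (act P g x) = act W g (p x)"
  shows "gmodule G P" and "p \<in> gmodule_hom G P W"
proof -
  interpret W: vectorspace class_ring W by (rule gmodule_vectorspace[OF W])
  have inj: "\<And>x y. x \<in> carrier P \<Longrightarrow> y \<in> carrier P \<Longrightarrow> p x = p y \<Longrightarrow> x = y"
    and im: "p ` carrier P = carrier W"
    using bij by (auto simp: bij_betw_def inj_on_def)
  have pc: "p x \<in> carrier W" if "x \<in> carrier P" for x using im that by auto
  show "p \<in> gmodule_hom G P W"
    using add smult act pc by (auto simp: gmodule_hom_iff)
  show "gmodule G P"
  proof (rule gmoduleI)
    show "Group.group G" by (rule gmodule_group[OF W])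
    show "vectorspace class_ring P"
    proof (rule vs_criteria)
      show "field (class_ring :: 'f ring)" by unfold_locales
      show "\<forall>v\<in>carrier P. \<exists>neg_v\<in>carrier P. v \<oplus>\<^bsub>P\<^esub> neg_v = \<zero>\<^bsub>P\<^esub>"
      proof
        fix v assume v: "v \<in> carrier P"
        then have "p v \<in> carrier W" using im by auto
        then have "\<ominus>\<^bsub>W\<^esub> p v \<in> p ` carrier P" unfolding im by simp
        then obtain w where w: "w \<in> carrier P" "p w = \<ominus>\<^bsub>W\<^esub> p v" by auto
        then have "p (v \<oplus>\<^bsub>P\<^esub> w) = \<zero>\<^bsub>W\<^esub>" using v add \<open>p v \<in> carrier W\<close> by (simp add: W.r_neg)
        then show "\<exists>neg_v\<in>carrier P. v \<oplus>\<^bsub>P\<^esub> neg_v = \<zero>\<^bsub>P\<^esub>"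
          using inj v w zero add by (intro bexI[of _ w]) auto
      qed
    qed (use zero add smult pc W.smult_l_distr W.smult_r_distr W.smult_assoc1 W.smult_one W.a_assoc W.a_comm W.r_zero
        in \<open>auto intro!: inj\<close>)
    show "act P (g \<otimes>\<^bsub>G\<^esub> h) v = act P g (act P h v)"
      if "g \<in> carrier G" "h \<in> carrier G" "v \<in> carrier P" for g h v
      using that act gmodule.act_mult[OF W] pc gmodule_group[OF W]
      by (auto intro!: inj simp: group.is_monoid monoid.m_closed)
    show "act P \<one>\<^bsub>G\<^esub> v = v" if "v \<in> carrier P" for v
      using that act[of "\<one>\<^bsub>G\<^esub>" v] gmodule.act_one[OF W] pc gmodule_group[OF W]
      by (auto intro!: inj simp: group.is_monoid monoid.one_closed)
    fix g v w c assume g: "g \<in> carrier G" and v: "v \<in> carrier P"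
    show "act P g v \<in> carrier P" using act[OF g v] by blast
    have "p (act P g (c \<odot>\<^bsub>P\<^esub> v)) = p (c \<odot>\<^bsub>P\<^esub> act P g v)"
      using act[OF g] smult v pc gmodule_act(3)[OF W g] by simp
    then show "act P g (c \<odot>\<^bsub>P\<^esub> v) = c \<odot>\<^bsub>P\<^esub> act P g v"
      by (rule inj[rotated 2]) (simp_all add: act[OF g] smult v)
    assume w: "w \<in> carrier P"
    have "p (act P g (v \<oplus>\<^bsub>P\<^esub> w)) = p (act P g v \<oplus>\<^bsub>P\<^esub> act P g w)"
      using act[OF g] add v w pc gmodule_act(2)[OF W g] by simp
    then show "act P g (v \<oplus>\<^bsub>P\<^esub> w) = act P g v \<oplus>\<^bsub>P\<^esub> act P g w"
      by (rule inj[rotated 2]) (simp_all add: act[OF g] add v w)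
  qed
qed

definition monomial_gmodule ::
  "'b set \<Rightarrow> ('g \<Rightarrow> 'b \<Rightarrow> 'b) \<Rightarrow> ('g \<Rightarrow> 'b \<Rightarrow> 'f) \<Rightarrow> ('f::field, 'b \<Rightarrow>\<^sub>0 'f, 'g) gmodule" where
  "monomial_gmodule B k c =
     (free_gmodule B k)\<lparr>act := \<lambda>g. plin (\<lambda>b. single (k g b) (c g b))\<rparr>"

lemma monomial_gmodule_simps:
  "carrier (monomial_gmodule B k c) = {x. keys x \<subseteq> B}"
  "zero (monomial_gmodule B k c) = 0" "add (monomial_gmodule B k c) = (+)"
  "smult (monomial_gmodule B k c) = scale"
  "act (monomial_gmodule B k c) g = plin (\<lambda>b. single (k g b) (c g b))"
  by (simp_all add: monomial_gmodule_def free_gmodule_def)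

lemma monomial_gmodule_pm_space: "pm_space B (monomial_gmodule B k c)"
  by (simp add: pm_space_def monomial_gmodule_simps)

text \<open>The second half of \<open>mult\<close> is the cocycle identity for the scalars
  \<open>c\<close> with respect to the action \<open>k\<close> on indices.\<close>

lemma gmodule_monomial:
  assumes G: "Group.group G"
    and k: "\<And>g b. g \<in> carrier G \<Longrightarrow> b \<in> B \<Longrightarrow> k g b \<in> B"
    and one: "\<And>b. b \<in> B \<Longrightarrow> k \<one>\<^bsub>G\<^esub> b = b \<and> c \<one>\<^bsub>G\<^esub> b = 1"
    and mult: "\<And>g h b. \<lbrakk>g \<in> carrier G; h \<in> carrier G; b \<in> B\<rbrakk>
      \<Longrightarrow> k (g \<otimes>\<^bsub>G\<^esub> h) b = k g (k h b) \<and> c (g \<otimes>\<^bsub>G\<^esub> h) b = c g (k h b) * c h b"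
  shows "gmodule G (monomial_gmodule B k c)"
proof (rule gmoduleI)
  show "vectorspace class_ring (monomial_gmodule B k c)"
    by (rule pm_space_vectorspace[OF monomial_gmodule_pm_space])
  show "act (monomial_gmodule B k c) \<one>\<^bsub>G\<^esub> v = v" if "v \<in> carrier (monomial_gmodule B k c)" for v
  proof -
    have "act (monomial_gmodule B k c) \<one>\<^bsub>G\<^esub> v = plin (\<lambda>b. single b 1) v"
      unfolding monomial_gmodule_simps
      by (rule plin_cong) (use that one in \<open>auto simp: monomial_gmodule_simps\<close>)
    then show ?thesis by (simp add: plin_single_id)
  qed
  show "act (monomial_gmodule B k c) (g \<otimes>\<^bsub>G\<^esub> h) v
      = act (monomial_gmodule B k c) g (act (monomial_gmodule B k c) h v)"
    if "g \<in> carrier G" "h \<in> carrier G" "v \<in> carrier (monomial_gmodule B k c)" for g h v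
    unfolding monomial_gmodule_simps plin_plin
    by (rule plin_cong) (use that mult in \<open>auto simp: monomial_gmodule_simps mult.commute subset_iff\<close>)
  show "act (monomial_gmodule B k c) g v \<in> carrier (monomial_gmodule B k c)"
    if "g \<in> carrier G" "v \<in> carrier (monomial_gmodule B k c)" for g v
    unfolding monomial_gmodule_simps mem_Collect_eq
    by (rule keys_plin) (use that k in \<open>auto simp: monomial_gmodule_simps subset_iff\<close>)
qed (use G in \<open>auto simp: monomial_gmodule_simps plin_add plin_scale\<close>)

subsection \<open>Presented modules\<close>

context
  fixes G :: "('g, 'x) monoid_scheme" and W :: "('f::field, 'y \<Rightarrow>\<^sub>0 'f, 'g, 'z) gmodule_scheme"
    and B :: "'b set" and k :: "'g \<Rightarrow> 'b \<Rightarrow> 'b" and E :: "('b \<Rightarrow>\<^sub>0 'f) set"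
    and Y :: "'y set" and \<psi> :: "'b \<Rightarrow> ('y \<Rightarrow>\<^sub>0 'f)" and \<sigma> :: "'y \<Rightarrow> 'b"
  assumes W: "gmodule G W" and pm: "pm_space Y W"
    and k: "\<And>g b. g \<in> carrier G \<Longrightarrow> b \<in> B \<Longrightarrow> k g b \<in> B"
    and \<psi>: "\<And>b. b \<in> B \<Longrightarrow> keys (\<psi> b) \<subseteq> Y"
    and E: "\<And>e. e \<in> E \<Longrightarrow> keys e \<subseteq> B \<and> plin \<psi> e = 0"
    and act: "\<And>g b. g \<in> carrier G \<Longrightarrow> b \<in> B \<Longrightarrow> \<psi> (k g b) = act W g (\<psi> b)"
    and \<sigma>: "\<And>y. y \<in> Y \<Longrightarrow> \<sigma> y \<in> B \<and> \<psi> (\<sigma> y) = single y 1"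
    and sec: "\<And>b. b \<in> B \<Longrightarrow> single b 1 - plin (\<lambda>y. single (\<sigma> y) 1) (\<psi> b)
      \<in> LinearCombinations.module.span class_ring (free_gmodule B k) E"
begin

private abbreviation "N \<equiv> LinearCombinations.module.span class_ring (free_gmodule B k) E"
private abbreviation "fib w \<equiv> {x. keys x \<subseteq> B \<and> plin \<psi> x = w}"

private lemma simps: "carrier W = {x. keys x \<subseteq> Y}" "zero W = 0" "add W = (+)" "smult W = scale"
  using pm by (auto simp: pm_space_def)

private lemma free_simps: "carrier (free_gmodule B k) = {x. keys x \<subseteq> B}"
  "zero (free_gmodule B k) = 0" "add (free_gmodule B k) = (+)" "smult (free_gmodule B k) = scale"
  by (simp_all add: free_gmodule_def)

text \<open>The linear extension of \<open>\<psi>\<close> kills the relators, so their span lies in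
  its kernel. Equality is due to \<open>sec\<close>: modulo relators every generator is a
  combination of representatives \<open>\<sigma> y\<close>, and these are mapped to the basis of
  \<open>W\<close>. Consequently the cosets of the span are the fibres \<open>fib w\<close>.\<close>

lemma span_relators: "N = fib 0"
proof
  interpret V: vectorspace class_ring "free_gmodule B k :: ('f, 'b \<Rightarrow>\<^sub>0 'f, 'g) gmodule"
    by (rule pm_space_vectorspace[OF free_gmodule_pm_space])
  have sub: "E \<subseteq> carrier (free_gmodule B k)" using E by (auto simp: free_simps)
  have N: "submodule class_ring N (free_gmodule B k)" by (rule V.span_is_submodule[OF sub])
  have closed: "x + y \<in> N" "scale c x \<in> N" "0 \<in> N" if "x \<in> N" "y \<in> N" for x y c
    using submodule.m_closed[OF N that] submodule.smult_closed[OF N, of c x] submodule.zero_closed[OF N] that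
    by (auto simp: free_simps)
  have zero: "0 \<in> N" using submodule.zero_closed[OF N] by (simp add: free_simps)
  show "N \<subseteq> fib 0"
  proof (rule V.span_is_subset)
    show "E \<subseteq> fib 0" using E by auto
    show "submodule class_ring (fib 0) (free_gmodule B k)"
      by (rule submodule.intro[OF V.module_axioms], force simp: free_simps)
        (auto simp: free_simps plin_add plin_scale intro!: keys_subset del: subsetI)
  qed
  have sumN: "(\<Sum>a\<in>A. f a) \<in> N" if "\<And>a. a \<in> A \<Longrightarrow> f a \<in> N" for f :: "'b \<Rightarrow> ('b \<Rightarrow>\<^sub>0 'f)" and A
    using that by (induction A rule: infinite_finite_induct) (auto intro: closed zero)
  show "fib 0 \<subseteq> N"
  proof
    fix x assume x: "x \<in> fib 0"
    let ?s = "\<lambda>b. single b 1 - plin (\<lambda>y. single (\<sigma> y) 1) (\<psi> b)"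
    \<comment> \<open>The subtracted term is zero because \<open>x\<close> lies in the kernel; it is
      there so that \<open>x\<close> becomes a combination of the elements provided by
      \<open>sec\<close>.\<close>
    have "x = plin (\<lambda>b. single b 1) x - plin (\<lambda>y. single (\<sigma> y) 1) (plin \<psi> x)"
      using x by (simp add: plin_single_id)
    also have "\<dots> = (\<Sum>b\<in>keys x. scale (lookup x b) (?s b))"
      unfolding plin_plin by (simp add: plin_def sum_subtractf)
    also have "\<dots> \<in> N"
    proof (rule sumN)
      fix b assume "b \<in> keys x"
      then have "?s b \<in> N" using sec x by blast
      then show "scale (lookup x b) (?s b) \<in> N" by (rule closed(2)) (rule zero)
    qed
    finally show "x \<in> N" .
  qed
qed

private lemma fib_nonempty:
  assumes "keys w \<subseteq> Y"
  obtains x where "x \<in> fib w"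
proof
  let ?x = "plin (\<lambda>y. single (\<sigma> y) 1) w"
  have "plin \<psi> ?x = plin (\<lambda>y. single y 1) w"
    unfolding plin_plin by (rule plin_cong) (use \<sigma> assms in auto)
  moreover have "keys ?x \<subseteq> B"
    by (rule keys_plin) (use \<sigma> assms in auto)
  ultimately show "?x \<in> fib w" by (simp add: plin_single_id)
qed

private lemma coset: "keys x \<subseteq> B \<Longrightarrow> N +>\<^bsub>free_gmodule B k\<^esub> x = fib (plin \<psi> x)"
  unfolding span_relators
proof (intro equalityI subsetI)
  fix y assume x: "keys x \<subseteq> B" and "y \<in> fib (plin \<psi> x)"
  then have "y - x \<in> fib 0" by (auto simp: plin_minus intro!: keys_subset del: subsetI)
  then show "y \<in> fib 0 +>\<^bsub>free_gmodule B k\<^esub> x"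
    by (auto simp: a_r_coset_def' free_simps intro!: bexI[of _ "y - x"])
next
  fix y assume x: "keys x \<subseteq> B" and "y \<in> fib 0 +>\<^bsub>free_gmodule B k\<^esub> x"
  then obtain n where "n \<in> fib 0" "y = n + x" by (auto simp: a_r_coset_def' free_simps)
  then show "y \<in> fib (plin \<psi> x)" using x by (auto simp: plin_add intro!: keys_subset del: subsetI)
qed

lemma carrier_presented: "carrier (presented_gmodule B k E) = fib ` carrier W"
proof -
  have "carrier (presented_gmodule B k E) = {fib (plin \<psi> x) |x. keys x \<subseteq> B}"
    using coset by (auto simp: presented_gmodule_def quotient_gmodule_def A_RCOSETS_def' free_simps)
  also have "\<dots> = fib ` carrier W"
  proof (intro equalityI subsetI)
    fix A assume "A \<in> {fib (plin \<psi> x) |x. keys x \<subseteq> B}"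
    then obtain x where x: "A = fib (plin \<psi> x)" "keys x \<subseteq> B" by auto
    have "keys (plin \<psi> x) \<subseteq> Y" by (rule keys_plin) (use x \<psi> in auto)
    then show "A \<in> fib ` carrier W" using x by (auto simp: simps)
  next
    fix A assume "A \<in> fib ` carrier W"
    then obtain w where "A = fib w" "keys w \<subseteq> Y" by (auto simp: simps)
    then show "A \<in> {fib (plin \<psi> x) |x. keys x \<subseteq> B}" using fib_nonempty by blast
  qed
  finally show ?thesis .
qed

lemma presented_ops:
  assumes v: "v \<in> carrier W" and w: "w \<in> carrier W"
  shows "zero (presented_gmodule B k E) = fib 0"
    and "fib v \<oplus>\<^bsub>presented_gmodule B k E\<^esub> fib w = fib (v + w)"
    and "c \<odot>\<^bsub>presented_gmodule B k E\<^esub> fib v = fib (scale c v)"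
    and "g \<in> carrier G \<Longrightarrow> act (presented_gmodule B k E) g (fib v) = fib (act W g v)"
proof -
  show "zero (presented_gmodule B k E) = fib 0"
    by (simp add: presented_gmodule_def quotient_gmodule_def span_relators)
  obtain x where x: "x \<in> fib v" using fib_nonempty v by (auto simp: simps)
  have "fib v <+>\<^bsub>free_gmodule B k\<^esub> fib w = fib (v + w)"
  proof (intro equalityI subsetI)
    fix z assume "z \<in> fib v <+>\<^bsub>free_gmodule B k\<^esub> fib w"
    then obtain a b where "a \<in> fib v" "b \<in> fib w" "z = a + b"
      by (auto simp: set_add_def' free_simps)
    then show "z \<in> fib (v + w)" by (auto simp: plin_add intro!: keys_subset del: subsetI)
  next
    fix z assume z: "z \<in> fib (v + w)"
    then have "z - x \<in> fib w" using x by (auto simp: plin_minus intro!: keys_subset del: subsetI)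
    then show "z \<in> fib v <+>\<^bsub>free_gmodule B k\<^esub> fib w"
      using x unfolding set_add_def' free_simps UN_iff by (intro bexI[of _ x] bexI[of _ "z - x"]) auto
  qed
  then show "fib v \<oplus>\<^bsub>presented_gmodule B k E\<^esub> fib w = fib (v + w)"
    by (simp add: presented_gmodule_def quotient_gmodule_def)
  have "(\<Union>x\<in>fib v. N +>\<^bsub>free_gmodule B k\<^esub> scale c x) = (\<Union>x\<in>fib v. fib (scale c v))"
    by (rule SUP_cong[OF refl], subst coset) (auto simp: plin_scale intro!: keys_subset del: subsetI)
  then show "c \<odot>\<^bsub>presented_gmodule B k E\<^esub> fib v = fib (scale c v)"
    using x by (auto simp: presented_gmodule_def quotient_gmodule_def free_simps)
  assume g: "g \<in> carrier G"
  have "N +>\<^bsub>free_gmodule B k\<^esub> act (free_gmodule B k) g x = fib (act W g v)" if x: "x \<in> fib v" for x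
  proof -
    have "keys (act (free_gmodule B k) g x) \<subseteq> B"
      unfolding act_free_gmodule by (rule keys_plin) (use k[OF g] x in auto)
    moreover have "plin \<psi> (act (free_gmodule B k) g x) = act W g v"
    proof -
      have act_sum: "act W g (\<Sum>b\<in>A. scale (c b) (\<psi> b)) = (\<Sum>b\<in>A. scale (c b) (act W g (\<psi> b)))
          \<and> keys (\<Sum>b\<in>A. scale (c b) (\<psi> b)) \<subseteq> Y"
        if "finite A" "A \<subseteq> B" for A and c :: "'b \<Rightarrow> 'f"
        using that
      proof (induction A rule: finite_induct)
        case empty
        have "act W g (scale 0 0) = scale 0 (act W g 0)"
          using gmodule_act(3)[OF W g, of 0 0] by (simp add: simps)
        then show ?case by simp
      next
        case (insert a A)
        have *: "\<psi> a \<in> carrier W" "scale (c a) (\<psi> a) \<in> carrier W" "(\<Sum>b\<in>A. scale (c b) (\<psi> b)) \<in> carrier W"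
          using insert \<psi>[of a] by (auto simp: simps intro!: keys_subset del: subsetI)
        have "act W g (scale (c a) (\<psi> a) + (\<Sum>b\<in>A. scale (c b) (\<psi> b)))
          = scale (c a) (act W g (\<psi> a)) + act W g (\<Sum>b\<in>A. scale (c b) (\<psi> b))"
          using gmodule_act(2)[OF W g *(2,3)] gmodule_act(3)[OF W g *(1), of "c a"] by (simp add: simps)
        moreover have "keys (scale (c a) (\<psi> a) + (\<Sum>b\<in>A. scale (c b) (\<psi> b))) \<subseteq> Y"
          using * by (auto simp: simps intro!: keys_subset del: subsetI)
        ultimately show ?case using insert by simp
      qed
      have "plin \<psi> (act (free_gmodule B k) g x) = plin (\<lambda>b. act W g (\<psi> b)) x"
        unfolding act_free_gmodule plin_plin by (rule plin_cong) (use act[OF g] x in auto)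
      also have "\<dots> = act W g (plin \<psi> x)"
        unfolding plin_def using act_sum[of "keys x" "lookup x"] x by auto
      finally show ?thesis using x by simp
    qed
    ultimately show ?thesis using coset by simp
  qed
  then have "(\<Union>x\<in>fib v. N +>\<^bsub>free_gmodule B k\<^esub> act (free_gmodule B k) g x) = (\<Union>x\<in>fib v. fib (act W g v))"
    by (intro SUP_cong refl)
  then show "act (presented_gmodule B k E) g (fib v) = fib (act W g v)"
    using x by (auto simp: presented_gmodule_def quotient_gmodule_def)
qed

lemma the_elem_fib: "w \<in> carrier W \<Longrightarrow> the_elem (plin \<psi> ` fib w) = w"
proof -
  assume "w \<in> carrier W"
  then obtain x where "x \<in> fib w" using fib_nonempty by (auto simp: simps)
  then have "plin \<psi> ` fib w = {w}" by force
  then show ?thesis by simp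
qed

text \<open>\<open>plin \<psi>\<close> is constant on each coset and \<open>p\<close> reads off the
  common value, so \<open>p\<close> is inverse to \<open>fib\<close>.\<close>

lemma presented_gmodule_iso:
  defines "p \<equiv> \<lambda>A. the_elem (plin \<psi> ` A)"
  shows "gmodule G (presented_gmodule B k E)"
    and "p \<in> gmodule_hom G (presented_gmodule B k E) W"
    and "bij_betw p (carrier (presented_gmodule B k E)) (carrier W)"
    and "\<And>b. b \<in> B \<Longrightarrow> p (N +>\<^bsub>free_gmodule B k\<^esub> single b 1) = \<psi> b"
proof -
  interpret W: vectorspace class_ring W by (rule gmodule_vectorspace[OF W])
  have p: "p (fib w) = w" if "w \<in> carrier W" for w
    using the_elem_fib[OF that] by (simp add: p_def)
  show bij: "bij_betw p (carrier (presented_gmodule B k E)) (carrier W)"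
    unfolding carrier_presented by (rule bij_betw_byWitness[where f' = fib]) (auto simp: p)
  have zero: "0 \<in> carrier W" by (simp add: simps)
  have closed: "v + w \<in> carrier W" "scale c v \<in> carrier W"
    if "v \<in> carrier W" "w \<in> carrier W" for v w c
    using W.a_closed[OF that] W.smult_closed[of c v] that by (auto simp: simps)
  have *: "\<zero>\<^bsub>presented_gmodule B k E\<^esub> \<in> carrier (presented_gmodule B k E)"
    "p \<zero>\<^bsub>presented_gmodule B k E\<^esub> = \<zero>\<^bsub>W\<^esub>"
    unfolding carrier_presented presented_ops(1)[OF zero zero] using p[OF zero] zero by (auto simp: simps)
  have add: "x \<oplus>\<^bsub>presented_gmodule B k E\<^esub> y \<in> carrier (presented_gmodule B k E)
      \<and> p (x \<oplus>\<^bsub>presented_gmodule B k E\<^esub> y) = p x \<oplus>\<^bsub>W\<^esub> p y"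
    if xy: "x \<in> carrier (presented_gmodule B k E)" "y \<in> carrier (presented_gmodule B k E)" for x y
  proof -
    obtain v w where "v \<in> carrier W" "w \<in> carrier W" "x = fib v" "y = fib w"
      using xy unfolding carrier_presented by auto
    then show ?thesis unfolding carrier_presented
      using presented_ops(2)[of v w] closed(1)[of v w] p by (simp add: simps(3))
  qed
  have smult: "c \<odot>\<^bsub>presented_gmodule B k E\<^esub> x \<in> carrier (presented_gmodule B k E)
      \<and> p (c \<odot>\<^bsub>presented_gmodule B k E\<^esub> x) = c \<odot>\<^bsub>W\<^esub> p x"
    if xy: "x \<in> carrier (presented_gmodule B k E)" for c x
  proof -
    obtain v where "v \<in> carrier W" "x = fib v" using xy unfolding carrier_presented by auto
    then show ?thesis unfolding carrier_presented
      using presented_ops(3)[of v v] closed(2)[of v v] p by (simp add: simps(4))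
  qed
  have act: "act (presented_gmodule B k E) g x \<in> carrier (presented_gmodule B k E)
      \<and> p (act (presented_gmodule B k E) g x) = act W g (p x)"
    if g: "g \<in> carrier G" and xy: "x \<in> carrier (presented_gmodule B k E)" for g x
  proof -
    obtain v where "v \<in> carrier W" "x = fib v" using xy unfolding carrier_presented by auto
    then show ?thesis unfolding carrier_presented
      using presented_ops(4)[of v v g] gmodule_act(1)[OF W g, of v] g p by simp
  qed
  show "gmodule G (presented_gmodule B k E)"
    by (rule gmodule_transport(1)[OF W bij * add smult act])
  show "p \<in> gmodule_hom G (presented_gmodule B k E) W"
    by (rule gmodule_transport(2)[OF W bij * add smult act])
  fix b assume b: "b \<in> B"
  then have "N +>\<^bsub>free_gmodule B k\<^esub> single b 1 = fib (\<psi> b)"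
    using coset[of "single b 1"] by simp
  then show "p (N +>\<^bsub>free_gmodule B k\<^esub> single b 1) = \<psi> b"
    using p[of "\<psi> b"] \<psi>[OF b] by (simp add: simps)
qed

end

section \<open>The McLain group\<close>

text \<open>\<open>A\<close> may be any finite set containing the columns used by row
  \<open>a\<close> of \<open>x\<close>. This freedom allows several products to be expanded over one
  common index set and compared termwise.\<close>

lemma lookup_J_mult:
  fixes x y :: "'l \<times> 'l \<Rightarrow>\<^sub>0 'r::ring_1"
  assumes "finite A" "\<And>c. (a, c) \<in> keys x \<Longrightarrow> c \<in> A"
  shows "lookup (J_mult x y) (a, b)
    = (\<Sum>c\<in>A. lookup x (a, c) * lookup y (c, b))"
proof -
  let ?x = "lookup x" and ?y = "lookup y"
  let ?t = "\<lambda>p. if fst p = a then ?x p * ?y (snd p, b) else 0"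
  have inner: "(\<Sum>q\<in>keys y. lookup (if snd p = fst q
        then single (fst p, snd q) (?x p * ?y q) else 0) (a, b)) = ?t p" for p
  proof -
    have "(\<Sum>q\<in>keys y. lookup (if snd p = fst q
        then single (fst p, snd q) (?x p * ?y q) else 0) (a, b))
      = (\<Sum>q\<in>keys y. if q = (snd p, b) then (if fst p = a then ?x p * ?y q else 0) else 0)"
      by (rule sum.cong) (auto simp: lookup_single when_def)
    then show ?thesis by (auto simp: sum.delta in_keys_iff)
  qed
  have "lookup (J_mult x y) (a, b) = (\<Sum>p\<in>keys x. ?t p)"
    unfolding J_mult_def lookup_sum inner ..
  also have "\<dots> = (\<Sum>p\<in>Pair a ` A. ?t p)"
    by (rule sum.mono_neutral_cong) (use assms in \<open>auto simp: in_keys_iff image_iff\<close>)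
  also have "\<dots> = (\<Sum>c\<in>A. ?x (a, c) * ?y (c, b))"
    by (subst sum.reindex) (auto simp: inj_on_def)
  finally show ?thesis .
qed

lemma keys_J_mult:
  fixes x y :: "'l \<times> 'l \<Rightarrow>\<^sub>0 'r::ring_1"
  assumes "(a, b) \<in> keys (J_mult x y)"
  obtains c where "(a, c) \<in> keys x" "(c, b) \<in> keys y"
proof -
  let ?A = "snd ` keys x"
  have "(\<Sum>c\<in>?A. lookup x (a, c) * lookup y (c, b)) \<noteq> 0"
    using assms lookup_J_mult[of ?A a x y b] by (force simp: in_keys_iff)
  then obtain c where "lookup x (a, c) * lookup y (c, b) \<noteq> 0"
    using sum.not_neutral_contains_not_neutral by meson
  then show thesis by (intro that[of c]) (auto simp: in_keys_iff)
qed

lemma J_mult_zero [simp]: "J_mult 0 x = 0" "J_mult x 0 = 0"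
  by (simp_all add: J_mult_def)

lemma J_mult_add:
  fixes x y z :: "'l \<times> 'l \<Rightarrow>\<^sub>0 'r::ring_1"
  shows "J_mult (x + y) z = J_mult x z + J_mult y z"
    and "J_mult x (y + z) = J_mult x y + J_mult x z"
proof -
  let ?A = "snd ` keys x \<union> snd ` keys y"
  have A: "finite ?A" by simp
  have 1: "c \<in> ?A" if "(a, c) \<in> keys x" for a c using that by force
  have 2: "c \<in> ?A" if "(a, c) \<in> keys y" for a c using that by force
  have 3: "c \<in> ?A" if "(a, c) \<in> keys (x + y)" for a c
    using that Poly_Mapping.keys_add[of x y] by force
  show "J_mult (x + y) z = J_mult x z + J_mult y z"
    by (rule poly_mapping_eqI)
      (auto simp: lookup_add lookup_J_mult[OF A 1] lookup_J_mult[OF A 2] lookup_J_mult[OF A 3]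
        algebra_simps sum.distrib)
  show "J_mult x (y + z) = J_mult x y + J_mult x z"
    by (rule poly_mapping_eqI)
      (auto simp: lookup_add lookup_J_mult[OF A 1] algebra_simps sum.distrib)
qed

lemma J_mult_assoc:
  fixes x y z :: "'l \<times> 'l \<Rightarrow>\<^sub>0 'r::ring_1"
  shows "J_mult (J_mult x y) z = J_mult x (J_mult y z)"
proof (rule poly_mapping_eqI)
  fix k :: "'l \<times> 'l"
  obtain a b where k: "k = (a, b)" by fastforce
  let ?A = "snd ` keys x \<union> snd ` keys y"
  have A: "finite ?A" by simp
  have 1: "c \<in> ?A" if "(a, c) \<in> keys x" for a c using that by force
  have 2: "c \<in> ?A" if "(a, c) \<in> keys y" for a c using that by force
  have 3: "c \<in> ?A" if "(a, c) \<in> keys (J_mult x y)" for a c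
    using keys_J_mult[OF that] 2 by metis
  have xw: "lookup (J_mult x w) (a, b)
    = (\<Sum>c\<in>?A. lookup x (a, c) * lookup w (c, b))" for w a b
    by (rule lookup_J_mult[OF A]) (rule 1)
  have yz: "lookup (J_mult y z) (a, b)
    = (\<Sum>c\<in>?A. lookup y (a, c) * lookup z (c, b))" for a b
    by (rule lookup_J_mult[OF A]) (rule 2)
  have "lookup (J_mult (J_mult x y) z) (a, b)
    = (\<Sum>c\<in>?A. lookup (J_mult x y) (a, c) * lookup z (c, b))"
    by (rule lookup_J_mult[OF A]) (rule 3)
  also have "\<dots> = (\<Sum>c\<in>?A. \<Sum>e\<in>?A. lookup x (a, e) * lookup y (e, c)
      * lookup z (c, b))"
    by (simp only: xw sum_distrib_right)
  also have "\<dots> = (\<Sum>e\<in>?A. \<Sum>c\<in>?A. lookup x (a, e) * lookup y (e, c)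
      * lookup z (c, b))"
    by (rule sum.swap)
  also have "\<dots> = lookup (J_mult x (J_mult y z)) (a, b)"
    by (simp only: xw yz sum_distrib_left mult.assoc)
  finally show "lookup (J_mult (J_mult x y) z) k = lookup (J_mult x (J_mult y z)) k"
    by (simp only: k)
qed

lemma McLain_simps:
  "carrier McLain = {x. keys x \<subseteq> Phi}"
  "x \<otimes>\<^bsub>McLain\<^esub> y = x + y + J_mult x y" "\<one>\<^bsub>McLain\<^esub> = 0"
  by (simp_all add: McLain_def)

lemma McLain_keys_mult:
  fixes x y :: "'l::linorder \<times> 'l \<Rightarrow>\<^sub>0 'r::ring_1"
  assumes "trans \<Delta>" "keys x \<subseteq> \<Delta>" "keys y \<subseteq> \<Delta>"
  shows "keys (x \<otimes>\<^bsub>McLain\<^esub> y) \<subseteq> \<Delta>"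
proof -
  have "keys (J_mult x y) \<subseteq> \<Delta>"
  proof
    fix p assume p: "p \<in> keys (J_mult x y)"
    obtain a b where ab: "p = (a, b)" by fastforce
    obtain c where "(a, c) \<in> keys x" "(c, b) \<in> keys y"
      using p unfolding ab by (rule keys_J_mult)
    then have "(a, c) \<in> \<Delta>" "(c, b) \<in> \<Delta>" using assms(2,3) by auto
    then show "p \<in> \<Delta>" unfolding ab by (rule transD[OF assms(1)])
  qed
  then show ?thesis
    unfolding McLain_simps
    by (intro subset_trans[OF Poly_Mapping.keys_add] Un_least) (use assms(2,3) in simp_all)
qed

lemma trans_Phi: "trans (Phi :: ('l::linorder \<times> 'l) set)"
  by (auto simp: Phi_def intro!: transI)

lemma monoid_McLain: "monoid (McLain :: ('l::linorder \<times> 'l \<Rightarrow>\<^sub>0 'r::ring_1) monoid)"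
proof
  fix x y z :: "'l \<times> 'l \<Rightarrow>\<^sub>0 'r"
  show "x \<in> carrier McLain \<Longrightarrow> y \<in> carrier McLain \<Longrightarrow> x \<otimes>\<^bsub>McLain\<^esub> y \<in> carrier McLain"
    using McLain_keys_mult[OF trans_Phi, of x y] by (simp add: McLain_simps(1))
  show "(x \<otimes>\<^bsub>McLain\<^esub> y) \<otimes>\<^bsub>McLain\<^esub> z = x \<otimes>\<^bsub>McLain\<^esub> (y \<otimes>\<^bsub>McLain\<^esub> z)"
    by (simp add: McLain_simps J_mult_add J_mult_assoc algebra_simps)
qed (simp_all add: McLain_simps)

text \<open>Splitting off from the right an entry in the first nonzero row produces no product term.\<close>

lemma McLain_induct [consumes 2, case_names zero mult]:
  fixes x :: "'l::linorder \<times> 'l \<Rightarrow>\<^sub>0 'r::ring_1"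
  assumes "keys x \<subseteq> \<Delta>" "\<Delta> \<subseteq> Phi" "P 0"
    and step: "\<And>x p r. \<lbrakk>keys x \<subseteq> \<Delta>; p \<in> \<Delta>; P x\<rbrakk> \<Longrightarrow> P (x \<otimes>\<^bsub>McLain\<^esub> single p r)"
  shows "P x"
  using assms(1)
proof (induction "card (keys x)" arbitrary: x)
  case 0
  then show ?case using assms(3) by simp
next
  case (Suc n)
  let ?F = "fst ` keys x"
  have "keys x \<noteq> {}" using Suc.hyps(2) by auto
  then have "Min ?F \<in> ?F" by (intro Min_in) auto
  then obtain b where p: "(Min ?F, b) \<in> keys x" by force
  define p where "p = (Min ?F, b)"
  define y where "y = x - single p (lookup x p)"
  have ly: "lookup y q = (if q = p then 0 else lookup x q)" for q
    by (auto simp: y_def lookup_minus lookup_single when_def)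
  have y: "keys y = keys x - {p}"
    by (auto simp: in_keys_iff ly split: if_splits)
  have "J_mult y (single p r) = 0" for r
  proof -
    have "(a, c) \<notin> keys (J_mult y (single p r))" for a c
    proof
      assume "(a, c) \<in> keys (J_mult y (single p r))"
      then obtain e where e: "(a, e) \<in> keys y" "(e, c) \<in> keys (single p r)"
        by (rule keys_J_mult)
      then have "e = Min ?F" by (auto simp: p_def split: if_splits)
      moreover have "a < e" using e y Suc.prems assms(2) by (auto simp: Phi_def)
      moreover have "Min ?F \<le> a" by (rule Min_le) (use e y in force)+
      ultimately show False by simp
    qed
    then show ?thesis by (metis keys_eq_empty equals0I prod.exhaust)
  qed
  then have x: "x = y \<otimes>\<^bsub>McLain\<^esub> single p (lookup x p)"
    by (simp add: McLain_simps y_def)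
  have "P y"
    by (rule Suc.hyps(1)) (use Suc y p in \<open>auto simp: p_def\<close>)
  then show ?case
    by (subst x, intro step) (use Suc.prems y p in \<open>auto simp: p_def\<close>)
qed

lemma McLain_single_mult:
  assumes "p \<in> Phi"
  shows "single p r \<otimes>\<^bsub>McLain\<^esub> single p s
    = single p ((r :: 'r::ring_1) + s)"
proof -
  have "J_mult (single p r) (single p s) = 0"
    using assms by (auto simp: J_mult_def Phi_def)
  then show ?thesis by (simp add: McLain_simps single_add)
qed

lemma group_McLain: "Group.group (McLain :: ('l::linorder \<times> 'l \<Rightarrow>\<^sub>0 'r::ring_1) monoid)"
proof (rule group.intro[OF monoid_McLain], rule group_axioms.intro, rule subsetI)
  interpret monoid "McLain :: ('l \<times> 'l \<Rightarrow>\<^sub>0 'r) monoid" by (rule monoid_McLain)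
  fix x :: "'l \<times> 'l \<Rightarrow>\<^sub>0 'r" assume "x \<in> carrier McLain"
  then have "keys x \<subseteq> Phi" "(Phi :: ('l \<times> 'l) set) \<subseteq> Phi" by (simp_all add: McLain_simps)
  then show "x \<in> Units McLain"
  proof (induction x rule: McLain_induct)
    case zero
    then show ?case using Units_one_closed by (simp add: McLain_simps)
  next
    case (mult x p r)
    have "single p r \<in> Units McLain"
      unfolding Units_def
      using mult(2) McLain_single_mult[OF mult(2), of r "- r"] McLain_single_mult[OF mult(2), of "- r" r]
      by (auto simp: McLain_simps(1,3) intro!: exI[of _ "single p (- r)"])
    then show ?case using mult by (intro Units_m_closed)
  qed
qed

global_interpretation McLain: Group.group "McLain :: ('l::linorder \<times> 'l \<Rightarrow>\<^sub>0 'r::ring_1) monoid"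
  by (rule group_McLain)

abbreviation McLain_inv :: "('l::linorder \<times> 'l \<Rightarrow>\<^sub>0 'r::ring_1) \<Rightarrow> ('l \<times> 'l \<Rightarrow>\<^sub>0 'r)" where
  "McLain_inv x \<equiv> inv\<^bsub>McLain\<^esub> x"

lemma McLain_keys_inv:
  fixes x :: "'l::linorder \<times> 'l \<Rightarrow>\<^sub>0 'r::ring_1"
  assumes "trans \<Delta>" "\<Delta> \<subseteq> Phi" "keys x \<subseteq> \<Delta>"
  shows "keys (McLain_inv x) \<subseteq> \<Delta>"
  using assms(3,2)
proof (induction x rule: McLain_induct)
  case zero
  have "McLain_inv (0 :: 'l \<times> 'l \<Rightarrow>\<^sub>0 'r) = 0" using McLain.inv_one unfolding McLain_simps(3) .
  then show ?case by simp
next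
  case (mult x p r)
  have c: "x \<in> carrier McLain" "single p r \<in> carrier McLain"
    "single p (- r) \<in> carrier McLain"
    using mult assms(2) by (auto simp: McLain_simps(1))
  have "McLain_inv (single p r) = single p (- r)"
    using McLain.inv_equality[OF _ c(2,3)] McLain_single_mult[of p "- r" r] mult(2) assms(2)
    by (auto simp: McLain_simps(3))
  then have "McLain_inv (x \<otimes>\<^bsub>McLain\<^esub> single p r)
      = single p (- r) \<otimes>\<^bsub>McLain\<^esub> McLain_inv x"
    using McLain.inv_mult_group[OF c(1,2)] by simp
  then show ?case using McLain_keys_mult[OF assms(1) _ mult(3), of "single p (- r)"] mult(2)
    by simp
qed

lemma subgroup_McLain_keys:
  assumes "trans \<Delta>" "\<Delta> \<subseteq> Phi"
  shows "subgroup {x. keys x \<subseteq> \<Delta>} (McLain :: ('l::linorder \<times> 'l \<Rightarrow>\<^sub>0 'r::ring_1) monoid)"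
proof (rule McLain.subgroupI)
  show "{x :: 'l \<times> 'l \<Rightarrow>\<^sub>0 'r. keys x \<subseteq> \<Delta>} \<noteq> {}" by (auto intro: exI[of _ 0])
  show "{x :: 'l \<times> 'l \<Rightarrow>\<^sub>0 'r. keys x \<subseteq> \<Delta>} \<subseteq> carrier McLain"
    using assms(2) by (auto simp: McLain_simps(1))
qed (use McLain_keys_mult[OF assms(1)] McLain_keys_inv[OF assms] in simp_all)

text \<open>Closedness of a set of roots is transitivity of the relation. Supports stay inside such
  a set under products and inverses, and conversely \<open>McLain_induct\<close> builds every
  element supported there from generators with index in \<Delta>.\<close>

lemma McLain_sub_eq:
  assumes "trans \<Delta>" "\<Delta> \<subseteq> Phi"
  shows "(McLain_sub \<Delta> :: ('l::linorder \<times> 'l \<Rightarrow>\<^sub>0 'r::ring_1) set) = {x. keys x \<subseteq> \<Delta>}"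
proof
  show "McLain_sub \<Delta> \<subseteq> {x :: 'l \<times> 'l \<Rightarrow>\<^sub>0 'r. keys x \<subseteq> \<Delta>}"
    unfolding McLain_sub_def
    by (rule McLain.generate_subgroup_incl[OF _ subgroup_McLain_keys[OF assms]]) (auto split: if_splits)
  show "{x :: 'l \<times> 'l \<Rightarrow>\<^sub>0 'r. keys x \<subseteq> \<Delta>} \<subseteq> McLain_sub \<Delta>"
  proof safe
    fix x :: "'l \<times> 'l \<Rightarrow>\<^sub>0 'r" assume "keys x \<subseteq> \<Delta>"
    then show "x \<in> McLain_sub \<Delta>" using assms(2)
    proof (induction x rule: McLain_induct)
      case zero
      then show ?case unfolding McLain_sub_def
        using generate.one[of "McLain :: ('l \<times> 'l \<Rightarrow>\<^sub>0 'r) monoid"] by (simp add: McLain_simps(3))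
    next
      case (mult x p r)
      from mult(2) have "single p r \<in> {single p r |p r. p \<in> \<Delta>}" by blast
      with mult(3) show ?case unfolding McLain_sub_def by (intro generate.eng) (auto intro: generate.incl)
    qed
  qed
qed

subsection \<open>Root sets\<close>

text \<open>The complement of \<Gamma> in \<Phi>: the positions whose entries in m\<inverse>
  distinguish the cosets m H.\<close>

definition Theta_set :: "('l::linorder \<times> 'l) set \<Rightarrow> ('l \<times> 'l) set" where
  "Theta_set D = {(a, c). \<exists>b. (a, b) \<in> D \<and> a < c \<and> c < b}"

lemma Gamma_set_eq: "Gamma_set D = Phi - Theta_set D"
  by (fastforce simp: Gamma_set_def Theta_set_def Phi_def)

lemma Omega_setI:
  "\<lbrakk>(a, b) \<in> D; (c, d) \<in> D; a < c; c < b; b < d\<rbrakk> \<Longrightarrow> (a, c) \<in> Omega_set D"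
  unfolding Omega_set_def Phi_def by blast

lemma Omega_subset_Theta: "Omega_set D \<subseteq> Theta_set D"
  by (auto simp: Omega_set_def Theta_set_def)

lemma Theta_subset_Phi: "Theta_set D \<subseteq> Phi"
  by (auto simp: Theta_set_def Phi_def)

lemma Gamma_subset_Phi: "Gamma_set D \<subseteq> Phi"
  by (auto simp: Gamma_set_def)

lemma trans_Gamma: "trans (Gamma_set D)"
  by (auto simp: Gamma_set_eq Theta_set_def Phi_def intro!: transI)

lemma inj_on_fst_eq: "\<lbrakk>inj_on fst D; (a, b) \<in> D; (a, b') \<in> D\<rbrakk> \<Longrightarrow> b = b'"
  using inj_onD[of fst D "(a, b)" "(a, b')"] by simp

lemma Theta_row:
  assumes "inj_on fst D" "(a, b) \<in> D"
  shows "(a, c) \<in> Theta_set D \<longleftrightarrow> a < c \<and> c < b"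
proof
  assume "(a, c) \<in> Theta_set D"
  then obtain e where "(a, e) \<in> D" "a < c" "c < e" by (auto simp: Theta_set_def)
  then show "a < c \<and> c < b" using inj_on_fst_eq[OF assms, of e] by simp
qed (use assms(2) in \<open>auto simp: Theta_set_def\<close>)

text \<open>If (a, c) lies outside \<Gamma>, row a ends after c, hence after b, which forces (a, b)
  into \<Omega>; then row b ends even later, which forces (b, c) into \<Omega>. The row ends
  increase along the chain, so (a, c) itself satisfies the condition for \<Omega>.\<close>

lemma trans_Gamma_Omega:
  assumes "inj_on fst D"
  shows "trans (Gamma_set D \<union> Omega_set D)"
proof (rule transI)
  fix a b c assume ab: "(a, b) \<in> Gamma_set D \<union> Omega_set D" and bc: "(b, c) \<in> Gamma_set D \<union> Omega_set D"
  have lt: "a < b" "b < c" using ab bc by (auto simp: Gamma_set_def Omega_set_def Phi_def)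
  show "(a, c) \<in> Gamma_set D \<union> Omega_set D"
  proof (rule ccontr)
    assume *: "(a, c) \<notin> Gamma_set D \<union> Omega_set D"
    then obtain e where e: "(a, e) \<in> D" "c < e" using lt by (auto simp: Gamma_set_eq Phi_def Theta_set_def)
    then have "(a, b) \<notin> Gamma_set D" using lt Theta_row[OF assms e(1), of b] by (auto simp: Gamma_set_eq)
    then obtain g where g: "(b, g) \<in> D" "e < g"
    proof -
      obtain e' g where "(a, e') \<in> D" "(b, g) \<in> D" "e' < g"
        using ab \<open>(a, b) \<notin> Gamma_set D\<close> by (auto simp: Omega_set_def)
      then show thesis using inj_on_fst_eq[OF assms e(1), of e'] that by simp
    qed
    then have "(b, c) \<notin> Gamma_set D" using lt e Theta_row[OF assms g(1), of c] by (auto simp: Gamma_set_eq)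
    then obtain h where h: "(c, h) \<in> D" "g < h"
    proof -
      obtain g' h where "(b, g') \<in> D" "(c, h) \<in> D" "g' < h"
        using bc \<open>(b, c) \<notin> Gamma_set D\<close> by (auto simp: Omega_set_def)
      then show thesis using inj_on_fst_eq[OF assms g(1), of g'] that by simp
    qed
    then have "(a, c) \<in> Omega_set D" using e g lt by (intro Omega_setI[of a e _ c h]) auto
    then show False using * by simp
  qed
qed

lemma H_group_eq: "(H_group D :: ('l::linorder \<times> 'l \<Rightarrow>\<^sub>0 'r::ring_1) set) = {x. keys x \<subseteq> Gamma_set D}"
  unfolding H_group_def by (rule McLain_sub_eq[OF trans_Gamma Gamma_subset_Phi])

lemma I_group_eq:
  assumes "inj_on fst D"
  shows "(I_group D :: ('l::linorder \<times> 'l \<Rightarrow>\<^sub>0 'r::ring_1) set)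
    = {x. keys x \<subseteq> Gamma_set D \<union> Omega_set D}"
  unfolding I_group_def
  by (rule McLain_sub_eq[OF trans_Gamma_Omega[OF assms]])
    (use Gamma_subset_Phi Omega_subset_Theta Theta_subset_Phi in blast)

subsection \<open>Truncation\<close>

definition restr :: "'b set \<Rightarrow> ('b \<Rightarrow>\<^sub>0 'r::zero) \<Rightarrow> ('b \<Rightarrow>\<^sub>0 'r)" where
  "restr S x = Poly_Mapping.mapp (\<lambda>k v. if k \<in> S then v else 0) x"

lemma lookup_restr: "lookup (restr S x) k = (if k \<in> S then lookup x k else 0)"
  by (simp add: restr_def lookup_mapp when_def in_keys_iff)

lemma keys_restr: "keys (restr S x) = keys x \<inter> S"
  by (auto simp: in_keys_iff lookup_restr split: if_splits)

lemma restr_id: "keys x \<subseteq> S \<Longrightarrow> restr S x = x"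
  by (rule poly_mapping_eqI) (auto simp: lookup_restr in_keys_iff)

lemma restr_eq_iff: "restr S x = restr S y \<longleftrightarrow> (\<forall>k\<in>S. lookup x k = lookup y k)"
proof
  assume eq: "restr S x = restr S y"
  show "\<forall>k\<in>S. lookup x k = lookup y k"
    using arg_cong[OF eq, of lookup] by (auto simp: lookup_restr fun_eq_iff split: if_splits)
qed (auto intro!: poly_mapping_eqI simp: lookup_restr)

lemma restr_restr: "restr S (restr S x) = restr S x"
  by (rule restr_id) (simp add: keys_restr)

text \<open>As \<open>n\<close> is supported above the diagonal, a product contribution at (a, b)
  uses only entries of row a strictly to the left of column b.\<close>

lemma lookup_mult_cong:
  fixes x y n :: "'l::linorder \<times> 'l \<Rightarrow>\<^sub>0 'r::ring_1"
  assumes n: "n \<in> carrier McLain"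
    and eq: "\<And>c. c < b \<Longrightarrow> lookup x (a, c) = lookup y (a, c)"
  shows "lookup (x \<otimes>\<^bsub>McLain\<^esub> n) (a, b) - lookup x (a, b)
    = lookup (y \<otimes>\<^bsub>McLain\<^esub> n) (a, b) - lookup y (a, b)"
proof -
  let ?A = "snd ` keys x \<union> snd ` keys y"
  have "lookup (J_mult x n) (a, b) = lookup (J_mult y n) (a, b)"
  proof (subst (1 2) lookup_J_mult[of ?A])
    show "(\<Sum>c\<in>?A. lookup x (a, c) * lookup n (c, b))
      = (\<Sum>c\<in>?A. lookup y (a, c) * lookup n (c, b))"
    proof (rule sum.cong[OF refl])
      fix c
      have "c < b \<or> lookup n (c, b) = 0"
        using n by (auto simp: McLain_simps(1) Phi_def in_keys_iff)
      then show "lookup x (a, c) * lookup n (c, b)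
        = lookup y (a, c) * lookup n (c, b)" using eq by auto
    qed
  qed force+
  then show ?thesis by (simp add: McLain_simps lookup_add)
qed

text \<open>In each row \<Theta> is an initial segment of the positions above the diagonal, so by
  \<open>lookup_mult_cong\<close> the discarded entries never influence the retained ones. This
  makes \<open>row_act\<close> an action.\<close>

lemma restr_Theta_mult:
  fixes y n :: "'l::linorder \<times> 'l \<Rightarrow>\<^sub>0 'r::ring_1"
  assumes "y \<in> carrier McLain" "n \<in> carrier McLain"
  shows "restr (Theta_set D) (restr (Theta_set D) y \<otimes>\<^bsub>McLain\<^esub> n) = restr (Theta_set D) (y \<otimes>\<^bsub>McLain\<^esub> n)"
  unfolding restr_eq_iff
proof
  fix k assume k: "k \<in> Theta_set D"
  then obtain a b e where ab: "k = (a, b)" "(a, e) \<in> D" "a < b" "b < e" by (auto simp: Theta_set_def)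
  have "lookup (restr (Theta_set D) y) (a, c) = lookup y (a, c)" if "c \<le> b" for c
    using that ab assms(1) by (auto simp: lookup_restr Theta_set_def McLain_simps(1) in_keys_iff Phi_def)
  from lookup_mult_cong[OF assms(2), of b "restr (Theta_set D) y" a y] this
  show "lookup (restr (Theta_set D) y \<otimes>\<^bsub>McLain\<^esub> n) k
      = lookup (y \<otimes>\<^bsub>McLain\<^esub> n) k"
    by (simp add: ab)
qed

text \<open>All entries to the left of a position of D are retained by the truncation, while the
  position itself is cut off. So the increment at \<open>d\<close> is visible on the truncated row,
  which is the source of the cocycle identity for \<open>row_coeff\<close>.\<close>

lemma lookup_D_mult:
  fixes y n :: "'l::linorder \<times> 'l \<Rightarrow>\<^sub>0 'r::ring_1"
  assumes D: "inj_on fst D" "d \<in> D" and "y \<in> carrier McLain" "n \<in> carrier McLain"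
  shows "lookup (y \<otimes>\<^bsub>McLain\<^esub> n) d
    = lookup y d + lookup (restr (Theta_set D) y \<otimes>\<^bsub>McLain\<^esub> n) d"
proof -
  obtain a b where d: "d = (a, b)" by fastforce
  have "lookup (restr (Theta_set D) y) (a, c) = lookup y (a, c)" if "c < b" for c
    using that D d assms(3) Theta_row[of D a b c]
    by (auto simp: lookup_restr McLain_simps(1) in_keys_iff Phi_def)
  moreover have "lookup (restr (Theta_set D) y) (a, b) = 0"
    using D d Theta_row[of D a b b] by (auto simp: lookup_restr)
  ultimately show ?thesis
    using lookup_mult_cong[OF assms(4), of b "restr (Theta_set D) y" a y] by (simp add: d algebra_simps)
qed

section \<open>Elementary modules\<close>

lemma linear_characterD:
  fixes \<mu> :: "'r::ring_1 \<Rightarrow> 'f::field"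
  assumes "linear_character \<mu>"
  shows "\<mu> (a + b) = \<mu> a * \<mu> b" and "\<mu> a \<noteq> 0" and "\<mu> 0 = 1"
proof -
  have \<mu>: "\<mu> \<in> hom (add_monoid class_ring) (units_of class_ring)"
    using assms by (simp add: linear_character_def)
  show add: "\<mu> (a + b) = \<mu> a * \<mu> b" for a b
    using hom_mult[OF \<mu>, of a b] by (simp add: units_of_def)
  show nz: "\<mu> a \<noteq> 0" for a
    using hom_in_carrier[OF \<mu>, of a] by (auto simp: units_of_def Units_def)
  show "\<mu> 0 = 1" using add[of 0 0] nz[of 0] by simp
qed

lemma hom_units_of_class_ring:
  "\<chi> \<in> hom G (units_of (class_ring :: 'f::field ring)) \<longleftrightarrow>
    (\<forall>x\<in>carrier G. \<chi> x \<noteq> 0) \<and> (\<forall>x\<in>carrier G. \<forall>y\<in>carrier G. \<chi> (x \<otimes>\<^bsub>G\<^esub> y) = \<chi> x * \<chi> y)"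
proof -
  have "Units (class_ring :: 'f ring) = {x. x \<noteq> 0}"
  proof (intro equalityI subsetI)
    fix x :: 'f assume "x \<in> {x. x \<noteq> 0}"
    then show "x \<in> Units class_ring" by (auto simp: Units_def intro!: exI[of _ "inverse x"])
  qed (auto simp: Units_def)
  then show ?thesis by (auto simp: hom_def units_of_def)
qed

text \<open>By \<open>indecomposable\<close> no product term reaches the position \<open>p\<close>,
  so the entry at \<open>p\<close> is additive and \<mu> of it is a homomorphism. A homomorphism
  with the prescribed values on generators agrees with it by \<open>McLain_induct\<close>, which
  settles the definite description.\<close>

lemma extended_character_eq:
  fixes \<mu> :: "'r::ring_1 \<Rightarrow> 'f::field" and x :: "'l::linorder \<times> 'l \<Rightarrow>\<^sub>0 'r"
  assumes \<Delta>: "trans \<Delta>" "\<Delta> \<subseteq> Phi" and p: "p \<in> \<Delta>"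
    and indecomposable: "\<And>c. \<lbrakk>(fst p, c) \<in> \<Delta>; (c, snd p) \<in> \<Delta>\<rbrakk> \<Longrightarrow> False"
    and \<mu>: "linear_character \<mu>" and x: "x \<in> McLain_sub \<Delta>"
  shows "extended_character \<Delta> p \<mu> x = \<mu> (lookup x p)"
proof -
  define \<chi> :: "('l \<times> 'l \<Rightarrow>\<^sub>0 'r) \<Rightarrow> 'f" where
    "\<chi> = (\<lambda>x\<in>McLain_sub \<Delta>. \<mu> (lookup x p))"
  have mem: "x \<in> McLain_sub \<Delta> \<longleftrightarrow> keys x \<subseteq> \<Delta>" for x :: "'l \<times> 'l \<Rightarrow>\<^sub>0 'r"
    by (simp add: McLain_sub_eq[OF \<Delta>])
  have closed: "x \<otimes>\<^bsub>McLain\<^esub> y \<in> McLain_sub \<Delta>" if "x \<in> McLain_sub \<Delta>" "y \<in> McLain_sub \<Delta>"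
    for x y :: "'l \<times> 'l \<Rightarrow>\<^sub>0 'r"
    using McLain_keys_mult[OF \<Delta>(1)] that by (simp add: mem)
  have lookup: "lookup (x \<otimes>\<^bsub>McLain\<^esub> y) p = lookup x p + lookup y p"
    if "x \<in> McLain_sub \<Delta>" "y \<in> McLain_sub \<Delta>" for x y :: "'l \<times> 'l \<Rightarrow>\<^sub>0 'r"
  proof -
    have "(fst p, snd p) \<notin> keys (J_mult x y)"
    proof
      assume "(fst p, snd p) \<in> keys (J_mult x y)"
      then obtain c where "(fst p, c) \<in> keys x" "(c, snd p) \<in> keys y"
        by (rule keys_J_mult)
      then show False using that indecomposable by (auto simp: mem)
    qed
    then show ?thesis by (simp add: McLain_simps lookup_add in_keys_iff)
  qed
  have single: "single q r \<in> McLain_sub \<Delta>" if "q \<in> \<Delta>" for q and r :: 'r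
    using that by (simp add: mem)
  have "extended_character \<Delta> p \<mu> = \<chi>"
    unfolding extended_character_def
  proof (rule the_equality)
    show "\<chi> \<in> extensional (McLain_sub \<Delta>) \<and>
        \<chi> \<in> hom (McLain\<lparr>carrier := McLain_sub \<Delta>\<rparr>) (units_of class_ring) \<and>
        (\<forall>r. \<chi> (single p r) = \<mu> r) \<and>
        (\<forall>q\<in>\<Delta> - {p}. \<forall>r. \<chi> (single q r) = 1)"
      unfolding hom_units_of_class_ring
      using p closed lookup single linear_characterD[OF \<mu>]
      by (auto simp: \<chi>_def lookup_single when_def)
  next
    fix \<chi>' :: "('l \<times> 'l \<Rightarrow>\<^sub>0 'r) \<Rightarrow> 'f"
    assume *: "\<chi>' \<in> extensional (McLain_sub \<Delta>) \<and>
        \<chi>' \<in> hom (McLain\<lparr>carrier := McLain_sub \<Delta>\<rparr>) (units_of class_ring) \<and>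
        (\<forall>r. \<chi>' (single p r) = \<mu> r) \<and>
        (\<forall>q\<in>\<Delta> - {p}. \<forall>r. \<chi>' (single q r) = 1)"
    have "\<chi>' x = \<mu> (lookup x p)" if "keys x \<subseteq> \<Delta>" for x
      using that \<Delta>(2)
    proof (induction x rule: McLain_induct)
      case zero
      have "\<chi>' (single p 0) = \<mu> 0" using * by blast
      then show ?case by simp
    next
      case (mult x q r)
      have "\<chi>' (x \<otimes>\<^bsub>McLain\<^esub> single q r) = \<chi>' x * \<chi>' (single q r)"
        using * mult single by (auto simp: hom_units_of_class_ring mem)
      moreover have "\<chi>' (single q r) = \<mu> (lookup (single q r) p)"
        using * mult(2) linear_characterD(3)[OF \<mu>] by (cases "q = p") (auto simp: lookup_single when_def)
      ultimately show ?case
        using lookup[of x "single q r"] mult single linear_characterD(1)[OF \<mu>] by (simp add: mem)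
    qed
    then show "\<chi>' = \<chi>" using *
      by (intro extensionalityI[of _ "McLain_sub \<Delta>"]) (auto simp: \<chi>_def mem)
  qed
  then show ?thesis using x by (simp add: \<chi>_def)
qed

subsection \<open>A monomial model of the basic modules\<close>

text \<open>
  The coset \<open>mH\<close> is determined by the entries of \<open>m\<inverse>\<close> in \<open>Theta_set D\<close>, which turns the
  module induced from the linear character of \<open>H\<close> into a monomial module whose basis
  consists of these truncated rows.
\<close>

abbreviation rows :: "('l::linorder \<times> 'l) set \<Rightarrow> ('l \<times> 'l \<Rightarrow>\<^sub>0 'r::ring_1) set" where
  "rows D \<equiv> {X. keys X \<subseteq> Theta_set D}"

definition row_act :: "('l::linorder \<times> 'l) set \<Rightarrow> ('l \<times> 'l \<Rightarrow>\<^sub>0 'r::ring_1)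
    \<Rightarrow> ('l \<times> 'l \<Rightarrow>\<^sub>0 'r) \<Rightarrow> ('l \<times> 'l \<Rightarrow>\<^sub>0 'r)" where
  "row_act D m X = restr (Theta_set D) (X \<otimes>\<^bsub>McLain\<^esub> McLain_inv m)"

text \<open>The sign compensates for the inverse: an element h of H has entry
  \<open>- lookup h d\<close> at \<open>d\<close> in its inverse, so on indices supported in
  \<Omega> the coefficient of h is \<lambda>(h).\<close>

definition row_coeff :: "('l::linorder \<times> 'l) set \<Rightarrow> ('l \<times> 'l \<Rightarrow> 'r::ring_1 \<Rightarrow> 'f::field)
    \<Rightarrow> ('l \<times> 'l \<Rightarrow>\<^sub>0 'r) \<Rightarrow> ('l \<times> 'l \<Rightarrow>\<^sub>0 'r) \<Rightarrow> 'f" where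
  "row_coeff D f m X = (\<Prod>d\<in>D. f d (- lookup (X \<otimes>\<^bsub>McLain\<^esub> McLain_inv m) d))"

definition row_module :: "('l::linorder \<times> 'l) set \<Rightarrow> ('l \<times> 'l \<Rightarrow> 'r::ring_1 \<Rightarrow> 'f::field)
    \<Rightarrow> ('f, ('l \<times> 'l \<Rightarrow>\<^sub>0 'r) \<Rightarrow>\<^sub>0 'f, 'l \<times> 'l \<Rightarrow>\<^sub>0 'r) gmodule" where
  "row_module D f = monomial_gmodule (rows D) (row_act D) (row_coeff D f)"

lemma rows_carrier: "X \<in> rows D \<Longrightarrow> X \<in> carrier McLain"
  using Theta_subset_Phi by (auto simp: McLain_simps(1))

lemma row_act_mem: "row_act D m X \<in> rows D"
  by (simp add: row_act_def keys_restr)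

lemma row_act_mult:
  fixes g h X :: "'l::linorder \<times> 'l \<Rightarrow>\<^sub>0 'r::ring_1"
  assumes "g \<in> carrier McLain" "h \<in> carrier McLain" "X \<in> rows D"
  shows "row_act D (g \<otimes>\<^bsub>McLain\<^esub> h) X = row_act D g (row_act D h X)"
proof -
  have X: "X \<in> carrier McLain" by (rule rows_carrier[OF assms(3)])
  have "X \<otimes>\<^bsub>McLain\<^esub> McLain_inv (g \<otimes>\<^bsub>McLain\<^esub> h) = (X \<otimes>\<^bsub>McLain\<^esub> McLain_inv h) \<otimes>\<^bsub>McLain\<^esub> McLain_inv g"
    using assms(1,2) X by (simp add: McLain.inv_mult_group McLain.m_assoc)
  then show ?thesis
    using restr_Theta_mult[of "X \<otimes>\<^bsub>McLain\<^esub> McLain_inv h" "McLain_inv g" D] assms(1,2) X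
    by (simp add: row_act_def)
qed

text \<open>By \<open>lookup_D_mult\<close> the entry at \<open>d\<close> after two multiplications
  is a sum of two increments, and the linear character \<open>f d\<close> turns this sum into a
  product.\<close>

lemma row_coeff_mult:
  fixes g h X :: "'l::linorder \<times> 'l \<Rightarrow>\<^sub>0 'r::ring_1"
  assumes D: "inj_on fst D" and f: "\<And>d. d \<in> D \<Longrightarrow> linear_character (f d)"
    and "g \<in> carrier McLain" "h \<in> carrier McLain" "X \<in> rows D"
  shows "row_coeff D f (g \<otimes>\<^bsub>McLain\<^esub> h) X = row_coeff D f g (row_act D h X) * row_coeff D f h X"
proof -
  have X: "X \<in> carrier McLain" by (rule rows_carrier[OF assms(5)])
  have eq: "X \<otimes>\<^bsub>McLain\<^esub> McLain_inv (g \<otimes>\<^bsub>McLain\<^esub> h) = (X \<otimes>\<^bsub>McLain\<^esub> McLain_inv h) \<otimes>\<^bsub>McLain\<^esub> McLain_inv g"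
    using assms(3,4) X by (simp add: McLain.inv_mult_group McLain.m_assoc)
  have "f d (- lookup (X \<otimes>\<^bsub>McLain\<^esub> McLain_inv (g \<otimes>\<^bsub>McLain\<^esub> h)) d)
    = f d (- lookup (row_act D h X \<otimes>\<^bsub>McLain\<^esub> McLain_inv g) d)
      * f d (- lookup (X \<otimes>\<^bsub>McLain\<^esub> McLain_inv h) d)" if d: "d \<in> D" for d
    unfolding eq
    using lookup_D_mult[OF D d, of "X \<otimes>\<^bsub>McLain\<^esub> McLain_inv h" "McLain_inv g"] assms(3,4) X
      linear_characterD(1)[OF f[OF d]]
    by (simp add: row_act_def algebra_simps flip: linear_characterD(1)[OF f[OF d]])
  then show ?thesis by (simp add: row_coeff_def prod.distrib)
qed

lemma lookup_rows_D:
  assumes "inj_on fst D" "d \<in> D" "X \<in> rows D"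
  shows "lookup X d = 0"
  using assms Theta_row[of D "fst d" "snd d" "snd d"] by (cases d) (auto simp: in_keys_iff)

lemma gmodule_row_module:
  fixes D :: "('l::linorder \<times> 'l) set" and f :: "'l \<times> 'l \<Rightarrow> 'r::ring_1 \<Rightarrow> 'f::field"
  assumes D: "inj_on fst D" and f: "\<And>d. d \<in> D \<Longrightarrow> linear_character (f d)"
  shows "gmodule McLain (row_module D f)"
  unfolding row_module_def
proof (rule gmodule_monomial)
  show "Group.group (McLain :: ('l \<times> 'l \<Rightarrow>\<^sub>0 'r) monoid)" by (rule group_McLain)
  fix X :: "'l \<times> 'l \<Rightarrow>\<^sub>0 'r" assume X: "X \<in> rows D"
  have one: "X \<otimes>\<^bsub>McLain\<^esub> McLain_inv \<one>\<^bsub>McLain\<^esub> = X"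
    using rows_carrier[OF X] by simp
  have "row_act D \<one>\<^bsub>McLain\<^esub> X = X"
    unfolding row_act_def one using X by (simp add: restr_id)
  moreover have "row_coeff D f \<one>\<^bsub>McLain\<^esub> X = 1"
    unfolding row_coeff_def one
    using lookup_rows_D[OF D _ X] linear_characterD(3)[OF f] by simp
  ultimately show "row_act D \<one>\<^bsub>McLain\<^esub> X = X \<and> row_coeff D f \<one>\<^bsub>McLain\<^esub> X = 1" by blast
next
  fix g h X :: "'l \<times> 'l \<Rightarrow>\<^sub>0 'r"
  assume "g \<in> carrier McLain" "h \<in> carrier McLain" "X \<in> rows D"
  then show "row_act D (g \<otimes>\<^bsub>McLain\<^esub> h) X = row_act D g (row_act D h X)
    \<and> row_coeff D f (g \<otimes>\<^bsub>McLain\<^esub> h) X = row_coeff D f g (row_act D h X) * row_coeff D f h X"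
    by (intro conjI row_act_mult row_coeff_mult[OF D f])
qed (rule row_act_mem)

lemma row_module_simps:
  "carrier (row_module D f) = {x. keys x \<subseteq> rows D}"
  "zero (row_module D f) = 0" "add (row_module D f) = (+)" "smult (row_module D f) = scale"
  "act (row_module D f) m = plin (\<lambda>X. single (row_act D m X) (row_coeff D f m X))"
  by (simp_all add: row_module_def monomial_gmodule_simps)

lemma row_module_pm_space: "pm_space (rows D) (row_module D f)"
  by (simp add: row_module_def monomial_gmodule_pm_space)

lemma act_row_module_single:
  "act (row_module D f) m (single X c)
    = single (row_act D m X) (c * row_coeff D f m X)"
  by (simp add: row_module_simps)

lemma gmodule_restrict_group:
  assumes "gmodule G V" "subgroup H G"
  shows "gmodule (G\<lparr>carrier := H\<rparr>) V"
proof (rule gmoduleI)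
  show "Group.group (G\<lparr>carrier := H\<rparr>)"
    by (rule subgroup.subgroup_is_group[OF assms(2) gmodule_group[OF assms(1)]])
  show "vectorspace class_ring V" by (rule gmodule_vectorspace[OF assms(1)])
qed (use subgroup.subset[OF assms(2)] gmodule_act[OF assms(1)] gmodule.act_one[OF assms(1)]
    gmodule.act_mult[OF assms(1)] in \<open>auto simp: subset_iff\<close>)

lemma subset_Diff_disjoint: "A \<inter> C = {} \<Longrightarrow> A \<subseteq> B \<Longrightarrow> A \<subseteq> B - C"
  by blast

lemma free_gmodule_span:
  fixes B :: "'b set" and k :: "'g \<Rightarrow> 'b \<Rightarrow> 'b" and E :: "('b \<Rightarrow>\<^sub>0 'f::field) set"
  assumes "E \<subseteq> {x. keys x \<subseteq> B}"
  defines "N \<equiv> LinearCombinations.module.span class_ring (free_gmodule B k) E"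
  shows "e \<in> E \<Longrightarrow> e \<in> N" and "0 \<in> N" and "\<lbrakk>x \<in> N; y \<in> N\<rbrakk> \<Longrightarrow> x + y \<in> N"
    and "x \<in> N \<Longrightarrow> scale c x \<in> N" and "\<lbrakk>x \<in> N; y \<in> N\<rbrakk> \<Longrightarrow> x - y \<in> N"
proof -
  interpret V: vectorspace class_ring "free_gmodule B k :: ('f, 'b \<Rightarrow>\<^sub>0 'f, 'g) gmodule"
    by (rule pm_space_vectorspace[OF free_gmodule_pm_space])
  have simps: "carrier (free_gmodule B k) = {x :: 'b \<Rightarrow>\<^sub>0 'f. keys x \<subseteq> B}"
    "zero (free_gmodule B k :: ('f, 'b \<Rightarrow>\<^sub>0 'f, 'g) gmodule) = 0"
    "add (free_gmodule B k :: ('f, 'b \<Rightarrow>\<^sub>0 'f, 'g) gmodule) = (+)"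
    "smult (free_gmodule B k :: ('f, 'b \<Rightarrow>\<^sub>0 'f, 'g) gmodule) = scale"
    by (simp_all add: free_gmodule_def)
  have sub: "E \<subseteq> carrier (free_gmodule B k)" using assms by (auto simp: simps)
  have N: "submodule class_ring N (free_gmodule B k)" unfolding N_def by (rule V.span_is_submodule[OF sub])
  show "e \<in> E \<Longrightarrow> e \<in> N" unfolding N_def using V.in_own_span[OF sub] by blast
  show "0 \<in> N" using submodule.zero_closed[OF N] by (simp add: simps)
  show add: "x \<in> N \<Longrightarrow> y \<in> N \<Longrightarrow> x + y \<in> N" for x y
    using submodule.m_closed[OF N, of x y] by (simp add: simps)
  show scale: "x \<in> N \<Longrightarrow> scale c x \<in> N" for x c
    using submodule.smult_closed[OF N, of c x] by (simp add: simps)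
  show "x \<in> N \<Longrightarrow> y \<in> N \<Longrightarrow> x - y \<in> N"
    using add[OF _ scale[of y "-1"], of x] by (simp add: scale_minus_one)
qed

text \<open>Serves the inflation from L to M: the induced module is given over \<open>K\<close>
  only, the model \<open>W\<close> is already a module for \<open>G\<close>, and
  \<open>\<rho>\<close> is the projection through which \<open>G\<close> acts on both.\<close>

lemma gmodule_pullback:
  fixes V :: "('f::field, 'v, 'g) gmodule" and W :: "('f, 'w, 'g, 'z) gmodule_scheme"
  assumes V: "gmodule K V" and W: "gmodule G W" and p: "p \<in> gmodule_hom K V W"
    and bij: "bij_betw p (carrier V) (carrier W)"
    and \<rho>: "\<And>g. g \<in> carrier G \<Longrightarrow> \<rho> g \<in> carrier K"
    and act: "\<And>g w. \<lbrakk>g \<in> carrier G; w \<in> carrier W\<rbrakk> \<Longrightarrow> act W (\<rho> g) w = act W g w"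
  shows "gmodule G (V\<lparr>act := \<lambda>g. act V (\<rho> g)\<rparr>)"
    and "p \<in> gmodule_hom G (V\<lparr>act := \<lambda>g. act V (\<rho> g)\<rparr>) W"
proof -
  let ?V = "V\<lparr>act := \<lambda>g. act V (\<rho> g)\<rparr>"
  interpret V: vectorspace class_ring V by (rule gmodule_vectorspace[OF V])
  interpret W: vectorspace class_ring W by (rule gmodule_vectorspace[OF W])
  have hom: "p x \<in> carrier W" "p (x \<oplus>\<^bsub>V\<^esub> y) = p x \<oplus>\<^bsub>W\<^esub> p y" "p (c \<odot>\<^bsub>V\<^esub> x) = c \<odot>\<^bsub>W\<^esub> p x"
    "g \<in> carrier K \<Longrightarrow> p (act V g x) = act W g (p x)"
    if "x \<in> carrier V" "y \<in> carrier V" for x y c g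
    using p that unfolding gmodule_hom_iff by blast+
  have "p \<zero>\<^bsub>V\<^esub> = p (0 \<odot>\<^bsub>V\<^esub> \<zero>\<^bsub>V\<^esub>)" by simp
  also have "\<dots> = \<zero>\<^bsub>W\<^esub>" using hom(3)[of "\<zero>\<^bsub>V\<^esub>" "\<zero>\<^bsub>V\<^esub>" 0] hom(1)[of "\<zero>\<^bsub>V\<^esub>" "\<zero>\<^bsub>V\<^esub>"] W.smult_l_null by simp
  finally have zero: "p \<zero>\<^bsub>V\<^esub> = \<zero>\<^bsub>W\<^esub>" .
  have "bij_betw p (carrier ?V) (carrier W)" using bij by simp
  note t = gmodule_transport[OF W this]
  show "gmodule G ?V" by (rule t) (use zero hom \<rho> act gmodule_act(1)[OF V] in simp_all)
  show "p \<in> gmodule_hom G ?V W" by (rule t) (use zero hom \<rho> act gmodule_act(1)[OF V] in simp_all)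
qed

subsection \<open>The elementary modules in the model\<close>

context
  fixes \<alpha> \<beta> :: "'l::linorder" and \<mu> :: "'r::ring_1 \<Rightarrow> 'f::field"
  assumes less: "\<alpha> < \<beta>" and \<mu>: "linear_character \<mu>"
begin

private abbreviation "L \<equiv> L_set \<alpha> \<beta>"
private abbreviation "T \<equiv> Theta_set {(\<alpha>, \<beta>)}"

lemma L_set_facts: "trans L" "L \<subseteq> Phi" "(\<alpha>, \<beta>) \<in> L" "T \<subseteq> L"
  using less by (auto simp: L_set_def Phi_def Theta_set_def intro!: transI)

lemma P_set_facts: "P_set \<alpha> \<beta> = L - T" "trans (P_set \<alpha> \<beta>)" "P_set \<alpha> \<beta> \<subseteq> Phi" "(\<alpha>, \<beta>) \<in> P_set \<alpha> \<beta>"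
proof -
  show *: "P_set \<alpha> \<beta> = L - T"
    using less by (auto simp: P_set_def L_set_def Theta_set_def)
  show "trans (P_set \<alpha> \<beta>)" unfolding *
    by (rule transI) (auto simp: L_set_def Theta_set_def)
  show "P_set \<alpha> \<beta> \<subseteq> Phi" "(\<alpha>, \<beta>) \<in> P_set \<alpha> \<beta>"
    using less by (auto simp: P_set_def Phi_def)
qed

lemma N_set_facts: "N_set \<alpha> \<beta> = Phi - L" "trans (N_set \<alpha> \<beta>)" "N_set \<alpha> \<beta> \<subseteq> Phi"
  by (auto simp: N_set_def L_set_def Phi_def intro!: transI)

lemma mem_McLain_sub:
  "(x :: 'l \<times> 'l \<Rightarrow>\<^sub>0 'r) \<in> McLain_sub L \<longleftrightarrow> keys x \<subseteq> L"
  "x \<in> McLain_sub (P_set \<alpha> \<beta>) \<longleftrightarrow> keys x \<subseteq> P_set \<alpha> \<beta>"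
  "x \<in> McLain_sub (N_set \<alpha> \<beta>) \<longleftrightarrow> keys x \<subseteq> N_set \<alpha> \<beta>"
  using McLain_sub_eq[OF L_set_facts(1,2)] McLain_sub_eq[OF P_set_facts(2,3)]
    McLain_sub_eq[OF N_set_facts(2,3)] by auto

text \<open>L consists of the positions inside the interval from \<alpha> to \<beta>. If (a, b) is
  such a position and a < c < b, then (a, c) and (c, b) are inside as well, so products only see the
  L-parts. Truncation to L is therefore a homomorphism, and it turns out to be the projection with
  kernel N.\<close>

lemma restr_L_mult:
  fixes x y :: "'l \<times> 'l \<Rightarrow>\<^sub>0 'r"
  assumes "x \<in> carrier McLain" "y \<in> carrier McLain"
  shows "restr L (x \<otimes>\<^bsub>McLain\<^esub> y) = restr L x \<otimes>\<^bsub>McLain\<^esub> restr L y"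
proof (rule poly_mapping_eqI)
  fix k :: "'l \<times> 'l"
  obtain a b where k: "k = (a, b)" by fastforce
  show "lookup (restr L (x \<otimes>\<^bsub>McLain\<^esub> y)) k = lookup (restr L x \<otimes>\<^bsub>McLain\<^esub> restr L y) k"
  proof (cases "k \<in> L")
    case False
    have "keys (restr L x \<otimes>\<^bsub>McLain\<^esub> restr L y) \<subseteq> L"
      by (rule McLain_keys_mult[OF L_set_facts(1)]) (auto simp: keys_restr)
    then show ?thesis using False by (auto simp: lookup_restr in_keys_iff)
  next
    case True
    let ?A = "snd ` keys x"
    have "lookup (J_mult x y) (a, b) = lookup (J_mult (restr L x) (restr L y)) (a, b)"
    proof (subst (1 2) lookup_J_mult[of ?A])
      show "(\<Sum>c\<in>?A. lookup x (a, c) * lookup y (c, b))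
        = (\<Sum>c\<in>?A. lookup (restr L x) (a, c) * lookup (restr L y) (c, b))"
      proof (rule sum.cong[OF refl])
        fix c
        have "(a, c) \<in> L \<and> (c, b) \<in> L \<or> lookup x (a, c) = 0 \<or> lookup y (c, b) = 0"
          using True assms by (force simp: k L_set_def McLain_simps(1) Phi_def in_keys_iff)
        then show "lookup x (a, c) * lookup y (c, b)
          = lookup (restr L x) (a, c) * lookup (restr L y) (c, b)"
          by (auto simp: lookup_restr)
      qed
    qed (auto simp: keys_restr intro: rev_image_eqI)
    then show ?thesis using True by (simp add: k McLain_simps lookup_add lookup_restr)
  qed
qed

lemma restr_L_inv:
  fixes x :: "'l \<times> 'l \<Rightarrow>\<^sub>0 'r"
  assumes "x \<in> carrier McLain"
  shows "restr L (McLain_inv x) = McLain_inv (restr L x)"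
proof -
  have c: "restr L y \<in> carrier McLain" if "y \<in> carrier McLain" for y :: "'l \<times> 'l \<Rightarrow>\<^sub>0 'r"
    using that by (auto simp: McLain_simps(1) keys_restr)
  have "restr L (McLain_inv x) \<otimes>\<^bsub>McLain\<^esub> restr L x = \<one>\<^bsub>McLain\<^esub>"
    using restr_L_mult[of "McLain_inv x" x] assms by (simp add: McLain_simps(3) restr_id)
  then show ?thesis using McLain.inv_equality c assms by (metis McLain.inv_closed)
qed

lemma L_projection_eq:
  fixes m :: "'l \<times> 'l \<Rightarrow>\<^sub>0 'r"
  assumes m: "m \<in> carrier McLain"
  shows "L_projection \<alpha> \<beta> m = restr L m"
  unfolding L_projection_def
proof (rule the_equality)
  have c: "restr L m \<in> carrier McLain" using m by (auto simp: McLain_simps(1) keys_restr)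
  let ?n = "m \<otimes>\<^bsub>McLain\<^esub> McLain_inv (restr L m)"
  have "restr L ?n = 0"
    using restr_L_mult[of m "McLain_inv (restr L m)"] restr_L_inv[OF c] m c
    by (simp add: restr_restr McLain_simps(3))
  then have "keys ?n \<inter> L = {}" by (metis keys_restr keys_zero)
  moreover have "keys ?n \<subseteq> Phi"
    using m c McLain.m_closed[OF m McLain.inv_closed[OF c]] by (simp add: McLain_simps(1))
  ultimately have "keys ?n \<subseteq> N_set \<alpha> \<beta>"
    unfolding N_set_facts(1) by (rule subset_Diff_disjoint)
  then have n: "?n \<in> McLain_sub (N_set \<alpha> \<beta>)" by (simp only: mem_McLain_sub)
  have "m = ?n \<otimes>\<^bsub>McLain\<^esub> restr L m"
    using m c by (simp add: McLain.m_assoc)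
  then have "\<exists>n\<in>McLain_sub (N_set \<alpha> \<beta>). m = n \<otimes>\<^bsub>McLain\<^esub> restr L m" using n by (rule rev_bexI[rotated])
  then show "restr L m \<in> McLain_sub L \<and> (\<exists>n\<in>McLain_sub (N_set \<alpha> \<beta>). m = n \<otimes>\<^bsub>McLain\<^esub> restr L m)"
    by (simp add: mem_McLain_sub(1) keys_restr)
next
  fix l :: "'l \<times> 'l \<Rightarrow>\<^sub>0 'r"
  assume "l \<in> McLain_sub L \<and> (\<exists>n\<in>McLain_sub (N_set \<alpha> \<beta>). m = n \<otimes>\<^bsub>McLain\<^esub> l)"
  then obtain n where n: "keys n \<subseteq> N_set \<alpha> \<beta>" "m = n \<otimes>\<^bsub>McLain\<^esub> l"
    and l: "keys l \<subseteq> L" by (auto simp: mem_McLain_sub)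
  have "restr L n = 0"
    using n(1) by (intro poly_mapping_eqI) (auto simp: N_set_facts(1) lookup_restr in_keys_iff)
  moreover have "n \<in> carrier McLain" "l \<in> carrier McLain"
    using n l N_set_facts L_set_facts by (auto simp: McLain_simps(1))
  ultimately show "l = restr L m"
    using restr_L_mult[of n l] restr_id[OF l] n(2) McLain.l_one[of l] by (simp add: McLain_simps(3))
qed

lemma elementary_model_gmodule: "gmodule McLain (row_module {(\<alpha>, \<beta>)} (\<lambda>_. \<mu>))"
  by (rule gmodule_row_module) (use \<mu> in auto)

text \<open>The truncated row of (\<alpha>, \<beta>) and the position (\<alpha>, \<beta>) itself lie
  in L, and these are the only entries that the action of the model looks at. So in the model, too,
  M acts through its projection to L.\<close>

lemma act_row_module_restr_L:
  fixes m :: "'l \<times> 'l \<Rightarrow>\<^sub>0 'r"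
  assumes m: "m \<in> carrier McLain" and v: "v \<in> carrier (row_module {(\<alpha>, \<beta>)} (\<lambda>_. \<mu>))"
  shows "act (row_module {(\<alpha>, \<beta>)} (\<lambda>_. \<mu>)) (restr L m) v = act (row_module {(\<alpha>, \<beta>)} (\<lambda>_. \<mu>)) m v"
  unfolding row_module_simps
proof (rule plin_cong)
  fix X assume "X \<in> keys v"
  then have X: "X \<in> rows {(\<alpha>, \<beta>)}" using v by (auto simp: row_module_simps)
  have "restr L (X \<otimes>\<^bsub>McLain\<^esub> McLain_inv m) = X \<otimes>\<^bsub>McLain\<^esub> McLain_inv (restr L m)"
    using restr_L_mult[OF rows_carrier[OF X], of "McLain_inv m"] restr_L_inv[OF m] m X L_set_facts(4)
    by (simp add: restr_id)
  then have "restr L (X \<otimes>\<^bsub>McLain\<^esub> McLain_inv (restr L m)) = restr L (X \<otimes>\<^bsub>McLain\<^esub> McLain_inv m)"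
    by (metis restr_restr)
  then have eq: "lookup (X \<otimes>\<^bsub>McLain\<^esub> McLain_inv (restr L m)) k
      = lookup (X \<otimes>\<^bsub>McLain\<^esub> McLain_inv m) k" if "k \<in> L" for k
    using that by (simp add: restr_eq_iff)
  have "row_act {(\<alpha>, \<beta>)} (restr L m) X = row_act {(\<alpha>, \<beta>)} m X"
    unfolding row_act_def restr_eq_iff using eq L_set_facts(4) by blast
  moreover have "row_coeff {(\<alpha>, \<beta>)} (\<lambda>_. \<mu>) (restr L m) X = row_coeff {(\<alpha>, \<beta>)} (\<lambda>_. \<mu>) m X"
    using eq[OF L_set_facts(3)] by (simp add: row_coeff_def)
  ultimately show "single (row_act {(\<alpha>, \<beta>)} (restr L m) X) (row_coeff {(\<alpha>, \<beta>)} (\<lambda>_. \<mu>) (restr L m) X)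
    = single (row_act {(\<alpha>, \<beta>)} m X) (row_coeff {(\<alpha>, \<beta>)} (\<lambda>_. \<mu>) m X)" by simp
qed

private abbreviation "GL \<equiv> (McLain\<lparr>carrier := McLain_sub L\<rparr> :: ('l \<times> 'l \<Rightarrow>\<^sub>0 'r) monoid)"
private abbreviation "HP \<equiv> (McLain_sub (P_set \<alpha> \<beta>) :: ('l \<times> 'l \<Rightarrow>\<^sub>0 'r) set)"
private abbreviation "W \<equiv> row_module {(\<alpha>, \<beta>)} (\<lambda>_. \<mu>)"
private abbreviation "\<chi> \<equiv> extended_character (P_set \<alpha> \<beta>) (\<alpha>, \<beta>) \<mu>"
private abbreviation "one_vec \<equiv> single (0 :: 'l \<times> 'l \<Rightarrow>\<^sub>0 'r) (1 :: 'f)"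

lemmas [simp] = mem_McLain_sub

private lemma McLain_c: "keys x \<subseteq> L \<Longrightarrow> x \<in> carrier McLain"
  using L_set_facts(2) by (auto simp: McLain_simps(1))

private lemma chi: "h \<in> HP \<Longrightarrow> \<chi> h = \<mu> (lookup h (\<alpha>, \<beta>))"
  by (rule extended_character_eq[OF P_set_facts(2,3,4) _ \<mu>]) (auto simp: P_set_def)

private lemma act_one_vec:
  assumes "x \<in> carrier McLain"
  shows "act W x one_vec = single (restr T (McLain_inv x)) (\<mu> (- lookup (McLain_inv x) (\<alpha>, \<beta>)))"
proof -
  have "0 \<otimes>\<^bsub>McLain\<^esub> McLain_inv x = McLain_inv x"
    using McLain.l_one[of "McLain_inv x"] assms by (simp add: McLain_simps(3))
  then show ?thesis
    by (simp add: act_row_module_single row_act_def row_coeff_def del: single_one)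
qed

private lemma act_P:
  assumes h: "h \<in> HP"
  shows "act W h one_vec = single 0 (\<chi> h)"
proof -
  have hc: "keys h \<subseteq> P_set \<alpha> \<beta>" using h by simp
  have c: "h \<in> carrier McLain" using hc P_set_facts(3) by (auto simp: McLain_simps(1))
  have k: "keys (McLain_inv h) \<subseteq> P_set \<alpha> \<beta>"
    by (rule McLain_keys_inv[OF P_set_facts(2,3) hc])
  have 0: "restr T (McLain_inv h) = 0"
    using k P_set_facts(1) by (intro poly_mapping_eqI) (auto simp: lookup_restr in_keys_iff)
  have "lookup (h \<otimes>\<^bsub>McLain\<^esub> McLain_inv h) (\<alpha>, \<beta>)
      = lookup h (\<alpha>, \<beta>) + lookup (McLain_inv h) (\<alpha>, \<beta>)"
  proof -
    have "(\<alpha>, \<beta>) \<notin> keys (J_mult h (McLain_inv h))"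
    proof
      assume "(\<alpha>, \<beta>) \<in> keys (J_mult h (McLain_inv h))"
      then obtain c where "(\<alpha>, c) \<in> keys h" "(c, \<beta>) \<in> keys (McLain_inv h)"
        by (rule keys_J_mult)
      then have "(\<alpha>, c) \<in> P_set \<alpha> \<beta>" "(c, \<beta>) \<in> P_set \<alpha> \<beta>" using hc k by auto
      then show False by (auto simp: P_set_def)
    qed
    then show ?thesis by (simp add: McLain_simps lookup_add in_keys_iff)
  qed
  then have "lookup h (\<alpha>, \<beta>) + lookup (McLain_inv h) (\<alpha>, \<beta>) = 0"
    using c by (simp add: McLain_simps(3))
  then have "- lookup (McLain_inv h) (\<alpha>, \<beta>) = lookup h (\<alpha>, \<beta>)"
    by (simp add: add_eq_0_iff2)
  then show ?thesis using act_one_vec[OF c] chi[OF h] 0 by simp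
qed

private abbreviation "ind_E \<equiv> ({single (x, w \<oplus>\<^bsub>one_dim_gmodule \<chi>\<^esub> w') 1
           - single (x, w) 1 - single (x, w') 1
         | x w w'. x \<in> carrier GL \<and> w \<in> carrier (one_dim_gmodule \<chi>) \<and> w' \<in> carrier (one_dim_gmodule \<chi>)}
        \<union> {single (x, c \<odot>\<^bsub>one_dim_gmodule \<chi>\<^esub> w) 1 - single (x, w) c
         | x c w. x \<in> carrier GL \<and> w \<in> carrier (one_dim_gmodule \<chi>)}
        \<union> {single (x \<otimes>\<^bsub>GL\<^esub> h, w) 1 - single (x, act (one_dim_gmodule \<chi>) h w) 1
         | x h w. x \<in> carrier GL \<and> h \<in> HP \<and> w \<in> carrier (one_dim_gmodule \<chi>)}
   :: (('l \<times> 'l \<Rightarrow>\<^sub>0 'r) \<times> 'f \<Rightarrow>\<^sub>0 'f) set)"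

text \<open>The comparison map sends the tensor of x and w to w times x applied to the basis vector
  of the zero row. This respects the relators because P acts on that vector by its character. A
  section is given by X \<mapsto> X\<inverse>, since X\<inverse> moves the zero row to X.\<close>

lemma elementary_module_iso:
  obtains p where "gmodule McLain (elementary_module \<alpha> \<beta> \<mu>)"
    and "p \<in> gmodule_hom McLain (elementary_module \<alpha> \<beta> \<mu>) W"
    and "bij_betw p (carrier (elementary_module \<alpha> \<beta> \<mu>)) (carrier W)"
proof -
  have WM: "gmodule McLain W" by (rule elementary_model_gmodule)
  have subL: "subgroup (McLain_sub L :: ('l \<times> 'l \<Rightarrow>\<^sub>0 'r) set) McLain"
    using subgroup_McLain_keys[OF L_set_facts(1,2)]
    by (simp add: McLain_sub_eq[OF L_set_facts(1,2)])
  have subP: "subgroup HP McLain"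
    using subgroup_McLain_keys[OF P_set_facts(2,3)]
    by (simp add: McLain_sub_eq[OF P_set_facts(2,3)])
  have WL: "gmodule GL W" by (rule gmodule_restrict_group[OF WM subL])
  define B where "B = carrier GL \<times> carrier (one_dim_gmodule \<chi>)"
  define k where "k = (\<lambda>g. \<lambda>(x :: 'l \<times> 'l \<Rightarrow>\<^sub>0 'r, w :: 'f). (g \<otimes>\<^bsub>GL\<^esub> x, w))"
  define \<psi> where "\<psi> = (\<lambda>(x, w). scale w (act W x one_vec))"
  define \<sigma> where "\<sigma> = (\<lambda>X :: 'l \<times> 'l \<Rightarrow>\<^sub>0 'r. (McLain_inv X, 1 :: 'f))"
  have V: "induced_gmodule GL HP (one_dim_gmodule \<chi>) = presented_gmodule B k ind_E"
    unfolding induced_gmodule_def B_def k_def ..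
  have B: "(x, w) \<in> B \<longleftrightarrow> keys x \<subseteq> L" for x w
    by (simp add: B_def one_dim_gmodule_def)
  have one_vec: "one_vec \<in> carrier W" by (simp add: row_module_simps)
  have actW: "act W x v \<in> carrier W" if "keys x \<subseteq> L" "v \<in> carrier W" for x v
    using gmodule_act(1)[OF WM McLain_c] that by blast
  have act_scale: "act W x (scale c v) = scale c (act W x v)" for x c v
    by (simp add: row_module_simps plin_scale)
  have act_mult: "act W (x \<otimes>\<^bsub>McLain\<^esub> y) v = act W x (act W y v)"
    if "keys x \<subseteq> L" "keys y \<subseteq> L" "v \<in> carrier W" for x y v
    using gmodule.act_mult[OF WM McLain_c McLain_c] that by blast
  have PL: "keys h \<subseteq> L" if "keys h \<subseteq> P_set \<alpha> \<beta>" for h :: "'l \<times> 'l \<Rightarrow>\<^sub>0 'r"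
    using that P_set_facts(1) by blast
  have Lmult: "keys (x \<otimes>\<^bsub>McLain\<^esub> y) \<subseteq> L"
    if "keys x \<subseteq> L" "keys y \<subseteq> L" for x y :: "'l \<times> 'l \<Rightarrow>\<^sub>0 'r"
    by (rule McLain_keys_mult[OF L_set_facts(1) that])
  have Linv: "keys (McLain_inv x) \<subseteq> L" if "keys x \<subseteq> L" for x :: "'l \<times> 'l \<Rightarrow>\<^sub>0 'r"
    by (rule McLain_keys_inv[OF L_set_facts(1,2) that])
  have TL: "keys X \<subseteq> L" if "X \<in> rows {(\<alpha>, \<beta>)}" for X :: "'l \<times> 'l \<Rightarrow>\<^sub>0 'r"
    using that L_set_facts(4) by blast
  have sigma_act: "act W (McLain_inv X) one_vec = single X 1" if "X \<in> rows {(\<alpha>, \<beta>)}" for X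
    using act_one_vec[of "McLain_inv X"] rows_carrier[OF that] that
      lookup_rows_D[of "{(\<alpha>, \<beta>)}" "(\<alpha>, \<beta>)" X] linear_characterD(3)[OF \<mu>]
    by (simp add: restr_id)
  have E: "keys e \<subseteq> B \<and> plin \<psi> e = 0" if "e \<in> ind_E" for e
    using that
  proof (elim UnE CollectE exE conjE)
    fix x w w'
    assume e: "e = single (x, w \<oplus>\<^bsub>one_dim_gmodule \<chi>\<^esub> w') 1
           - single (x, w) 1 - single (x, w') 1" and x: "x \<in> carrier GL"
    have "keys e \<subseteq> B"
      unfolding e by (intro keys_subset) (use x in \<open>simp_all add: B\<close>)
    then show ?thesis unfolding e
      by (simp add: plin_minus \<psi>_def one_dim_gmodule_def scale_add_left)
  next
    fix x c w
    assume e: "e = single (x, c \<odot>\<^bsub>one_dim_gmodule \<chi>\<^esub> w) 1 - single (x, w) c"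
      and x: "x \<in> carrier GL"
    have "keys e \<subseteq> B"
      unfolding e by (intro keys_subset) (use x in \<open>simp_all add: B\<close>)
    then show ?thesis unfolding e
      by (simp add: plin_minus \<psi>_def one_dim_gmodule_def)
  next
    fix x h w
    assume e: "e = single (x \<otimes>\<^bsub>GL\<^esub> h, w) 1 - single (x, act (one_dim_gmodule \<chi>) h w) 1"
      and x: "x \<in> carrier GL" and h: "h \<in> HP"
    have xL: "keys x \<subseteq> L" using x by simp
    have hL: "keys h \<subseteq> L" using h PL by simp
    have "keys e \<subseteq> B"
      unfolding e by (intro keys_subset) (use xL Lmult[OF xL hL] in \<open>simp_all add: B\<close>)
    moreover have "act W (x \<otimes>\<^bsub>McLain\<^esub> h) one_vec = scale (\<chi> h) (act W x one_vec)"
      unfolding act_mult[OF xL hL one_vec] act_P[OF h]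
      using act_scale[of x "\<chi> h" one_vec] by (simp del: single_one)
    ultimately show ?thesis unfolding e
      by (simp add: plin_minus \<psi>_def one_dim_gmodule_def mult.commute)
  qed
  have EB: "ind_E \<subseteq> {x. keys x \<subseteq> B}" by (intro subsetI CollectI conjunct1[OF E])
  have pm: "pm_space (rows {(\<alpha>, \<beta>)}) W" by (rule row_module_pm_space)
  have kB: "k g b \<in> B" if "g \<in> carrier GL" "b \<in> B" for g b
    using that Lmult by (cases b) (simp add: k_def B)
  have psi: "keys (\<psi> b) \<subseteq> rows {(\<alpha>, \<beta>)}" if "b \<in> B" for b
  proof (cases b)
    case (Pair x w)
    then show ?thesis using actW[OF _ one_vec, of x] that
      by (simp add: \<psi>_def B row_module_simps(1) keys_subset(1))
  qed
  have psi_act: "\<psi> (k g b) = act W g (\<psi> b)" if "g \<in> carrier GL" "b \<in> B" for g b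
    using that act_mult[OF _ _ one_vec] by (cases b) (simp add: k_def B \<psi>_def act_scale)
  have sig: "\<sigma> X \<in> B \<and> \<psi> (\<sigma> X) = single X 1" if "X \<in> rows {(\<alpha>, \<beta>)}" for X
    using Linv[OF TL[OF that]] sigma_act[OF that] by (simp add: \<sigma>_def B \<psi>_def)
  have sec: "single b 1 - plin (\<lambda>X. single (\<sigma> X) 1) (\<psi> b)
      \<in> LinearCombinations.module.span class_ring
          (free_gmodule B k :: ('f, ('l \<times> 'l \<Rightarrow>\<^sub>0 'r) \<times> 'f \<Rightarrow>\<^sub>0 'f, 'l \<times> 'l \<Rightarrow>\<^sub>0 'r) gmodule) ind_E" if b: "b \<in> B" for b
  proof -
    note N = free_gmodule_span[where k = k, OF EB]
    obtain x w where bxw: "b = (x, w)" by fastforce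
    have xL: "keys x \<subseteq> L" using b by (simp add: bxw B)
    \<comment> \<open>X\<inverse> represents the coset of x modulo P: the rest of this block shows
      that x = X\<inverse> h with h in P, because the truncated row of h\<inverse> vanishes.\<close>
    define X where "X = restr T (McLain_inv x)"
    have X: "X \<in> rows {(\<alpha>, \<beta>)}" by (simp add: X_def keys_restr)
    define h where "h = X \<otimes>\<^bsub>McLain\<^esub> x"
    have c: "x \<in> carrier McLain" "X \<in> carrier McLain"
      using McLain_c xL rows_carrier[OF X] by auto
    have hL: "keys h \<subseteq> L" unfolding h_def by (rule Lmult[OF TL[OF X] xL])
    have xh: "x = McLain_inv X \<otimes>\<^bsub>McLain\<^esub> h"
      unfolding h_def using c by (simp add: McLain.inv_solve_left)
    have hP: "h \<in> HP"
    proof -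
      have "restr T (McLain_inv h) = restr T (McLain_inv x \<otimes>\<^bsub>McLain\<^esub> McLain_inv X)"
        unfolding h_def using c by (simp add: McLain.inv_mult_group)
      also have "\<dots> = restr T (X \<otimes>\<^bsub>McLain\<^esub> McLain_inv X)"
        unfolding X_def by (rule restr_Theta_mult[symmetric]) (use c X_def in auto)
      also have "\<dots> = 0" using c by (simp add: McLain_simps(3) restr_id)
      finally have "keys (McLain_inv h) \<inter> T = {}" by (metis keys_restr keys_zero)
      then have "keys (McLain_inv h) \<subseteq> P_set \<alpha> \<beta>"
        unfolding P_set_facts(1) using Linv[OF hL] by (rule subset_Diff_disjoint)
      then have "McLain_inv (McLain_inv h) \<in> HP"
        using subgroup.m_inv_closed[OF subP] by simp
      then show ?thesis using McLain_c[OF hL] by simp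
    qed
    have "act W x one_vec = scale (\<chi> h) (single X 1)"
      unfolding xh act_mult[OF Linv[OF TL[OF X]] hL one_vec] act_P[OF hP] sigma_act[OF X, symmetric]
      using act_scale[of "McLain_inv X" "\<chi> h" one_vec] by (simp del: single_one)
    then have psib: "\<psi> b = single X (w * \<chi> h)"
      by (simp add: \<psi>_def bxw)
    have mX: "McLain_inv X \<in> carrier GL" using Linv[OF TL[OF X]] by simp
    have mw: "a \<in> carrier (one_dim_gmodule \<chi>)" for a by (simp add: one_dim_gmodule_def)
    \<comment> \<open>One relator moves \<open>h\<close> across the tensor sign, the other takes the
      resulting scalar out; together they reduce an arbitrary generator to the representative of its
      coset.\<close>
    have 1: "single (McLain_inv X \<otimes>\<^bsub>GL\<^esub> h, w) 1
        - single (McLain_inv X, act (one_dim_gmodule \<chi>) h w) 1 \<in> ind_E"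
      by (rule UnI2) (use mX mw hP in blast)
    have 2: "single (McLain_inv X, (\<chi> h * w) \<odot>\<^bsub>one_dim_gmodule \<chi>\<^esub> 1) 1
        - single (McLain_inv X, 1) (\<chi> h * w) \<in> ind_E"
      by (rule UnI1, rule UnI2) (use mX mw in blast)
    have "single b 1 - plin (\<lambda>X. single (\<sigma> X) 1) (\<psi> b)
      = (single (McLain_inv X \<otimes>\<^bsub>GL\<^esub> h, w) 1
        - single (McLain_inv X, act (one_dim_gmodule \<chi>) h w) 1)
      + (single (McLain_inv X, (\<chi> h * w) \<odot>\<^bsub>one_dim_gmodule \<chi>\<^esub> 1) 1
        - single (McLain_inv X, 1) (\<chi> h * w))"
      unfolding psib by (simp add: bxw \<sigma>_def one_dim_gmodule_def mult.commute flip: xh)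
    also have "\<dots> \<in> LinearCombinations.module.span class_ring
          (free_gmodule B k :: ('f, ('l \<times> 'l \<Rightarrow>\<^sub>0 'r) \<times> 'f \<Rightarrow>\<^sub>0 'f, 'l \<times> 'l \<Rightarrow>\<^sub>0 'r) gmodule) ind_E"
      by (intro N(3) N(1) 1 2)
    finally show ?thesis .
  qed
  note iso = presented_gmodule_iso[OF WL pm kB psi E psi_act sig sec]
  let ?V = "presented_gmodule B k ind_E :: ('f, (('l \<times> 'l \<Rightarrow>\<^sub>0 'r) \<times> 'f \<Rightarrow>\<^sub>0 'f) set, 'l \<times> 'l \<Rightarrow>\<^sub>0 'r) gmodule"
  let ?p = "\<lambda>A. the_elem (plin \<psi> ` A)"
  have el: "elementary_module \<alpha> \<beta> \<mu> = ?V\<lparr>act := \<lambda>m. act ?V (L_projection \<alpha> \<beta> m)\<rparr>"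
    by (simp add: elementary_module_def V Let_def)
  have V: "gmodule GL ?V" and p: "?p \<in> gmodule_hom GL ?V W" and bij: "bij_betw ?p (carrier ?V) (carrier W)"
    using iso(1-3) by blast+
  have bij': "bij_betw ?p (carrier (elementary_module \<alpha> \<beta> \<mu>)) (carrier W)"
    using bij by (simp add: el)
  have \<rho>: "L_projection \<alpha> \<beta> m \<in> carrier GL"
    if "m \<in> carrier (McLain :: ('l \<times> 'l \<Rightarrow>\<^sub>0 'r) monoid)" for m
    using L_projection_eq[OF that] by (simp add: keys_restr)
  have act\<rho>: "act W (L_projection \<alpha> \<beta> m) v = act W m v"
    if "m \<in> carrier (McLain :: ('l \<times> 'l \<Rightarrow>\<^sub>0 'r) monoid)" "v \<in> carrier W" for m v
    using L_projection_eq[OF that(1)] act_row_module_restr_L[OF that] by simp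
  have "gmodule McLain (elementary_module \<alpha> \<beta> \<mu>)"
    unfolding el by (rule gmodule_pullback(1)[OF V WM p bij \<rho> act\<rho>])
  moreover have "?p \<in> gmodule_hom McLain (elementary_module \<alpha> \<beta> \<mu>) W"
    unfolding el by (rule gmodule_pullback(2)[OF V WM p bij \<rho> act\<rho>])
  ultimately show thesis using that bij' by blast
qed

end

section \<open>Tensor products of monomial modules\<close>

lemma lookup_monomial_act:
  assumes "inj_on (k g) B" "keys v \<subseteq> B" "b \<in> B"
  shows "lookup (act (monomial_gmodule B k c) g v) (k g b) = c g b * lookup v b"
proof -
  have "lookup (act (monomial_gmodule B k c) g v) (k g b)
    = (\<Sum>a\<in>keys v. if a = b then lookup v b * c g b else 0)"
    unfolding monomial_gmodule_simps lookup_plin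
    by (rule sum.cong) (use assms inj_onD[OF assms(1)] in \<open>auto simp: lookup_single when_def\<close>)
  then show ?thesis by (auto simp: sum.delta in_keys_iff mult.commute)
qed

context
  fixes G :: "('g, 'x) monoid_scheme" and D :: "'i set"
    and U :: "'i \<Rightarrow> ('f::field, 'v, 'g) gmodule" and \<theta> :: "'i \<Rightarrow> 'v \<Rightarrow> ('y \<Rightarrow>\<^sub>0 'f)"
    and Y :: "'i \<Rightarrow> 'y set" and k :: "'i \<Rightarrow> 'g \<Rightarrow> 'y \<Rightarrow> 'y" and c :: "'i \<Rightarrow> 'g \<Rightarrow> 'y \<Rightarrow> 'f"
    and Z :: "'y set" and kZ :: "'g \<Rightarrow> 'y \<Rightarrow> 'y" and cZ :: "'g \<Rightarrow> 'y \<Rightarrow> 'f"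
    and \<pi> :: "'i \<Rightarrow> 'y \<Rightarrow> 'y"
  assumes finD: "finite D"
    and U: "\<And>i. i \<in> D \<Longrightarrow> gmodule G (U i)"
    and V: "\<And>i. i \<in> D \<Longrightarrow> gmodule G (monomial_gmodule (Y i) (k i) (c i))"
    and VZ: "gmodule G (monomial_gmodule Z kZ cZ)"
    and \<theta>: "\<And>i. i \<in> D \<Longrightarrow> \<theta> i \<in> gmodule_hom G (U i) (monomial_gmodule (Y i) (k i) (c i))"
    and bij: "\<And>i. i \<in> D \<Longrightarrow> bij_betw (\<theta> i) (carrier (U i)) {x. keys x \<subseteq> Y i}"
    and k_inj: "\<And>i g. \<lbrakk>i \<in> D; g \<in> carrier G\<rbrakk> \<Longrightarrow> inj_on (k i g) (Y i)"
    and kZ_bij: "\<And>g. g \<in> carrier G \<Longrightarrow> bij_betw (kZ g) Z Z"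
    and \<pi>_mem: "\<And>i X. \<lbrakk>i \<in> D; X \<in> Z\<rbrakk> \<Longrightarrow> \<pi> i X \<in> Y i"
    and \<pi>_inj: "\<And>X X'. \<lbrakk>X \<in> Z; X' \<in> Z; \<And>i. i \<in> D \<Longrightarrow> \<pi> i X = \<pi> i X'\<rbrakk> \<Longrightarrow> X = X'"
    and \<pi>_surj: "\<And>y. (\<And>i. i \<in> D \<Longrightarrow> y i \<in> Y i) \<Longrightarrow> \<exists>X\<in>Z. \<forall>i\<in>D. \<pi> i X = y i"
    and \<pi>_k: "\<And>i g X. \<lbrakk>i \<in> D; g \<in> carrier G; X \<in> Z\<rbrakk> \<Longrightarrow> \<pi> i (kZ g X) = k i g (\<pi> i X)"
    and cZ: "\<And>g X. \<lbrakk>g \<in> carrier G; X \<in> Z\<rbrakk> \<Longrightarrow> cZ g X = (\<Prod>i\<in>D. c i g (\<pi> i X))"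
begin

private abbreviation "B \<equiv> \<Pi>\<^sub>E i\<in>D. carrier (U i)"
private abbreviation "tk \<equiv> \<lambda>g t. \<lambda>i\<in>D. act (U i) g (t i)"
private abbreviation "E1 \<equiv> {single (t(i := u \<oplus>\<^bsub>U i\<^esub> v)) 1
           - single (t(i := u)) 1 - single (t(i := v)) 1
         | t i u v. t \<in> (\<Pi>\<^sub>E i\<in>D. carrier (U i)) \<and> i \<in> D
                    \<and> u \<in> carrier (U i) \<and> v \<in> carrier (U i)} :: (('i \<Rightarrow> 'v) \<Rightarrow>\<^sub>0 'f) set"
private abbreviation "E2 \<equiv> {single (t(i := c \<odot>\<^bsub>U i\<^esub> u)) 1 - single (t(i := u)) c
         | t i c u. t \<in> (\<Pi>\<^sub>E i\<in>D. carrier (U i)) \<and> i \<in> D \<and> u \<in> carrier (U i)} :: (('i \<Rightarrow> 'v) \<Rightarrow>\<^sub>0 'f) set"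
private abbreviation "NT \<equiv> LinearCombinations.module.span class_ring
  (free_gmodule B tk :: ('f, ('i \<Rightarrow> 'v) \<Rightarrow>\<^sub>0 'f, 'g) gmodule) (E1 \<union> E2)"

text \<open>The coefficient of a pure tensor at X is the product of the coefficients of its factors
  at the components \<open>\<pi> i X\<close>. The support is finite, as \<open>lookup_\<psi>\<close>
  needs, because the components embed it into a finite product of finite supports.\<close>

private definition \<psi> :: "('i \<Rightarrow> 'v) \<Rightarrow> ('y \<Rightarrow>\<^sub>0 'f)" where
  "\<psi> t = Abs_poly_mapping (\<lambda>X. if X \<in> Z then \<Prod>i\<in>D. lookup (\<theta> i (t i)) (\<pi> i X) else 0)"

private lemma lookup_\<psi>: "lookup (\<psi> t) X
    = (if X \<in> Z then \<Prod>i\<in>D. lookup (\<theta> i (t i)) (\<pi> i X) else 0)"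
proof -
  let ?f = "\<lambda>X. if X \<in> Z then \<Prod>i\<in>D. lookup (\<theta> i (t i)) (\<pi> i X) else 0"
  let ?r = "\<lambda>X. \<lambda>i\<in>D. \<pi> i X"
  have "?r ` {X. ?f X \<noteq> 0} \<subseteq> (\<Pi>\<^sub>E i\<in>D. keys (\<theta> i (t i)))"
    using finD by (auto simp: in_keys_iff split: if_splits)
  moreover have "finite (\<Pi>\<^sub>E i\<in>D. keys (\<theta> i (t i)))"
    using finD by (intro finite_PiE) auto
  ultimately have "finite (?r ` {X. ?f X \<noteq> 0})" by (rule finite_subset)
  moreover have "inj_on ?r {X. ?f X \<noteq> 0}"
  proof (rule inj_onI)
    fix X X' assume "X \<in> {X. ?f X \<noteq> 0}" "X' \<in> {X. ?f X \<noteq> 0}" and eq: "?r X = ?r X'"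
    then have XZ: "X \<in> Z" "X' \<in> Z" by (auto split: if_splits)
    have "\<pi> i X = \<pi> i X'" if "i \<in> D" for i using fun_cong[OF eq, of i] that by simp
    then show "X = X'" using \<pi>_inj[OF XZ] by blast
  qed
  ultimately have "finite {X. ?f X \<noteq> 0}" by (rule finite_imageD)
  then show ?thesis unfolding \<psi>_def by (subst Abs_poly_mapping_inverse) auto
qed

private lemma lookup_\<psi>_upd:
  assumes "i \<in> D"
  shows "lookup (\<psi> (t(i := a))) X = (if X \<in> Z then lookup (\<theta> i a) (\<pi> i X)
    * (\<Prod>j\<in>D - {i}. lookup (\<theta> j (t j)) (\<pi> j X)) else 0)"
proof -
  have "(\<Prod>j\<in>D - {i}. lookup (\<theta> j ((t(i := a)) j)) (\<pi> j X))
    = (\<Prod>j\<in>D - {i}. lookup (\<theta> j (t j)) (\<pi> j X))"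
    by (rule prod.cong) auto
  then show ?thesis
    unfolding lookup_\<psi> using prod.remove[OF finD assms, of "\<lambda>j. lookup (\<theta> j ((t(i := a)) j)) (\<pi> j X)"]
    by (simp del: fun_upd_apply) (simp add: fun_upd_apply)
qed

private lemma \<theta>_hom:
  assumes "i \<in> D" "u \<in> carrier (U i)" "v \<in> carrier (U i)"
  shows "\<theta> i (u \<oplus>\<^bsub>U i\<^esub> v) = \<theta> i u + \<theta> i v" "\<theta> i (a \<odot>\<^bsub>U i\<^esub> u) = scale a (\<theta> i u)"
    "g \<in> carrier G \<Longrightarrow> \<theta> i (act (U i) g u) = act (monomial_gmodule (Y i) (k i) (c i)) g (\<theta> i u)"
    "keys (\<theta> i u) \<subseteq> Y i"
    "u \<oplus>\<^bsub>U i\<^esub> v \<in> carrier (U i)" "a \<odot>\<^bsub>U i\<^esub> u \<in> carrier (U i)"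
    "g \<in> carrier G \<Longrightarrow> act (U i) g u \<in> carrier (U i)"
proof -
  interpret Ui: vectorspace class_ring "U i" by (rule gmodule_vectorspace[OF U[OF assms(1)]])
  show "\<theta> i (u \<oplus>\<^bsub>U i\<^esub> v) = \<theta> i u + \<theta> i v" "\<theta> i (a \<odot>\<^bsub>U i\<^esub> u) = scale a (\<theta> i u)"
    "g \<in> carrier G \<Longrightarrow> \<theta> i (act (U i) g u) = act (monomial_gmodule (Y i) (k i) (c i)) g (\<theta> i u)"
    "keys (\<theta> i u) \<subseteq> Y i"
    using \<theta>[OF assms(1)] assms(2,3) unfolding gmodule_hom_iff monomial_gmodule_simps(1-4) by blast+
  show "u \<oplus>\<^bsub>U i\<^esub> v \<in> carrier (U i)" "a \<odot>\<^bsub>U i\<^esub> u \<in> carrier (U i)" using assms by auto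
  show "g \<in> carrier G \<Longrightarrow> act (U i) g u \<in> carrier (U i)"
    using gmodule_act(1)[OF U[OF assms(1)]] assms by blast
qed

private lemma upd_mem: "t \<in> B \<Longrightarrow> i \<in> D \<Longrightarrow> u \<in> carrier (U i) \<Longrightarrow> t(i := u) \<in> B"
  by (auto simp: PiE_iff extensional_def)

private lemma relators:
  assumes "e \<in> E1 \<union> E2"
  shows "keys e \<subseteq> B \<and> plin \<psi> e = 0"
  using assms
proof (elim UnE CollectE exE conjE)
  fix t i u v
  assume e: "e = single (t(i := u \<oplus>\<^bsub>U i\<^esub> v)) 1
           - single (t(i := u)) 1 - single (t(i := v)) 1"
    and t: "t \<in> B" "i \<in> D" "u \<in> carrier (U i)" "v \<in> carrier (U i)"
  have "keys e \<subseteq> B"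
    unfolding e using upd_mem[OF t(1,2)] \<theta>_hom(5)[OF t(2-4)] t
    by (intro keys_subset(3)) (simp_all del: fun_upd_apply)
  moreover have "\<psi> (t(i := u \<oplus>\<^bsub>U i\<^esub> v)) = \<psi> (t(i := u)) + \<psi> (t(i := v))"
    by (rule poly_mapping_eqI)
      (simp add: lookup_add lookup_\<psi>_upd[OF t(2)] \<theta>_hom(1)[OF t(2-4)] algebra_simps)
  ultimately show ?thesis unfolding e by (simp add: plin_minus)
next
  fix t i u a
  assume e: "e = single (t(i := a \<odot>\<^bsub>U i\<^esub> u)) 1 - single (t(i := u)) a"
    and t: "t \<in> B" "i \<in> D" "u \<in> carrier (U i)"
  have "keys e \<subseteq> B"
    unfolding e using upd_mem[OF t(1,2)] \<theta>_hom(6)[OF t(2,3,3)] t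
    by (intro keys_subset(3)) (simp_all del: fun_upd_apply)
  moreover have "\<psi> (t(i := a \<odot>\<^bsub>U i\<^esub> u)) = scale a (\<psi> (t(i := u)))"
    by (rule poly_mapping_eqI)
      (simp add: lookup_\<psi>_upd[OF t(2)] \<theta>_hom(2)[OF t(2,3,3)] algebra_simps)
  ultimately show ?thesis unfolding e by (simp add: plin_minus)
qed

private definition \<tau> :: "'i \<Rightarrow> 'y \<Rightarrow> 'v" where
  "\<tau> i y = the_inv_into (carrier (U i)) (\<theta> i) (single y 1)"

private lemma \<tau>:
  assumes "i \<in> D" "y \<in> Y i"
  shows "\<tau> i y \<in> carrier (U i)" "\<theta> i (\<tau> i y) = single y 1"
proof -
  have "single y (1 :: 'f) \<in> \<theta> i ` carrier (U i)"
    using bij[OF assms(1)] assms(2) by (auto simp: bij_betw_def)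
  then show "\<tau> i y \<in> carrier (U i)" "\<theta> i (\<tau> i y) = single y 1"
    using the_inv_into_into[of "\<theta> i" "carrier (U i)"] f_the_inv_into_f[of "\<theta> i" "carrier (U i)"]
      bij[OF assms(1)] by (auto simp: bij_betw_def \<tau>_def)
qed

text \<open>The vectors \<open>\<tau> i y\<close> are the preimages of the basis of the monomial
  factor. The conclusion is needed for predicates known to be compatible with the operations of
  \<open>U i\<close>, where a single tensor slot varies.\<close>

private lemma basis_induct:
  assumes i: "i \<in> D" and u: "u \<in> carrier (U i)"
    and zero: "Q \<zero>\<^bsub>U i\<^esub>"
    and basis: "\<And>y. y \<in> Y i \<Longrightarrow> Q (\<tau> i y)"
    and add: "\<And>u v. \<lbrakk>u \<in> carrier (U i); v \<in> carrier (U i); Q u; Q v\<rbrakk> \<Longrightarrow> Q (u \<oplus>\<^bsub>U i\<^esub> v)"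
    and smult: "\<And>a u. \<lbrakk>u \<in> carrier (U i); Q u\<rbrakk> \<Longrightarrow> Q (a \<odot>\<^bsub>U i\<^esub> u)"
  shows "Q u"
proof -
  interpret Ui: vectorspace class_ring "U i" by (rule gmodule_vectorspace[OF U[OF i]])
  have inj: "inj_on (\<theta> i) (carrier (U i))" using bij[OF i] by (simp add: bij_betw_def)
  have zero_im: "\<theta> i \<zero>\<^bsub>U i\<^esub> = 0"
    using gmodule_hom_zero[OF U[OF i] V[OF i] \<theta>[OF i]] by (simp add: monomial_gmodule_simps)
  have "\<exists>w\<in>carrier (U i). Q w \<and> \<theta> i w = (\<Sum>y\<in>A. scale (a y) (single y 1))"
    if "finite A" "A \<subseteq> Y i" for A and a :: "'y \<Rightarrow> 'f"
    using that
  proof (induction A rule: finite_induct)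
    case empty
    then show ?case using zero zero_im by (intro bexI[of _ "\<zero>\<^bsub>U i\<^esub>"]) auto
  next
    case (insert y A)
    then obtain w where w: "w \<in> carrier (U i)" "Q w"
      "\<theta> i w = (\<Sum>y\<in>A. scale (a y) (single y 1))" by auto
    have y: "y \<in> Y i" using insert by simp
    let ?w = "(a y \<odot>\<^bsub>U i\<^esub> \<tau> i y) \<oplus>\<^bsub>U i\<^esub> w"
    have 1: "a y \<odot>\<^bsub>U i\<^esub> \<tau> i y \<in> carrier (U i)" by (rule \<theta>_hom(6)[OF i \<tau>(1)[OF i y] \<tau>(1)[OF i y]])
    have "Q ?w" by (intro add smult basis 1 w \<tau>(1)[OF i y] y)
    moreover have "\<theta> i ?w = scale (a y) (single y 1) + \<theta> i w"
      using \<theta>_hom(1)[OF i 1 w(1)] \<theta>_hom(2)[OF i \<tau>(1)[OF i y] \<tau>(1)[OF i y]] \<tau>(2)[OF i y] by simp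
    moreover have "?w \<in> carrier (U i)" by (rule \<theta>_hom(5)[OF i 1 w(1)])
    ultimately show ?case using insert w by (intro bexI[of _ ?w]) auto
  qed
  from this[of "keys (\<theta> i u)" "lookup (\<theta> i u)"]
  obtain w where w: "w \<in> carrier (U i)" "Q w" "\<theta> i w = plin (\<lambda>y. single y 1) (\<theta> i u)"
    using \<theta>_hom(4)[OF i u u] by (auto simp: plin_def)
  then have "w = u" using inj_onD[OF inj _ w(1) u] by (simp add: plin_single_id)
  then show ?thesis using w by simp
qed

private definition \<sigma> :: "'y \<Rightarrow> 'i \<Rightarrow> 'v" where
  "\<sigma> X = (\<lambda>i\<in>D. \<tau> i (\<pi> i X))"

private lemma \<sigma>:
  assumes X: "X \<in> Z"
  shows "\<sigma> X \<in> B \<and> \<psi> (\<sigma> X) = single X 1"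
proof
  show "\<sigma> X \<in> B" using \<tau>(1) \<pi>_mem[OF _ X] by (auto simp: \<sigma>_def)
  show "\<psi> (\<sigma> X) = single X 1"
  proof (rule poly_mapping_eqI)
    fix X'
    have "lookup (\<psi> (\<sigma> X)) X' = (if X' \<in> Z then \<Prod>i\<in>D. (if \<pi> i X = \<pi> i X' then 1 else 0) else 0)"
      unfolding lookup_\<psi>
      by (intro if_cong refl prod.cong) (use \<tau>(2) \<pi>_mem[OF _ X] in \<open>auto simp: \<sigma>_def lookup_single when_def\<close>)
    also have "\<dots> = (if X' = X then 1 else 0)"
    proof (cases "X' \<in> Z \<and> X' \<noteq> X")
      case True
      then obtain i where "i \<in> D" "\<pi> i X \<noteq> \<pi> i X'" using \<pi>_inj[OF X, of X'] by blast
      then show ?thesis using True finD by (auto intro!: prod_zero)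
    next
      case False
      then show ?thesis using X by (cases "X' = X") simp_all
    qed
    finally show "lookup (\<psi> (\<sigma> X)) X' = lookup (single X 1) X'"
      by (cases "X = X'") (simp_all add: lookup_single when_def)
  qed
qed

text \<open>Multilinear expansion, one slot at a time: the induction runs over the set of slots that
  need not hold a basis vector yet. When none is left, the tensor is itself one of the
  representatives \<open>\<sigma> X\<close>, because the components \<open>\<pi>\<close> are jointly
  surjective.\<close>

private lemma sec:
  assumes t: "t \<in> B"
  shows "single t 1 - plin (\<lambda>X. single (\<sigma> X) 1) (\<psi> t) \<in> NT"
proof -
  have EB: "E1 \<union> E2 \<subseteq> {x. keys x \<subseteq> B}" by (intro subsetI CollectI conjunct1[OF relators])
  note NT = free_gmodule_span[where k = tk, OF EB]
  let ?s = "\<lambda>t. single t 1 - plin (\<lambda>X. single (\<sigma> X) 1) (\<psi> t)"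
  have "\<forall>t\<in>B. (\<forall>i\<in>D - A. t i \<in> \<tau> i ` Y i) \<longrightarrow> ?s t \<in> NT" if "finite A" "A \<subseteq> D" for A
    using that
  proof (induction A rule: finite_induct)
    case empty
    show ?case
    proof (intro ballI impI)
      fix t assume t: "t \<in> B" "\<forall>i\<in>D - {}. t i \<in> \<tau> i ` Y i"
      then have "\<forall>i\<in>D. \<exists>y. y \<in> Y i \<and> t i = \<tau> i y" by auto
      then obtain y where y: "\<And>i. i \<in> D \<Longrightarrow> y i \<in> Y i" "\<And>i. i \<in> D \<Longrightarrow> t i = \<tau> i (y i)" by metis
      then obtain X where X: "X \<in> Z" "\<And>i. i \<in> D \<Longrightarrow> \<pi> i X = y i" using \<pi>_surj[of y] by blast
      have "\<sigma> X = t"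
        by (rule extensionalityI[of _ D]) (use t X y in \<open>auto simp: \<sigma>_def PiE_def\<close>)
      then have "?s t = 0" using conjunct2[OF \<sigma>[OF X(1)]] by simp
      then show "?s t \<in> NT" using NT(2) by simp
    qed
  next
    case (insert i A)
    have i: "i \<in> D" using insert by simp
    show ?case
    proof (intro ballI impI)
      fix t assume t: "t \<in> B" "\<forall>j\<in>D - insert i A. t j \<in> \<tau> j ` Y j"
      have ti: "t i \<in> carrier (U i)" using t(1) i by auto
      have "?s (t(i := t i)) \<in> NT"
      proof (rule basis_induct[OF i ti])
        fix y assume y: "y \<in> Y i"
        have "t(i := \<tau> i y) \<in> B" by (rule upd_mem[OF t(1) i \<tau>(1)[OF i y]])
        moreover have "\<forall>j\<in>D - A. (t(i := \<tau> i y)) j \<in> \<tau> j ` Y j" using t(2) y by auto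
        ultimately show "?s (t(i := \<tau> i y)) \<in> NT" using insert by blast
      next
        fix u v assume uv: "u \<in> carrier (U i)" "v \<in> carrier (U i)" and s: "?s (t(i := u)) \<in> NT" "?s (t(i := v)) \<in> NT"
        have e: "single (t(i := u \<oplus>\<^bsub>U i\<^esub> v)) 1
           - single (t(i := u)) 1 - single (t(i := v)) 1 \<in> E1 \<union> E2" (is "?e \<in> _")
          using t(1) i uv by blast
        have "\<psi> (t(i := u \<oplus>\<^bsub>U i\<^esub> v)) - \<psi> (t(i := u)) - \<psi> (t(i := v)) = 0"
          using conjunct2[OF relators[OF e]] by (simp add: plin_minus)
        then have "\<psi> (t(i := u \<oplus>\<^bsub>U i\<^esub> v)) = \<psi> (t(i := u)) + \<psi> (t(i := v))"
          by (simp add: diff_diff_eq)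
        then have eq: "?s (t(i := u \<oplus>\<^bsub>U i\<^esub> v)) = ?e + (?s (t(i := u)) + ?s (t(i := v)))"
          by (simp add: plin_add algebra_simps)
        show "?s (t(i := u \<oplus>\<^bsub>U i\<^esub> v)) \<in> NT"
          by (subst eq) (rule NT(3)[OF NT(1)[OF e] NT(3)[OF s]])
      next
        fix a u assume u: "u \<in> carrier (U i)" and s: "?s (t(i := u)) \<in> NT"
        have e: "single (t(i := a \<odot>\<^bsub>U i\<^esub> u)) 1 - single (t(i := u)) a \<in> E1 \<union> E2" (is "?e \<in> _")
          using t(1) i u by blast
        have "\<psi> (t(i := a \<odot>\<^bsub>U i\<^esub> u)) = scale a (\<psi> (t(i := u)))"
          using conjunct2[OF relators[OF e]] by (simp add: plin_minus algebra_simps)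
        then have eq: "?s (t(i := a \<odot>\<^bsub>U i\<^esub> u)) = ?e + scale a (?s (t(i := u)))"
          by (simp add: plin_scale algebra_simps)
        show "?s (t(i := a \<odot>\<^bsub>U i\<^esub> u)) \<in> NT"
          by (subst eq) (rule NT(3)[OF NT(1)[OF e] NT(4)[OF s]])
      next
        interpret Ui: vectorspace class_ring "U i" by (rule gmodule_vectorspace[OF U[OF i]])
        \<comment> \<open>The scalar relator with factor 0 has zero second term, so a pure tensor
          with a zero slot is itself a relator.\<close>
        have e: "single (t(i := 0 \<odot>\<^bsub>U i\<^esub> t i)) 1 - single (t(i := t i)) 0 \<in> E1 \<union> E2"
          using t(1) i ti by blast
        have z: "0 \<odot>\<^bsub>U i\<^esub> t i = \<zero>\<^bsub>U i\<^esub>" using Ui.smult_l_null[OF ti] by simp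
        have e': "single (t(i := \<zero>\<^bsub>U i\<^esub>)) 1 \<in> E1 \<union> E2"
          using e unfolding z single_zero diff_zero .
        show "?s (t(i := \<zero>\<^bsub>U i\<^esub>)) \<in> NT"
          using conjunct2[OF relators[OF e']] NT(1)[OF e'] by simp
      qed
      then show "?s t \<in> NT" by simp
    qed
  qed
  from this[OF finD] show ?thesis using t by simp
qed

private lemma \<psi>_act:
  assumes g: "g \<in> carrier G" and t: "t \<in> B"
  shows "\<psi> (tk g t) = act (monomial_gmodule Z kZ cZ) g (\<psi> t)"
proof (rule poly_mapping_eqI)
  fix X
  have keys: "keys (\<psi> t) \<subseteq> Z" for t by (auto simp: in_keys_iff lookup_\<psi> split: if_splits)
  have inj: "inj_on (kZ g) Z" and im: "kZ g ` Z = Z" using kZ_bij[OF g] by (auto simp: bij_betw_def)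
  show "lookup (\<psi> (tk g t)) X = lookup (act (monomial_gmodule Z kZ cZ) g (\<psi> t)) X"
  proof (cases "X \<in> Z")
    case False
    have "act (monomial_gmodule Z kZ cZ) g (\<psi> t) \<in> carrier (monomial_gmodule Z kZ cZ)"
      by (rule gmodule_act(1)[OF VZ g]) (use keys in \<open>simp add: monomial_gmodule_simps\<close>)
    then have "keys (act (monomial_gmodule Z kZ cZ) g (\<psi> t)) \<subseteq> Z"
      by (simp add: monomial_gmodule_simps(1))
    then have "lookup (act (monomial_gmodule Z kZ cZ) g (\<psi> t)) X = 0"
      using False by (auto simp: in_keys_iff)
    then show ?thesis using False by (simp add: lookup_\<psi>)
  next
    case True
    then obtain X' where X': "X' \<in> Z" "X = kZ g X'" using im by blast
    have "lookup (\<psi> (tk g t)) X = (\<Prod>i\<in>D. lookup (\<theta> i (tk g t i)) (\<pi> i X))"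
      using True by (simp add: lookup_\<psi>)
    also have "\<dots> = (\<Prod>i\<in>D. c i g (\<pi> i X') * lookup (\<theta> i (t i)) (\<pi> i X'))"
    proof (rule prod.cong[OF refl])
      fix i assume i: "i \<in> D"
      have ti: "t i \<in> carrier (U i)" using t i by auto
      have "lookup (\<theta> i (tk g t i)) (\<pi> i X)
        = lookup (act (monomial_gmodule (Y i) (k i) (c i)) g (\<theta> i (t i))) (k i g (\<pi> i X'))"
        using i \<theta>_hom(3)[OF i ti ti g] \<pi>_k[OF i g X'(1)] X'(2) by simp
      also have "\<dots> = c i g (\<pi> i X') * lookup (\<theta> i (t i)) (\<pi> i X')"
        by (rule lookup_monomial_act[where k = "k i", OF k_inj[OF i g] \<theta>_hom(4)[OF i ti ti] \<pi>_mem[OF i X'(1)]])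
      finally show "lookup (\<theta> i (tk g t i)) (\<pi> i X)
        = c i g (\<pi> i X') * lookup (\<theta> i (t i)) (\<pi> i X')" .
    qed
    also have "\<dots> = cZ g X' * lookup (\<psi> t) X'"
      using X'(1) by (simp add: prod.distrib cZ[OF g X'(1)] lookup_\<psi>)
    also have "\<dots> = lookup (act (monomial_gmodule Z kZ cZ) g (\<psi> t)) X"
      unfolding X'(2) by (rule lookup_monomial_act[where k = kZ, OF inj keys X'(1), symmetric])
    finally show ?thesis .
  qed
qed

lemma tensor_gmodule_iso:
  obtains p where "gmodule G (tensor_gmodule D U)"
    and "p \<in> gmodule_hom G (tensor_gmodule D U) (monomial_gmodule Z kZ cZ)"
    and "bij_betw p (carrier (tensor_gmodule D U)) (carrier (monomial_gmodule Z kZ cZ))"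
proof -
  have T: "tensor_gmodule D U = presented_gmodule B tk (E1 \<union> E2)"
    unfolding tensor_gmodule_def ..
  have tkB: "tk g t \<in> B" if "g \<in> carrier G" "t \<in> B" for g t
  proof (rule PiE_I)
    fix i assume i: "i \<in> D"
    have "t i \<in> carrier (U i)" using that(2) i by (rule PiE_mem)
    then show "tk g t i \<in> carrier (U i)" using \<theta>_hom(7)[OF i _ _ that(1)] i by simp
  qed simp
  have keys: "keys (\<psi> t) \<subseteq> Z" if "t \<in> B" for t
    by (auto simp: in_keys_iff lookup_\<psi> split: if_splits)
  note iso = presented_gmodule_iso[OF VZ monomial_gmodule_pm_space tkB keys relators \<psi>_act \<sigma> sec]
  let ?p = "\<lambda>A. the_elem (plin \<psi> ` A)"
  have "gmodule G (tensor_gmodule D U)" unfolding T by (rule iso(1); assumption)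
  moreover have "?p \<in> gmodule_hom G (tensor_gmodule D U) (monomial_gmodule Z kZ cZ)"
    unfolding T by (rule iso(2); assumption)
  moreover have "bij_betw ?p (carrier (tensor_gmodule D U)) (carrier (monomial_gmodule Z kZ cZ))"
    unfolding T by (rule iso(3); assumption)
  ultimately show thesis by (rule that)
qed

end

section \<open>Basic modules in the monomial model\<close>

lemma row_act_inverse:
  fixes g X :: "'l::linorder \<times> 'l \<Rightarrow>\<^sub>0 'r::ring_1"
  assumes g: "g \<in> carrier McLain" and X: "X \<in> rows D"
  shows "row_act D (McLain_inv g) (row_act D g X) = X"
proof -
  have "row_act D (McLain_inv g) (row_act D g X) = row_act D \<one>\<^bsub>McLain\<^esub> X"
    using row_act_mult[of "McLain_inv g" g X D] g X by simp
  then show ?thesis using rows_carrier[OF X] X by (simp add: row_act_def restr_id)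
qed

lemma bij_betw_row_act:
  fixes g :: "'l::linorder \<times> 'l \<Rightarrow>\<^sub>0 'r::ring_1"
  assumes g: "g \<in> carrier McLain"
  shows "bij_betw (row_act D g) (rows D) (rows D)"
proof (rule bij_betw_byWitness[where f' = "row_act D (McLain_inv g)"])
  show "\<forall>X\<in>rows D. row_act D (McLain_inv g) (row_act D g X) = X"
    using row_act_inverse[OF g] by blast
  show "\<forall>X\<in>rows D. row_act D g (row_act D (McLain_inv g) X) = X"
    using row_act_inverse[of "McLain_inv g"] g by simp
qed (use row_act_mem in blast)+

text \<open>First coordinates in D are distinct, so \<open>Theta_set D\<close> is the disjoint union
  of the sets \<open>Theta_set {d}\<close>. A family of truncated rows for D is therefore the same
  as one truncated row for each \<open>d\<close>, and the action and the coefficients split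
  accordingly, since right multiplication treats rows separately.\<close>

lemma basic_module_iso:
  fixes D :: "('l::linorder \<times> 'l) set" and f :: "'l \<times> 'l \<Rightarrow> 'r::ring_1 \<Rightarrow> 'f::field"
  assumes D: "basic_subset D" and f: "\<And>d. d \<in> D \<Longrightarrow> linear_character (f d)"
  obtains p where "gmodule McLain (basic_module D f)"
    and "p \<in> gmodule_hom McLain (basic_module D f) (row_module D f)"
    and "bij_betw p (carrier (basic_module D f)) (carrier (row_module D f))"
proof -
  have fin: "finite D" and inj: "inj_on fst D" and Phi: "D \<subseteq> Phi"
    using D by (auto simp: basic_subset_def)
  define U where "U = (\<lambda>(\<alpha>, \<beta>). elementary_module \<alpha> \<beta> (f (\<alpha>, \<beta>)))"
  have "\<exists>p. gmodule McLain (U d) \<and> p \<in> gmodule_hom McLain (U d) (row_module {d} (\<lambda>_. f d))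
      \<and> bij_betw p (carrier (U d)) (carrier (row_module {d} (\<lambda>_. f d)))" if d: "d \<in> D" for d
  proof -
    obtain \<alpha> \<beta> where ab: "d = (\<alpha>, \<beta>)" by fastforce
    have "\<alpha> < \<beta>" using d Phi by (auto simp: ab Phi_def)
    from elementary_module_iso[OF this f[OF d]]
    show ?thesis unfolding ab U_def by auto
  qed
  then obtain \<theta> where U: "\<And>d. d \<in> D \<Longrightarrow> gmodule McLain (U d)"
    and \<theta>: "\<And>d. d \<in> D \<Longrightarrow> \<theta> d \<in> gmodule_hom McLain (U d) (row_module {d} (\<lambda>_. f d))"
    and bij: "\<And>d. d \<in> D \<Longrightarrow> bij_betw (\<theta> d) (carrier (U d)) (carrier (row_module {d} (\<lambda>_. f d)))"
    by metis
  have Td: "Theta_set {d} \<subseteq> Theta_set D" if "d \<in> D" for d using that by (auto simp: Theta_set_def)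
  have TD: "k \<in> Theta_set D \<Longrightarrow> \<exists>d\<in>D. k \<in> Theta_set {d}" for k
    by (force simp: Theta_set_def)
  have Tdisj: "d = d'" if "d \<in> D" "d' \<in> D" "k \<in> Theta_set {d}" "k \<in> Theta_set {d'}" for d d' k
    using that inj_onD[OF inj, of d d'] by (cases d; cases d') (auto simp: Theta_set_def)
  have V: "gmodule McLain (monomial_gmodule (rows {d}) (row_act {d}) (row_coeff {d} (\<lambda>_. f d)))"
    if "d \<in> D" for d
    using gmodule_row_module[of "{d}" "\<lambda>_. f d"] f[OF that] by (simp add: row_module_def)
  have VZ: "gmodule McLain (monomial_gmodule (rows D) (row_act D) (row_coeff D f))"
    using gmodule_row_module[OF inj f] by (simp add: row_module_def)
  have \<theta>': "\<theta> d \<in> gmodule_hom McLain (U d) (monomial_gmodule (rows {d}) (row_act {d}) (row_coeff {d} (\<lambda>_. f d)))"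
    if "d \<in> D" for d using \<theta>[OF that] by (simp add: row_module_def)
  have bij': "bij_betw (\<theta> d) (carrier (U d)) {x. keys x \<subseteq> rows {d}}" if "d \<in> D" for d
    using bij[OF that] by (simp add: row_module_simps)
  have k_inj: "inj_on (row_act {d} g) (rows {d})"
    if "d \<in> D" "g \<in> carrier (McLain :: ('l \<times> 'l \<Rightarrow>\<^sub>0 'r) monoid)" for d g
    using bij_betw_row_act[OF that(2)] by (rule bij_betw_imp_inj_on)
  have kZ: "bij_betw (row_act D g) (rows D) (rows D)"
    if "g \<in> carrier (McLain :: ('l \<times> 'l \<Rightarrow>\<^sub>0 'r) monoid)" for g
    by (rule bij_betw_row_act[OF that])
  have \<pi>_mem: "restr (Theta_set {d}) X \<in> rows {d}" if "d \<in> D" "X \<in> rows D" for d and X :: "'l \<times> 'l \<Rightarrow>\<^sub>0 'r"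
    by (simp add: keys_restr)
  have \<pi>_inj: "X = X'" if "X \<in> rows D" "X' \<in> rows D"
    and eq: "\<And>d. d \<in> D \<Longrightarrow> restr (Theta_set {d}) X = restr (Theta_set {d}) X'" for X X' :: "'l \<times> 'l \<Rightarrow>\<^sub>0 'r"
  proof (rule poly_mapping_eqI)
    fix k
    show "lookup X k = lookup X' k"
    proof (cases "k \<in> Theta_set D")
      case True
      then obtain d where "d \<in> D" "k \<in> Theta_set {d}" using TD by blast
      then show ?thesis using eq[of d] by (simp add: restr_eq_iff)
    next
      case False
      then have "k \<notin> keys X" "k \<notin> keys X'" using that(1,2) by blast+
      then show ?thesis by (simp add: in_keys_iff)
    qed
  qed
  have \<pi>_surj: "\<exists>X\<in>rows D. \<forall>d\<in>D. restr (Theta_set {d}) X = y d"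
    if y: "\<And>d. d \<in> D \<Longrightarrow> y d \<in> rows {d}" for y :: "'l \<times> 'l \<Rightarrow> 'l \<times> 'l \<Rightarrow>\<^sub>0 'r"
  proof (intro bexI ballI)
    let ?X = "\<Sum>d\<in>D. y d"
    fix d assume d: "d \<in> D"
    show "restr (Theta_set {d}) ?X = y d"
    proof (rule poly_mapping_eqI)
      fix k
      show "lookup (restr (Theta_set {d}) ?X) k = lookup (y d) k"
      proof (cases "k \<in> Theta_set {d}")
        case True
        have "lookup (y e) k = 0" if "e \<in> D" "e \<noteq> d" for e
          using y[OF that(1)] Tdisj[OF that(1) d _ True] that(2) by (auto simp: in_keys_iff)
        then have "lookup ?X k = (\<Sum>e\<in>D. if e = d then lookup (y d) k else 0)"
          unfolding lookup_sum by (intro sum.cong) auto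
        then show ?thesis using True d fin by (simp add: lookup_restr)
      next
        case False
        then show ?thesis using y[OF d] by (auto simp: lookup_restr in_keys_iff)
      qed
    qed
  next
    show "(\<Sum>d\<in>D. y d) \<in> rows D"
    proof (rule CollectI, rule subsetI)
      fix k assume "k \<in> keys (\<Sum>d\<in>D. y d)"
      then obtain d where "d \<in> D" "k \<in> keys (y d)"
        using Poly_Mapping.keys_sum[of y D] by auto
      then show "k \<in> Theta_set D" using y Td by blast
    qed
  qed
  have \<pi>_k: "restr (Theta_set {d}) (row_act D g X) = row_act {d} g (restr (Theta_set {d}) X)"
    if "d \<in> D" "g \<in> carrier McLain" "X \<in> rows D" for d and g X :: "'l \<times> 'l \<Rightarrow>\<^sub>0 'r"
  proof -
    have "restr (Theta_set {d}) (row_act D g X) = restr (Theta_set {d}) (X \<otimes>\<^bsub>McLain\<^esub> McLain_inv g)"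
      unfolding row_act_def restr_eq_iff using Td[OF that(1)] by (auto simp: lookup_restr)
    also have "\<dots> = row_act {d} g (restr (Theta_set {d}) X)"
      unfolding row_act_def by (rule restr_Theta_mult[symmetric]) (use that rows_carrier in auto)
    finally show ?thesis .
  qed
  have cZ: "row_coeff D f g X = (\<Prod>d\<in>D. row_coeff {d} (\<lambda>_. f d) g (restr (Theta_set {d}) X))"
    if "g \<in> carrier McLain" "X \<in> rows D" for g X :: "'l \<times> 'l \<Rightarrow>\<^sub>0 'r"
    unfolding row_coeff_def
  proof (rule prod.cong[OF refl])
    fix d assume d: "d \<in> D"
    have "lookup (X \<otimes>\<^bsub>McLain\<^esub> McLain_inv g) d
      = lookup (restr (Theta_set {d}) X \<otimes>\<^bsub>McLain\<^esub> McLain_inv g) d"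
      using lookup_D_mult[of "{d}" d X "McLain_inv g"] that rows_carrier[OF that(2)]
        lookup_rows_D[OF inj d that(2)] by simp
    then show "f d (- lookup (X \<otimes>\<^bsub>McLain\<^esub> McLain_inv g) d)
      = (\<Prod>e\<in>{d}. f d (- lookup (restr (Theta_set {d}) X \<otimes>\<^bsub>McLain\<^esub> McLain_inv g) e))" by simp
  qed
  show thesis
  proof (rule tensor_gmodule_iso[where G = McLain and D = D and U = U and \<theta> = \<theta> and Y = "\<lambda>d. rows {d}"
        and k = "\<lambda>d. row_act {d}" and c = "\<lambda>d. row_coeff {d} (\<lambda>_. f d)" and Z = "rows D"
        and kZ = "row_act D" and cZ = "row_coeff D f" and \<pi> = "\<lambda>d. restr (Theta_set {d})"])
    fix p
    assume "gmodule McLain (tensor_gmodule D U)"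
      "p \<in> gmodule_hom McLain (tensor_gmodule D U) (monomial_gmodule (rows D) (row_act D) (row_coeff D f))"
      "bij_betw p (carrier (tensor_gmodule D U)) (carrier (monomial_gmodule (rows D) (row_act D) (row_coeff D f)))"
    then show thesis
      using that[of p] by (simp add: basic_module_def U_def row_module_def)
  qed (rule fin U V VZ \<theta>' bij' k_inj kZ \<pi>_mem \<pi>_inj \<pi>_surj \<pi>_k cZ; assumption)+
qed

section \<open>Right primitive characters of finite rings\<close>

lemma right_primitive_linear: "right_primitive \<mu> \<Longrightarrow> linear_character \<mu>"
  by (simp add: right_primitive_def)

lemma group_add_monoid: "Group.group (add_monoid (class_ring :: 'r::ring_1 ring))"
  by (rule abelian_group.a_group[OF ring.is_abelian_group[OF class_ring.ring_axioms]])

lemma right_idealI: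
  fixes A :: "'r::ring_1 set"
  assumes "0 \<in> A" "\<And>a b. a \<in> A \<Longrightarrow> b \<in> A \<Longrightarrow> a + b \<in> A" "\<And>a r. a \<in> A \<Longrightarrow> a * r \<in> A"
  shows "right_ideal A"
proof -
  have G: "Group.group (add_monoid (class_ring :: 'r ring))" by (rule group_add_monoid)
  have "subgroup A (add_monoid (class_ring :: 'r ring))"
  proof (rule group.subgroupI[OF G])
    show "A \<noteq> {}" using assms(1) by blast
  next
    fix a assume a: "a \<in> A"
    have "- a \<in> A" using assms(3)[OF a, of "-1"] by simp
    then show "inv\<^bsub>add_monoid (class_ring :: 'r ring)\<^esub> a \<in> A"
      using group.inv_equality[OF G, of "- a" a] by simp
  qed (use assms in auto)
  then show ?thesis using assms(3) by (auto simp: right_ideal_def additive_subgroup_def)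
qed

lemma right_primitive_eq_0:
  fixes \<mu> :: "'r::ring_1 \<Rightarrow> 'f::field"
  assumes "right_primitive \<mu>" "\<And>r. \<mu> (a * r) = 1"
  shows "a = 0"
proof -
  have "right_ideal (range ((*) a))"
  proof (rule right_idealI)
    show "0 \<in> range ((*) a)" by (rule range_eqI[of _ _ 0]) simp
  next
    fix x y assume "x \<in> range ((*) a)" "y \<in> range ((*) a)"
    then obtain r s where "x = a * r" "y = a * s" by auto
    then show "x + y \<in> range ((*) a)" by (intro range_eqI[of _ _ "r + s"]) (simp add: algebra_simps)
  next
    fix x r assume "x \<in> range ((*) a)"
    then obtain s where "x = a * s" by auto
    then show "x * r \<in> range ((*) a)" by (intro range_eqI[of _ _ "s * r"]) (simp add: algebra_simps)
  qed
  moreover have "range ((*) a) \<subseteq> {r. \<mu> r = 1}" using assms(2) by auto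
  ultimately have "range ((*) a) = {0}" using assms(1) by (auto simp: right_primitive_def)
  then have "a * 1 = 0" by blast
  then show ?thesis by simp
qed

text \<open>
  If \<open>char F\<close> divided \<open>card R\<close>, the elements of \<open>R\<close> killed by \<open>char F\<close> would form a nonzero
  right ideal, on which every linear character is trivial.
\<close>

lemma of_nat_card_neq_0:
  fixes \<mu> :: "'r::ring_1 \<Rightarrow> 'f::field"
  assumes fin: "finite (UNIV :: 'r set)" and \<mu>: "right_primitive \<mu>"
  shows "of_nat (card (UNIV :: 'r set)) \<noteq> (0 :: 'f)"
proof
  let ?p = "CHAR('f)"
  note lin = linear_characterD[OF right_primitive_linear[OF \<mu>]]
  assume "of_nat (card (UNIV :: 'r set)) = (0 :: 'f)"
  then have dvd: "?p dvd card (UNIV :: 'r set)" by (simp add: of_nat_eq_0_iff_char_dvd)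
  have "card (UNIV :: 'r set) \<noteq> 0" using fin by simp
  then have "?p > 0" using dvd by (metis dvd_0_left_iff gr0I)
  then have prime: "prime ?p" by (rule prime_CHAR_semidom)
  let ?G = "add_monoid (class_ring :: 'r ring)"
  obtain m where m: "card (UNIV :: 'r set) = ?p * m" using dvd by (auto elim: dvdE)
  have "\<exists>H. subgroup H ?G \<and> card H = ?p ^ 1"
    by (rule sylow_thm[where m = m, OF prime group_add_monoid]) (use m fin in \<open>simp_all add: Coset.order_def\<close>)
  then obtain H where H: "subgroup H ?G" "card H = ?p" by auto
  have "of_nat ?p * h = 0" if "h \<in> H" for h :: 'r
  proof -
    interpret H: group "?G\<lparr>carrier := H\<rparr>" by (rule subgroup.subgroup_is_group[OF H(1) group_add_monoid])
    have "finite H" using H(2) \<open>?p > 0\<close> by (simp add: card_ge_0_finite)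
    then have "h [^]\<^bsub>?G\<lparr>carrier := H\<rparr>\<^esub> Coset.order (?G\<lparr>carrier := H\<rparr>) = \<one>\<^bsub>?G\<lparr>carrier := H\<rparr>\<^esub>"
      by (intro H.pow_order_eq_1) (use that in auto)
    moreover have "h [^]\<^bsub>?G\<lparr>carrier := H\<rparr>\<^esub> n = of_nat n * h" for n :: nat
      by (induction n) (auto simp: algebra_simps)
    ultimately show ?thesis using H(2) by (simp add: Coset.order_def)
  qed
  define T where "T = {r :: 'r. of_nat ?p * r = 0}"
  have "right_ideal T"
    by (rule right_idealI) (auto simp: T_def distrib_left simp flip: mult.assoc)
  moreover have "T \<subseteq> {r. \<mu> r = 1}"
  proof
    fix r assume "r \<in> T"
    then have "\<mu> (of_nat ?p * r) = 1" using lin(3) by (simp add: T_def)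
    moreover have "\<mu> (of_nat n * r) = \<mu> r ^ n" for n
      using lin(1,3) by (induction n) (auto simp: algebra_simps)
    ultimately have "\<mu> r ^ ?p = 1" by simp
    \<comment> \<open>In characteristic p the only p-th root of unity is 1.\<close>
    moreover have "((\<mu> r - 1) + 1) ^ ?p = (\<mu> r - 1) ^ ?p + 1 ^ ?p"
      by (rule freshmans_dream) (use prime in auto)
    ultimately have "(\<mu> r - 1) ^ ?p = 0" by simp
    then show "r \<in> {r. \<mu> r = 1}" by simp
  qed
  ultimately have "T = {0}" using \<mu> by (auto simp: right_primitive_def)
  then have "H \<subseteq> {0}" using \<open>\<And>h. h \<in> H \<Longrightarrow> of_nat ?p * h = 0\<close> by (auto simp: T_def)
  then have "card H \<le> 1" using card_mono[of "{0 :: 'r}" H] by simp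
  then show False using H(2) prime prime_gt_1_nat[of ?p] by simp
qed

text \<open>For nonzero \<open>a\<close> the right ideal a R is not contained in the kernel of
  \<mu>; shifting the summation variable by a suitable element multiplies the sum by a scalar other
  than 1, so the sum vanishes.\<close>

lemma character_sum_row:
  fixes \<mu> :: "'r::ring_1 \<Rightarrow> 'f::field"
  assumes fin: "finite (UNIV :: 'r set)" and \<mu>: "right_primitive \<mu>"
  shows "(\<Sum>x\<in>UNIV. \<mu> (a * x)) = (if a = 0 then of_nat (card (UNIV :: 'r set)) else 0)"
proof (cases "a = 0")
  case True
  then show ?thesis using linear_characterD(3)[OF right_primitive_linear[OF \<mu>]] by simp
next
  case False
  then obtain r where r: "\<mu> (a * r) \<noteq> 1" using right_primitive_eq_0[OF \<mu>] by blast
  have "(\<Sum>x\<in>UNIV. \<mu> (a * x)) = (\<Sum>x\<in>UNIV. \<mu> (a * (x + r)))"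
    by (rule sum.reindex_bij_witness[of _ "\<lambda>x. x + r" "\<lambda>x. x - r"]) auto
  also have "\<dots> = \<mu> (a * r) * (\<Sum>x\<in>UNIV. \<mu> (a * x))"
    by (simp add: distrib_left linear_characterD(1)[OF right_primitive_linear[OF \<mu>]] sum_distrib_left mult.commute)
  finally have "(1 - \<mu> (a * r)) * (\<Sum>x\<in>UNIV. \<mu> (a * x)) = 0" by (simp add: algebra_simps)
  then show ?thesis using r False by simp
qed

text \<open>
  A right inverse of the square matrix \<open>\<mu> (a x)\<close> is also a left inverse; so \<open>\<mu>\<close> is left primitive.
\<close>

lemma character_sum_column:
  fixes \<mu> :: "'r::ring_1 \<Rightarrow> 'f::field"
  assumes fin: "finite (UNIV :: 'r set)" and \<mu>: "right_primitive \<mu>"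
  shows "(\<Sum>x\<in>UNIV. \<mu> (x * a)) = (if a = 0 then of_nat (card (UNIV :: 'r set)) else 0)"
proof -
  let ?n = "card (UNIV :: 'r set)" and ?N = "of_nat (card (UNIV :: 'r set)) :: 'f"
  note lin = linear_characterD[OF right_primitive_linear[OF \<mu>]]
  have N: "?N \<noteq> 0" by (rule of_nat_card_neq_0[OF fin \<mu>])
  obtain e where e: "bij_betw e {0..<?n} (UNIV :: 'r set)"
    using ex_bij_betw_nat_finite[OF fin] by blast
  define A where "A = Matrix.mat ?n ?n (\<lambda>(i, j). \<mu> (e i * e j))"
  define B where "B = Matrix.mat ?n ?n (\<lambda>(i, j). \<mu> (- (e j * e i)) / ?N)"
  have A: "A \<in> carrier_mat ?n ?n" and B: "B \<in> carrier_mat ?n ?n" by (simp_all add: A_def B_def)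
  have reindex: "(\<Sum>k = 0..<?n. g (e k)) = (\<Sum>x\<in>UNIV. g x)" for g :: "'r \<Rightarrow> 'f"
    using sum.reindex_bij_betw[OF e] by simp
  have "A * B = 1\<^sub>m ?n"
  proof (rule eq_matI)
    fix i j assume "i < dim_row (1\<^sub>m ?n :: 'f mat)" "j < dim_col (1\<^sub>m ?n :: 'f mat)"
    then have ij: "i < ?n" "j < ?n" by auto
    have "(A * B) $$ (i, j) = (\<Sum>k = 0..<?n. \<mu> (e i * e k) * (\<mu> (- (e j * e k)) / ?N))"
      using ij by (simp add: A_def B_def scalar_prod_def)
    also have "\<dots> = (\<Sum>x\<in>UNIV. \<mu> (e i * x) * (\<mu> (- (e j * x)) / ?N))" by (rule reindex)
    also have "\<dots> = (\<Sum>x\<in>UNIV. \<mu> ((e i - e j) * x)) / ?N"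
      by (simp add: sum_divide_distrib left_diff_distrib flip: lin(1))
    also have "\<dots> = (if e i = e j then 1 else 0)"
      using N by (simp add: character_sum_row[OF fin \<mu>])
    also have "\<dots> = 1\<^sub>m ?n $$ (i, j)"
      using ij inj_onD[OF bij_betw_imp_inj_on[OF e], of i j] by auto
    finally show "(A * B) $$ (i, j) = 1\<^sub>m ?n $$ (i, j)" .
  qed (simp_all add: A_def B_def)
  then have BA: "B * A = 1\<^sub>m ?n" by (rule mat_mult_left_right_inverse[OF A B])
  \<comment> \<open>In the row of \<open>B * A\<close> belonging to the ring element 0 the factors
    from \<open>B\<close> are the constant 1/\<open>?N\<close>, so this row consists of the column
    sums divided by \<open>?N\<close>.\<close>
  obtain i j where ij: "i < ?n" "e i = 0" "j < ?n" "e j = a"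
    using bij_betw_imp_surj_on[OF e] by (metis UNIV_I atLeastLessThan_iff imageE)
  have "(B * A) $$ (i, j) = (\<Sum>k = 0..<?n. \<mu> (- (e k * e i)) / ?N * \<mu> (e k * e j))"
    using ij by (simp add: A_def B_def scalar_prod_def)
  also have "\<dots> = (\<Sum>x\<in>UNIV. \<mu> (- (x * e i)) / ?N * \<mu> (x * e j))" by (rule reindex)
  also have "\<dots> = (\<Sum>x\<in>UNIV. \<mu> (x * a)) / ?N"
    using ij lin(3) by (simp add: sum_divide_distrib)
  finally have "(\<Sum>x\<in>UNIV. \<mu> (x * a)) / ?N = 1\<^sub>m ?n $$ (i, j)" using BA by simp
  also have "\<dots> = (if a = 0 then 1 else 0)"
    using ij inj_onD[OF bij_betw_imp_inj_on[OF e], of i j] by auto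
  finally show ?thesis using N by (simp add: field_simps split: if_splits)
qed

section \<open>Semi-invariants of the basic modules\<close>

locale basic_data =
  fixes D :: "('l::linorder \<times> 'l) set" and f :: "'l \<times> 'l \<Rightarrow> 'r::ring_1 \<Rightarrow> 'f::field"
  assumes basic: "basic_subset D"
    and primitive: "\<And>d. d \<in> D \<Longrightarrow> right_primitive (f d)"
    and finite_R: "finite (UNIV :: 'r set)"
begin

abbreviation "M \<equiv> (McLain :: ('l \<times> 'l \<Rightarrow>\<^sub>0 'r) monoid)"
abbreviation "V \<equiv> row_module D f"
abbreviation "\<Theta> \<equiv> Theta_set D"
abbreviation "\<Gamma> \<equiv> Gamma_set D"
abbreviation "\<Omega> \<equiv> Omega_set D"
abbreviation "H \<equiv> (H_group D :: ('l \<times> 'l \<Rightarrow>\<^sub>0 'r) set)"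
abbreviation "I \<equiv> (I_group D :: ('l \<times> 'l \<Rightarrow>\<^sub>0 'r) set)"
abbreviation "\<delta> X \<equiv> single (X :: 'l \<times> 'l \<Rightarrow>\<^sub>0 'r) (1 :: 'f)"
abbreviation "Om \<equiv> {X :: 'l \<times> 'l \<Rightarrow>\<^sub>0 'r. keys X \<subseteq> \<Omega>}"

text \<open>On H this is the character \<lambda> by \<open>basic_character_eq\<close>. The formula
  is also evaluated outside H, where it gives the coefficient in \<open>act_delta_0\<close> but need
  not be multiplicative.\<close>

definition lam :: "('l \<times> 'l \<Rightarrow>\<^sub>0 'r) \<Rightarrow> 'f" where
  "lam h = (\<Prod>d\<in>D. f d (lookup h d))"

definition semi_invariants :: "(('l \<times> 'l \<Rightarrow>\<^sub>0 'r) \<Rightarrow>\<^sub>0 'f) set" where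
  "semi_invariants = {v \<in> carrier V. \<forall>h\<in>H. act V h v = scale (lam h) v}"

lemma D_facts: "finite D" "D \<noteq> {}" "D \<subseteq> Phi" "inj_on fst D" "inj_on snd D"
  using basic by (auto simp: basic_subset_def)

lemma linear: "d \<in> D \<Longrightarrow> linear_character (f d)"
  by (rule right_primitive_linear[OF primitive])

lemma D_fst: "\<lbrakk>(a, b) \<in> D; (a, b') \<in> D\<rbrakk> \<Longrightarrow> b = b'"
  by (rule inj_on_fst_eq[OF D_facts(4)])

lemma D_snd: "\<lbrakk>(a, b) \<in> D; (a', b) \<in> D\<rbrakk> \<Longrightarrow> a = a'"
  using inj_onD[OF D_facts(5), of "(a, b)" "(a', b)"] by simp

lemma Theta_iff: "(a, b) \<in> D \<Longrightarrow> (a, c) \<in> \<Theta> \<longleftrightarrow> a < c \<and> c < b"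
  by (rule Theta_row[OF D_facts(4)])

lemma D_not_Theta: "d \<in> D \<Longrightarrow> d \<notin> \<Theta>"
  using Theta_iff[of "fst d" "snd d" "snd d"] by simp

lemma Gamma_iff: "p \<in> \<Gamma> \<longleftrightarrow> p \<in> Phi \<and> p \<notin> \<Theta>"
  by (simp add: Gamma_set_eq)

lemma V_gmodule: "gmodule M V"
  by (rule gmodule_row_module[OF D_facts(4) linear])

lemma V_simps: "carrier V = {x. keys x \<subseteq> rows D}" "\<zero>\<^bsub>V\<^esub> = 0" "add V = (+)" "smult V = scale"
  by (rule row_module_simps)+

lemma act_single: "act V m (single X c) = single (row_act D m X) (c * row_coeff D f m X)"
  by (rule act_row_module_single)

lemma act_V: "\<lbrakk>m \<in> carrier M; v \<in> carrier V\<rbrakk> \<Longrightarrow> act V m v \<in> carrier V"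
  by (rule gmodule_act(1)[OF V_gmodule])

lemma act_lin: "act V m (v + w) = act V m v + act V m w" "act V m (scale c v) = scale c (act V m v)"
  "act V m 0 = 0" "act V m (\<Sum>a\<in>A. x a) = (\<Sum>a\<in>A. act V m (x a))" "act V m (v - w) = act V m v - act V m w"
  by (simp_all add: row_module_simps(5) plin_add plin_scale plin_sum plin_minus)

lemma act_mult: "\<lbrakk>m \<in> carrier M; n \<in> carrier M; v \<in> carrier V\<rbrakk> \<Longrightarrow> act V (m \<otimes>\<^bsub>M\<^esub> n) v = act V m (act V n v)"
  by (rule gmodule.act_mult[OF V_gmodule])

lemma act_one: "v \<in> carrier V \<Longrightarrow> act V \<one>\<^bsub>M\<^esub> v = v"
  by (rule gmodule.act_one[OF V_gmodule])

lemma act_inv: "\<lbrakk>m \<in> carrier M; v \<in> carrier V\<rbrakk> \<Longrightarrow> act V (McLain_inv m) (act V m v) = v"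
  using act_mult[of "McLain_inv m" m v] act_one by simp

lemma delta_V: "X \<in> rows D \<Longrightarrow> single X c \<in> carrier V"
  by (simp add: V_simps)

lemma zero_rows: "0 \<in> rows D"
  by simp

lemma row_coeff_nonzero: "row_coeff D f m X \<noteq> 0"
  unfolding row_coeff_def using D_facts(1) linear_characterD(2)[OF linear] by simp

lemma act_delta_0:
  assumes m: "m \<in> carrier M"
  shows "act V m (\<delta> 0) = single (restr \<Theta> (McLain_inv m)) (lam (- McLain_inv m))"
proof -
  have "0 \<otimes>\<^bsub>McLain\<^esub> McLain_inv m = McLain_inv m"
    using McLain.l_one[of "McLain_inv m"] m by (simp add: McLain_simps(3))
  then show ?thesis by (simp add: act_single row_act_def row_coeff_def lam_def del: single_one)
qed

lemma act_inv_delta_0: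
  assumes "X \<in> rows D"
  shows "act V (McLain_inv X) (\<delta> 0) = \<delta> X"
proof -
  have "lam (- X) = 1"
    unfolding lam_def using lookup_rows_D[OF D_facts(4) _ assms] linear_characterD(3)[OF linear] by simp
  then show ?thesis
    using act_delta_0[of "McLain_inv X"] rows_carrier[OF assms] assms by (simp add: restr_id)
qed

lemma H_eq: "h \<in> H \<longleftrightarrow> keys h \<subseteq> \<Gamma>"
  by (simp add: H_group_eq)

lemma I_eq: "h \<in> I \<longleftrightarrow> keys h \<subseteq> \<Gamma> \<union> \<Omega>"
  by (simp add: I_group_eq[OF D_facts(4)])

lemma H_subgroup: "subgroup H M"
  unfolding H_group_eq by (rule subgroup_McLain_keys[OF trans_Gamma Gamma_subset_Phi])

lemma Gamma_Omega_Phi: "\<Gamma> \<union> \<Omega> \<subseteq> Phi"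
  using Gamma_subset_Phi Omega_subset_Theta Theta_subset_Phi by blast

lemma I_subgroup: "subgroup I M"
  unfolding I_group_eq[OF D_facts(4)]
  by (rule subgroup_McLain_keys[OF trans_Gamma_Omega[OF D_facts(4)] Gamma_Omega_Phi])

lemma H_I: "H \<subseteq> I" and H_M: "H \<subseteq> carrier M" and I_M: "I \<subseteq> carrier M"
  using subgroup.subset[OF H_subgroup] subgroup.subset[OF I_subgroup] H_eq I_eq by auto

lemma Om_rows: "Om \<subseteq> rows D" and Om_I: "Om \<subseteq> I" and Om_M: "Om \<subseteq> carrier M"
  using Omega_subset_Theta[of D] I_eq I_M by auto

lemma lookup_inv_H:
  assumes h: "h \<in> H" and d: "d \<in> D"
  shows "lookup (McLain_inv h) d = - lookup h d"
proof -
  have hM: "h \<in> carrier M" using h H_M by auto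
  have iM: "keys (McLain_inv h) \<subseteq> Phi"
    using McLain.inv_closed[OF hM] by (simp add: McLain_simps(1))
  obtain a b where ab: "d = (a, b)" by fastforce
  have "(a, b) \<notin> keys (J_mult h (McLain_inv h))"
  proof
    assume "(a, b) \<in> keys (J_mult h (McLain_inv h))"
    then obtain c where c: "(a, c) \<in> keys h" "(c, b) \<in> keys (McLain_inv h)"
      by (rule keys_J_mult)
    then have "(a, c) \<in> \<Gamma>" using h H_eq by auto
    moreover have "c < b" using c(2) iM by (auto simp: Phi_def)
    ultimately show False using Theta_iff[of a b c] d by (auto simp: ab Gamma_iff Phi_def)
  qed
  then have "lookup (h \<otimes>\<^bsub>M\<^esub> McLain_inv h) d = lookup h d + lookup (McLain_inv h) d"
    by (simp add: ab McLain_simps lookup_add in_keys_iff)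
  then have "lookup (McLain_inv h) d + lookup h d = 0"
    using hM by (simp add: McLain_simps(3) add.commute)
  then show ?thesis by (simp add: add_eq_0_iff2)
qed

lemma inv_H: "h \<in> H \<Longrightarrow> McLain_inv h \<in> H"
  by (rule subgroup.m_inv_closed[OF H_subgroup])

text \<open>Suppose h\<inverse> contributed to X h\<inverse> in row a at a column b up to the end e
  of that row. The factor from X sits at some (a, c) \<in> \<Omega>, so row c ends after e, hence
  after b, and (c, b) lies in \<Theta>; but h\<inverse> has no entries there. So h neither moves the
  index nor picks up X in its coefficient.\<close>

lemma act_H_Om:
  assumes h: "h \<in> H" and X: "X \<in> Om"
  shows "act V h (single X c) = single X (lam h * c)"
proof -
  let ?n = "McLain_inv h"
  have n: "keys ?n \<subseteq> \<Gamma>" using inv_H[OF h] H_eq by blast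
  have Xr: "X \<in> rows D" using X Om_rows by blast
  have J: "lookup (J_mult X ?n) (a, b) = 0" if ae: "(a, e) \<in> D" "b \<le> e" for a b e
  proof -
    have "(a, b) \<notin> keys (J_mult X ?n)"
    proof
      assume "(a, b) \<in> keys (J_mult X ?n)"
      then obtain c where c: "(a, c) \<in> keys X" "(c, b) \<in> keys ?n"
        by (rule keys_J_mult)
      then have "(a, c) \<in> \<Omega>" using X by auto
      then obtain e' g where "(a, e') \<in> D" "(c, g) \<in> D" "e' < g" by (auto simp: Omega_set_def)
      moreover have "e' = e" using D_fst[OF ae(1) \<open>(a, e') \<in> D\<close>] by simp
      moreover have "(c, b) \<in> \<Gamma>" using c n by auto
      ultimately show False using Theta_iff[of c g b] ae(2) by (auto simp: Gamma_iff Phi_def)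
    qed
    then show ?thesis by (simp add: in_keys_iff)
  qed
  have "row_act D h X = X"
  proof (rule poly_mapping_eqI)
    fix k :: "'l \<times> 'l"
    obtain a b where k: "k = (a, b)" by fastforce
    show "lookup (row_act D h X) k = lookup X k"
    proof (cases "k \<in> \<Theta>")
      case True
      then obtain e where "(a, e) \<in> D" "b < e" by (auto simp: k Theta_set_def)
      then have "lookup (J_mult X ?n) k = 0" using J[of a e b] by (simp add: k)
      moreover have "lookup ?n k = 0" using n True Gamma_iff[of k] by (auto simp: in_keys_iff)
      ultimately show ?thesis using True by (simp add: row_act_def lookup_restr McLain_simps lookup_add)
    next
      case False
      then have "k \<notin> keys X" using Xr by blast
      then show ?thesis using False by (simp add: row_act_def lookup_restr in_keys_iff)
    qed
  qed
  moreover have "row_coeff D f h X = lam h"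
    unfolding row_coeff_def lam_def
  proof (rule prod.cong[OF refl])
    fix d assume d: "d \<in> D"
    obtain a b where ab: "d = (a, b)" by fastforce
    have "lookup (J_mult X ?n) d = 0" using J[of a b b] d by (simp add: ab)
    then show "f d (- lookup (X \<otimes>\<^bsub>McLain\<^esub> ?n) d) = f d (lookup h d)"
      using lookup_inv_H[OF h d] lookup_rows_D[OF D_facts(4) d Xr] by (simp add: McLain_simps lookup_add)
  qed
  ultimately show ?thesis by (simp add: act_single mult.commute)
qed

lemma basic_character_eq:
  assumes h: "h \<in> H"
  shows "basic_character D f h = lam h"
proof -
  have "extended_character (Gamma_set {d}) d (f d) h = f d (lookup h d)" if d: "d \<in> D" for d
  proof (rule extended_character_eq)
    show "trans (Gamma_set {d})" "Gamma_set {d} \<subseteq> Phi" by (rule trans_Gamma Gamma_subset_Phi)+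
    show "d \<in> Gamma_set {d}"
      using d D_facts(3) by (cases d) (auto simp: Gamma_set_eq Theta_set_def)
    show "linear_character (f d)" by (rule linear[OF d])
    have "Gamma_set D \<subseteq> Gamma_set {d}" using d by (auto simp: Gamma_set_eq Theta_set_def)
    then show "h \<in> McLain_sub (Gamma_set {d})"
      using h H_eq by (simp add: McLain_sub_eq[OF trans_Gamma Gamma_subset_Phi])
    fix c assume "(fst d, c) \<in> Gamma_set {d}" "(c, snd d) \<in> Gamma_set {d}"
    then show False by (cases d) (auto simp: Gamma_set_eq Theta_set_def Phi_def)
  qed
  then show ?thesis using h by (simp add: basic_character_def lam_def)
qed

lemma lookup_act:
  assumes "m \<in> carrier M" "v \<in> carrier V" "X \<in> rows D"
  shows "lookup (act V m v) (row_act D m X) = row_coeff D f m X * lookup v X"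
  unfolding row_module_def
  by (rule lookup_monomial_act) (use assms bij_betw_row_act[OF assms(1), of D] in \<open>auto simp: V_simps bij_betw_def\<close>)

text \<open>
  A basis vector outside \<open>Om\<close> has a nonzero entry \<open>X\<^bsub>a c\<^esub>\<close>, \<open>(a, c) \<notin> \<Omega>\<close>. Among the rows with a
  nonzero entry in column \<open>c\<close> take the one with maximal \<open>b\<close>, \<open>(a, b) \<in> D\<close>: then \<open>1 + r e\<^bsub>c b\<^esub>\<close>
  lies in \<open>H\<close> and in the kernel of \<open>\<lambda>\<close>, but multiplies \<open>\<delta> X\<close> by \<open>f (a, b) (X\<^bsub>a c\<^esub> r)\<close>.
\<close>

lemma non_Omega_root:
  assumes X: "X \<in> rows D" and nOm: "X \<notin> Om"
  obtains a b c where "(a, b) \<in> D" "(a, c) \<in> keys X"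
    "\<And>r. single (c, b) r \<in> H" "\<And>r. lam (single (c, b) r) = 1"
    "\<And>r. row_act D (single (c, b) r) X = X"
    "\<And>r. row_coeff D f (single (c, b) r) X = f (a, b) (lookup X (a, c) * r)"
proof -
  obtain a0 c where ac0: "(a0, c) \<in> keys X" "(a0, c) \<notin> \<Omega>" using nOm by auto
  let ?K = "{b. \<exists>a. (a, c) \<in> keys X \<and> (a, b) \<in> D}"
  have finK: "finite ?K" by (rule finite_subset[of _ "snd ` D"]) (use D_facts(1) in force)+
  have row: "\<exists>b. (a, b) \<in> D \<and> a < c' \<and> c' < b" if "(a, c') \<in> keys X" for a c'
  proof -
    have "(a, c') \<in> \<Theta>" using that X by blast
    then show ?thesis by (auto simp: Theta_set_def)
  qed
  obtain b0 where b0: "(a0, b0) \<in> D" "a0 < c" "c < b0" using row[OF ac0(1)] by blast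
  have "?K \<noteq> {}" using b0 ac0 by blast
  define b where "b = Max ?K"
  have "b \<in> ?K" unfolding b_def by (rule Max_in[OF finK \<open>?K \<noteq> {}\<close>])
  then obtain a where a: "(a, c) \<in> keys X" "(a, b) \<in> D" by blast
  have max: "b' \<le> b" if "(a', c) \<in> keys X" "(a', b') \<in> D" for a' b'
    unfolding b_def by (rule Max_ge[OF finK]) (use that in blast)
  have lt: "a < c" "c < b"
    using row[OF a(1)] D_fst[OF a(2)] by auto
  \<comment> \<open>Otherwise row c ends after b, and by maximality of b also after the row end b0
    of a0, which would make (a0, c) a root of \<Omega>.\<close>
  have p: "(c, b) \<in> \<Gamma>"
  proof (rule ccontr)
    assume "(c, b) \<notin> \<Gamma>"
    then obtain e where e: "(c, e) \<in> D" "b < e" using lt by (auto simp: Gamma_iff Phi_def Theta_set_def)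
    have "b0 < e" using max[OF ac0(1) b0(1)] e(2) by simp
    then have "(a0, c) \<in> \<Omega>" using b0 e by (intro Omega_setI[of a0 b0 D c e])
    then show False using ac0(2) by simp
  qed
  have pD: "(c, b) \<notin> D" using D_snd[OF a(2)] lt by auto
  have pPhi: "(c, b) \<in> Phi" using lt by (simp add: Phi_def)
  have inv: "McLain_inv (single (c, b) r) = single (c, b) (- r)" for r :: 'r
    using McLain.inv_equality[of "single (c, b) (- r)" "single (c, b) r"]
      McLain_single_mult[OF pPhi, of "- r" r] pPhi by (simp add: McLain_simps(1,3))
  have J: "lookup (J_mult X (single (c, b) s)) (a', b')
      = (if b' = b then lookup X (a', c) * s else 0)" for a' b' s
  proof -
    let ?A = "insert c (snd ` keys X)"
    have "lookup (J_mult X (single (c, b) s)) (a', b')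
      = (\<Sum>e\<in>?A. lookup X (a', e) * lookup (single (c, b) s) (e, b'))"
      by (rule lookup_J_mult) force+
    also have "\<dots> = (\<Sum>e\<in>?A. if e = c then (if b' = b then lookup X (a', c) * s else 0) else 0)"
      by (rule sum.cong) (auto simp: lookup_single when_def)
    also have "\<dots> = (if b' = b then lookup X (a', c) * s else 0)"
      by (subst sum.delta) auto
    finally show ?thesis .
  qed
  show thesis
  proof (rule that[OF a(2,1)])
    fix r
    show "single (c, b) r \<in> H" using p by (simp add: H_eq)
    have "f d (lookup (single (c, b) r) d) = 1" if d: "d \<in> D" for d
    proof -
      have "d \<noteq> (c, b)" using d pD by blast
      then show ?thesis using linear_characterD(3)[OF linear[OF d]] by (simp add: lookup_single when_def)
    qed
    then show "lam (single (c, b) r) = 1" by (simp add: lam_def)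
    show "row_act D (single (c, b) r) X = X"
    proof (rule poly_mapping_eqI)
      fix k :: "'l \<times> 'l"
      obtain a' b' where k: "k = (a', b')" by fastforce
      show "lookup (row_act D (single (c, b) r) X) k = lookup X k"
      proof (cases "k \<in> \<Theta>")
        case True
        then obtain e where e: "(a', e) \<in> D" "b' < e" by (auto simp: k Theta_set_def)
        \<comment> \<open>A row with an entry in column c ends at e \<le> b by the choice of b, so
          its truncation has no entry in column b that could change.\<close>
        have "lookup X (a', c) = 0" if "b' = b"
        proof (rule ccontr)
          assume "lookup X (a', c) \<noteq> 0"
          then have "e \<le> b" using max[of a' e] e(1) by (simp add: in_keys_iff)
          then show False using e(2) that by simp
        qed
        moreover have "k \<noteq> (c, b)" using True p Gamma_iff by blast
        then have "lookup (single (c, b) (- r)) k = 0"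
          by (simp add: lookup_single when_def)
        ultimately show ?thesis using True
          by (simp add: row_act_def inv lookup_restr McLain_simps lookup_add k J)
      next
        case False
        then have "k \<notin> keys X" using X by blast
        then show ?thesis using False by (simp add: row_act_def lookup_restr in_keys_iff)
      qed
    qed
    have "f d (- lookup (X \<otimes>\<^bsub>McLain\<^esub> single (c, b) (- r)) d)
      = (if d = (a, b) then f (a, b) (lookup X (a, c) * r) else 1)" if d: "d \<in> D" for d
    proof -
      obtain a' b' where ab: "d = (a', b')" by fastforce
      have "d \<noteq> (c, b)" using d pD by blast
      then have 0: "lookup (single (c, b) (- r)) d = 0"
        by (simp add: lookup_single when_def)
      have "lookup (X \<otimes>\<^bsub>McLain\<^esub> single (c, b) (- r)) d
        = (if b' = b then - (lookup X (a', c) * r) else 0)"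
        using lookup_rows_D[OF D_facts(4) d X] 0 by (simp add: McLain_simps lookup_add ab J)
      moreover have "a' = a" if "b' = b" using D_snd[OF a(2), of a'] d that by (simp add: ab)
      ultimately show ?thesis using linear_characterD(3)[OF linear[OF d]] by (auto simp: ab)
    qed
    then show "row_coeff D f (single (c, b) r) X = f (a, b) (lookup X (a, c) * r)"
      unfolding row_coeff_def inv using D_facts(1) a(2) by (simp add: prod.delta)
  qed
qed

lemma non_Omega_coeff_0:
  assumes v: "v \<in> carrier V" and X: "X \<in> rows D" "X \<notin> Om"
    and inv: "\<And>c b r. \<lbrakk>c \<in> snd ` keys X; b \<in> snd ` D; single (c, b) r \<in> H\<rbrakk>
      \<Longrightarrow> act V (single (c, b) r) v = scale (lam (single (c, b) r)) v"
  shows "lookup v X = 0"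
proof (rule ccontr)
  assume nz: "lookup v X \<noteq> 0"
  obtain a b c where ab: "(a, b) \<in> D" "(a, c) \<in> keys X"
    and r: "\<And>r. single (c, b) r \<in> H" "\<And>r. lam (single (c, b) r) = 1"
    "\<And>r. row_act D (single (c, b) r) X = X"
    "\<And>r. row_coeff D f (single (c, b) r) X = f (a, b) (lookup X (a, c) * r)"
    by (rule non_Omega_root[OF X]) blast
  have "f (a, b) (lookup X (a, c) * r) = 1" for r
  proof -
    let ?h = "single (c, b) r"
    have "act V ?h v = v" using inv[OF _ _ r(1)] ab r(2) by (force simp: image_iff)
    moreover have "lookup (act V ?h v) X = f (a, b) (lookup X (a, c) * r) * lookup v X"
      using lookup_act[OF _ v X(1), of ?h] r H_M by (metis subset_eq)
    ultimately show ?thesis using nz by simp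
  qed
  then have "lookup X (a, c) = 0" by (rule right_primitive_eq_0[OF primitive[OF ab(1)]])
  then show False using ab(2) by (simp add: in_keys_iff)
qed

lemma semi_invariants_eq: "semi_invariants = {v. keys v \<subseteq> Om}"
proof (intro equalityI subsetI)
  fix v assume v: "v \<in> semi_invariants"
  then have vV: "v \<in> carrier V" and inv: "\<And>h. h \<in> H \<Longrightarrow> act V h v = scale (lam h) v"
    by (auto simp: semi_invariants_def)
  have "X \<in> Om" if X: "X \<in> keys v" for X
  proof (rule ccontr)
    assume "X \<notin> Om"
    moreover have "X \<in> rows D" using X vV by (auto simp: V_simps)
    ultimately have "lookup v X = 0" using non_Omega_coeff_0[OF vV _ _ inv] by blast
    then show False using X by (simp add: in_keys_iff)
  qed
  then show "v \<in> {v. keys v \<subseteq> Om}" by blast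
next
  fix v :: "('l \<times> 'l \<Rightarrow>\<^sub>0 'r) \<Rightarrow>\<^sub>0 'f" assume v: "v \<in> {v. keys v \<subseteq> Om}"
  have "act V h v = scale (lam h) v" if h: "h \<in> H" for h
  proof -
    have v1: "v = (\<Sum>X\<in>keys v. single X (lookup v X))"
      using plin_single_id[of v] by (simp add: plin_def)
    have "act V h v = (\<Sum>X\<in>keys v. act V h (single X (lookup v X)))"
      by (subst v1) (rule act_lin(4))
    also have "\<dots> = (\<Sum>X\<in>keys v. single X (lam h * lookup v X))"
      by (rule sum.cong[OF refl], rule act_H_Om[OF h]) (use v in blast)
    also have "\<dots> = scale (lam h) v"
      by (subst (3) v1) (simp add: scale_sum)
    finally show ?thesis .
  qed
  moreover have "v \<in> carrier V" using v Om_rows unfolding V_simps by blast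
  ultimately show "v \<in> semi_invariants" by (auto simp: semi_invariants_def)
qed

end

section \<open>Finitely supported functions over a finite ring\<close>

lemma restr_linear:
  "restr S (x + y) = restr S x + restr S (y :: 'b \<Rightarrow>\<^sub>0 'r::comm_monoid_add)"
  "restr S 0 = (0 :: 'b \<Rightarrow>\<^sub>0 'r)"
  "restr S (\<Sum>a\<in>A. z a) = (\<Sum>a\<in>A. restr S (z a :: 'b \<Rightarrow>\<^sub>0 'r))"
proof -
  show add: "restr S (x + y) = restr S x + restr S y" for x y :: "'b \<Rightarrow>\<^sub>0 'r"
    by (auto intro!: poly_mapping_eqI simp: lookup_restr lookup_add)
  show zero: "restr S 0 = (0 :: 'b \<Rightarrow>\<^sub>0 'r)"
    by (auto intro!: poly_mapping_eqI simp: lookup_restr)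
  show "restr S (\<Sum>a\<in>A. z a) = (\<Sum>a\<in>A. restr S (z a))"
    by (induction A rule: infinite_finite_induct) (auto simp: add zero)
qed

lemma restr_scale: "restr S (scale c x) = scale c (restr S x)"
  by (auto intro!: poly_mapping_eqI simp: lookup_restr)

lemma pm_expand: "(\<Sum>X\<in>keys v. single X (lookup v X)) = (v :: 'b \<Rightarrow>\<^sub>0 'f::field)"
  using plin_single_id[of v] by (simp add: plin_def)

lemma bij_betw_supported_PiE:
  assumes S: "finite S"
  shows "bij_betw (\<lambda>x. \<lambda>k\<in>S. lookup x k) {x :: 'b \<Rightarrow>\<^sub>0 'r::zero. keys x \<subseteq> S}
      (\<Pi>\<^sub>E k\<in>S. (UNIV :: 'r set))"
proof (rule bij_betw_byWitness[where f' = "\<lambda>g. Abs_poly_mapping (\<lambda>k. if k \<in> S then g k else 0)"])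
  have l: "lookup (Abs_poly_mapping (\<lambda>k. if k \<in> S then g k else 0)) k = (if k \<in> S then g k else 0)"
    for g :: "'b \<Rightarrow> 'r" and k
    by (subst Abs_poly_mapping_inverse) (auto intro: finite_subset[OF _ S])
  show "\<forall>x\<in>{x :: 'b \<Rightarrow>\<^sub>0 'r. keys x \<subseteq> S}.
      Abs_poly_mapping (\<lambda>k. if k \<in> S then (\<lambda>k\<in>S. lookup x k) k else 0) = x"
    by (intro ballI poly_mapping_eqI) (auto simp: l in_keys_iff)
  show "\<forall>g\<in>\<Pi>\<^sub>E k\<in>S. (UNIV :: 'r set).
      (\<lambda>k\<in>S. lookup (Abs_poly_mapping (\<lambda>k. if k \<in> S then g k else 0)) k) = g"
    by (auto simp: l PiE_def extensional_def restrict_def)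
  show "(\<lambda>g. Abs_poly_mapping (\<lambda>k. if k \<in> S then g k else 0)) ` (\<Pi>\<^sub>E k\<in>S. (UNIV :: 'r set))
      \<subseteq> {x. keys x \<subseteq> S}"
    by (auto simp: l in_keys_iff split: if_splits)
qed auto

lemma card_poly_mapping_supported:
  assumes S: "finite S" and R: "finite (UNIV :: 'r::zero set)"
  shows "finite {x :: 'b \<Rightarrow>\<^sub>0 'r. keys x \<subseteq> S}"
    and "card {x :: 'b \<Rightarrow>\<^sub>0 'r. keys x \<subseteq> S} = card (UNIV :: 'r set) ^ card S"
proof -
  note bij = bij_betw_supported_PiE[OF S, where ?'r = 'r]
  have fin: "finite (\<Pi>\<^sub>E k\<in>S. (UNIV :: 'r set))" by (rule finite_PiE[OF S]) (rule R)
  show "finite {x :: 'b \<Rightarrow>\<^sub>0 'r. keys x \<subseteq> S}" using bij_betw_finite[OF bij] fin by blast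
  show "card {x :: 'b \<Rightarrow>\<^sub>0 'r. keys x \<subseteq> S} = card (UNIV :: 'r set) ^ card S"
    using bij_betw_same_card[OF bij] card_PiE[OF S, of "\<lambda>_. UNIV :: 'r set"] by simp
qed

text \<open>Distributivity; it factors character sums over the elements supported in \<Omega> into
  character sums over R.\<close>

lemma sum_supported_prod:
  fixes g :: "'b \<Rightarrow> 'r::zero \<Rightarrow> 'f::comm_semiring_1"
  assumes S: "finite S" and R: "finite (UNIV :: 'r set)"
  shows "(\<Sum>x | keys x \<subseteq> S. \<Prod>k\<in>S. g k (lookup x k)) = (\<Prod>k\<in>S. \<Sum>r\<in>UNIV. g k r)"
proof -
  have "(\<Prod>k\<in>S. \<Sum>r\<in>UNIV. g k r) = (\<Sum>h\<in>(\<Pi>\<^sub>E k\<in>S. UNIV). \<Prod>k\<in>S. g k (h k))"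
    by (rule prod_sum_PiE) (use S R in auto)
  also have "\<dots> = (\<Sum>x | keys x \<subseteq> S. \<Prod>k\<in>S. g k ((\<lambda>k\<in>S. lookup x k) k))"
    by (rule sum.reindex_bij_betw[OF bij_betw_supported_PiE[OF S], symmetric])
  finally show ?thesis by simp
qed

context basic_data
begin

section \<open>Submodules of the model and averaging\<close>

lemma gsub_iff: "gsubmodule M V U \<longleftrightarrow> U \<subseteq> carrier V \<and> 0 \<in> U \<and> (\<forall>u\<in>U. \<forall>v\<in>U. u + v \<in> U)
    \<and> (\<forall>c. \<forall>u\<in>U. scale c u \<in> U) \<and> (\<forall>g\<in>carrier M. \<forall>u\<in>U. act V g u \<in> U)"
  unfolding gsubmodule_iff[OF V_gmodule] V_simps ..

lemma gsubD:
  assumes "gsubmodule M V U"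
  shows "u \<in> U \<Longrightarrow> u \<in> carrier V" "0 \<in> U" "\<lbrakk>u \<in> U; v \<in> U\<rbrakk> \<Longrightarrow> u + v \<in> U" "u \<in> U \<Longrightarrow> scale c u \<in> U"
    "\<lbrakk>g \<in> carrier M; u \<in> U\<rbrakk> \<Longrightarrow> act V g u \<in> U"
  using assms unfolding gsub_iff by auto

lemma gsub_sum:
  assumes "gsubmodule M V U" "\<And>a. a \<in> A \<Longrightarrow> x a \<in> U"
  shows "(\<Sum>a\<in>A. x a) \<in> U"
  using assms(2) by (induction A rule: infinite_finite_induct) (auto intro: gsubD(2,3)[OF assms(1)])

lemma semi_V: "v \<in> semi_invariants \<Longrightarrow> v \<in> carrier V"
  by (simp add: semi_invariants_def)

lemma card_R_nonzero: "(of_nat (card (UNIV :: 'r set)) :: 'f) \<noteq> 0"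
proof -
  obtain d where "d \<in> D" using D_facts(2) by blast
  then show ?thesis by (rule of_nat_card_neq_0[OF finite_R primitive])
qed

text \<open>H acts on \<delta> 0 by the scalar \<open>lam\<close>, so multiplicativity is inherited
  from the action.\<close>

lemma lam_mult:
  assumes "g \<in> H" "h \<in> H"
  shows "lam (g \<otimes>\<^bsub>M\<^esub> h) = lam g * lam h" "lam (McLain_inv g) * lam g = 1" "lam g \<noteq> 0"
proof -
  have z: "\<delta> 0 \<in> carrier V" by (rule delta_V[OF zero_rows])
  have one: "act V g (\<delta> 0) = single 0 (lam g)" if "g \<in> H" for g
    using act_H_Om[OF that, of 0 1] by (simp del: single_one)
  have gM: "g \<in> carrier M" "h \<in> carrier M" using assms H_M by auto
  have "act V (g \<otimes>\<^bsub>M\<^esub> h) (\<delta> 0) = act V g (act V h (\<delta> 0))" by (rule act_mult[OF gM z])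
  also have "\<dots> = single 0 (lam g * lam h)"
    unfolding one[OF assms(2)] using act_H_Om[OF assms(1), of 0 "lam h"] by simp
  finally have "single (0 :: 'l \<times> 'l \<Rightarrow>\<^sub>0 'r) (lam (g \<otimes>\<^bsub>M\<^esub> h)) = single 0 (lam g * lam h)"
    unfolding one[OF subgroup.m_closed[OF H_subgroup assms]] .
  then show "lam (g \<otimes>\<^bsub>M\<^esub> h) = lam g * lam h" by (metis lookup_single_eq)
  have "act V (McLain_inv g) (act V g (\<delta> 0)) = \<delta> 0" by (rule act_inv[OF gM(1) z])
  then have "single (0 :: 'l \<times> 'l \<Rightarrow>\<^sub>0 'r) (lam (McLain_inv g) * lam g) = \<delta> 0"
    unfolding one[OF assms(1)] using act_H_Om[OF inv_H[OF assms(1)], of 0 "lam g"] by simp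
  then show "lam (McLain_inv g) * lam g = 1" by (metis lookup_single_eq)
  then show "lam g \<noteq> 0" by auto
qed

text \<open>
  A submodule contains a vector with nonzero coefficient at \<open>\<delta> 0\<close>. Averaging over the finite
  subgroup of \<open>H\<close> on a finite set of indices makes it semi-invariant under that subgroup, and
  this suffices since only indices occurring in the vector and in \<open>D\<close> matter.
\<close>

lemma submodule_semi_invariant:
  assumes U: "gsubmodule M V U" and nz: "U \<noteq> {0}"
  shows "\<exists>u\<in>U \<inter> semi_invariants. u \<noteq> 0"
proof -
  obtain u0 where u0: "u0 \<in> U" "u0 \<noteq> 0" using nz gsubD(2)[OF U] by blast
  then obtain X where X: "X \<in> keys u0" by (metis keys_eq_empty ex_in_conv)
  have Xr: "X \<in> rows D" using X gsubD(1)[OF U u0(1)] by (auto simp: V_simps)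
  have XM: "X \<in> carrier M" by (rule rows_carrier[OF Xr])
  \<comment> \<open>X moves its own index to the zero row, because X X\<inverse> is the identity. So
    the nonzero coefficient of \<open>u0\<close> at X becomes a nonzero coefficient of
    \<open>u\<close> at 0.\<close>
  define u where "u = act V X u0"
  have u: "u \<in> U" unfolding u_def by (rule gsubD(5)[OF U XM u0(1)])
  have uV: "u \<in> carrier V" by (rule gsubD(1)[OF U u])
  have "row_act D X X = 0" using XM by (simp add: row_act_def McLain_simps(3) restr_id)
  then have "lookup u 0 = row_coeff D f X X * lookup u0 X"
    unfolding u_def using lookup_act[OF XM gsubD(1)[OF U u0(1)] Xr] by simp
  then have u_0: "lookup u 0 \<noteq> 0" using X row_coeff_nonzero by (simp add: in_keys_iff)
  \<comment> \<open>All indices occurring in \<open>u\<close> or in D. The roots of \<Gamma> between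
    them form a finite closed set, hence a finite subgroup of H that contains every generator
    required by \<open>non_Omega_coeff_0\<close>.\<close>
  define \<Lambda> where "\<Lambda> = (\<Union>p\<in>(\<Union>X\<in>keys u. keys X) \<union> D. {fst p, snd p})"
  have fin\<Lambda>: "finite \<Lambda>" using D_facts(1) by (auto simp: \<Lambda>_def)
  define \<Delta> where "\<Delta> = \<Gamma> \<inter> \<Lambda> \<times> \<Lambda>"
  have \<Delta>: "trans \<Delta>" "\<Delta> \<subseteq> Phi" "finite \<Delta>"
    using trans_Gamma[of D] Gamma_subset_Phi[of D] fin\<Lambda> by (auto simp: \<Delta>_def trans_def)
  define K where "K = {h :: 'l \<times> 'l \<Rightarrow>\<^sub>0 'r. keys h \<subseteq> \<Delta>}"
  have K: "finite K" "card K = card (UNIV :: 'r set) ^ card \<Delta>"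
    unfolding K_def by (rule card_poly_mapping_supported[OF \<Delta>(3) finite_R])+
  have sub: "subgroup K M" unfolding K_def by (rule subgroup_McLain_keys[OF \<Delta>(1,2)])
  have KH: "K \<subseteq> H" by (auto simp: K_def H_eq \<Delta>_def)
  have KM: "K \<subseteq> carrier M" using KH H_M by blast
  \<comment> \<open>The projection to the vectors on which K acts by \<lambda>, without dividing by
    the order of K. The coefficient at 0 is thus multiplied by \<open>card K\<close>, a power of the
    order of R and so nonzero in F.\<close>
  define w where "w = (\<Sum>h\<in>K. scale (lam (McLain_inv h)) (act V h u))"
  have hU: "scale c (act V h u) \<in> U" if "h \<in> K" for c h
    using that KM by (intro gsubD(4,5)[OF U] u) auto
  have w: "w \<in> U" unfolding w_def by (rule gsub_sum[OF U hU])
  have wV: "w \<in> carrier V" by (rule gsubD(1)[OF U w])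
  have w0: "lookup w 0 = of_nat (card K) * lookup u 0"
  proof -
    have "lam (McLain_inv h) * lookup (act V h u) 0 = lookup u 0" if h: "h \<in> K" for h
    proof -
      have "act V h (\<delta> 0) = single 0 (lam h)"
        using act_H_Om[of h 0 1] h KH by (auto simp del: single_one)
      then have "single (row_act D h 0) (row_coeff D f h 0) = single 0 (lam h)"
        using act_single[of h 0 1] by (simp del: single_one)
      then have "row_act D h 0 = 0" "row_coeff D f h 0 = lam h"
        using lam_mult(3)[of h h] h KH by (metis keys_single singleton_inject subsetD lookup_single_eq row_coeff_nonzero)+
      then have "lookup (act V h u) 0 = lam h * lookup u 0"
        using lookup_act[of h u 0] h KM uV by auto
      then show ?thesis using lam_mult(2)[of h h] h KH by (auto simp flip: mult.assoc)
    qed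
    then show ?thesis by (simp add: w_def lookup_sum)
  qed
  have "(of_nat (card K) :: 'f) \<noteq> 0" using K(2) card_R_nonzero by simp
  then have nz: "w \<noteq> 0" using w0 u_0 by auto
  have act_w: "act V g w = scale (lam g) w" if g: "g \<in> K" for g
  proof -
    have gH: "g \<in> H" "g \<in> carrier M" using g KH KM by auto
    have "act V g w = (\<Sum>h\<in>K. scale (lam (McLain_inv h)) (act V (g \<otimes>\<^bsub>M\<^esub> h) u))"
      unfolding w_def act_lin(4) act_lin(2)
      by (rule sum.cong[OF refl]) (use act_mult[OF gH(2) _ uV] KM in \<open>auto simp: subset_iff\<close>)
    also have "\<dots> = (\<Sum>h\<in>K. scale (lam (McLain_inv (McLain_inv g \<otimes>\<^bsub>M\<^esub> h))) (act V h u))"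
    proof (rule sum.reindex_bij_witness[of _ "\<lambda>h. McLain_inv g \<otimes>\<^bsub>M\<^esub> h" "\<lambda>h. g \<otimes>\<^bsub>M\<^esub> h"])
      fix h assume h: "h \<in> K"
      then have hM: "h \<in> carrier M" using KM by blast
      show "McLain_inv g \<otimes>\<^bsub>M\<^esub> (g \<otimes>\<^bsub>M\<^esub> h) = h" "g \<otimes>\<^bsub>M\<^esub> (McLain_inv g \<otimes>\<^bsub>M\<^esub> h) = h"
        using gH(2) hM by (simp_all flip: McLain.m_assoc)
      then show "scale (lam (McLain_inv (McLain_inv g \<otimes>\<^bsub>M\<^esub> (g \<otimes>\<^bsub>M\<^esub> h)))) (act V (g \<otimes>\<^bsub>M\<^esub> h) u)
        = scale (lam (McLain_inv h)) (act V (g \<otimes>\<^bsub>M\<^esub> h) u)" by simp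
      show "g \<otimes>\<^bsub>M\<^esub> h \<in> K" "McLain_inv g \<otimes>\<^bsub>M\<^esub> h \<in> K"
        using subgroup.m_closed[OF sub] subgroup.m_inv_closed[OF sub] g h by auto
    qed
    also have "\<dots> = (\<Sum>h\<in>K. scale (lam g) (scale (lam (McLain_inv h)) (act V h u)))"
    proof (rule sum.cong[OF refl])
      fix h assume h: "h \<in> K"
      have hH: "h \<in> H" "h \<in> carrier M" using h KH KM by auto
      have "McLain_inv (McLain_inv g \<otimes>\<^bsub>M\<^esub> h) = McLain_inv h \<otimes>\<^bsub>M\<^esub> g"
        using gH(2) hH(2) by (simp add: McLain.inv_mult_group)
      then show "scale (lam (McLain_inv (McLain_inv g \<otimes>\<^bsub>M\<^esub> h))) (act V h u)
        = scale (lam g) (scale (lam (McLain_inv h)) (act V h u))"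
        using lam_mult(1)[OF inv_H[OF hH(1)] gH(1)] by (simp add: mult.commute)
    qed
    finally show ?thesis by (simp add: w_def scale_sum)
  qed
  \<comment> \<open>Averaging brings in no new indices, as K and \<open>u\<close> both live on
    \<Lambda>; so the generators tested against \<open>w\<close> below still belong to K.\<close>
  have keys_w: "keys X \<subseteq> \<Lambda> \<times> \<Lambda>" if X: "X \<in> keys w" for X
  proof -
    obtain h where h: "h \<in> K" and "X \<in> keys (scale (lam (McLain_inv h)) (act V h u))"
      using X Poly_Mapping.keys_sum[of "\<lambda>h. scale (lam (McLain_inv h)) (act V h u)" K] unfolding w_def by auto
    then have Xh: "X \<in> keys (act V h u)" by (auto dest: subsetD[OF keys_scale])
    have "keys (act V h u) \<subseteq> row_act D h ` keys u"
      unfolding row_module_simps(5) by (rule keys_plin) auto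
    then obtain Y where Y: "Y \<in> keys u" "X = row_act D h Y" using Xh by blast
    have T: "trans (Phi \<inter> \<Lambda> \<times> \<Lambda>)" using trans_Phi by (auto simp: trans_def)
    have "Y \<in> rows D" using Y uV by (auto simp: V_simps)
    then have "keys Y \<subseteq> Phi" using rows_carrier by (auto simp: McLain_simps(1))
    moreover have "keys Y \<subseteq> \<Lambda> \<times> \<Lambda>" using Y(1) by (force simp: \<Lambda>_def)
    ultimately have 1: "keys Y \<subseteq> Phi \<inter> \<Lambda> \<times> \<Lambda>" by blast
    have "McLain_inv h \<in> K" by (rule subgroup.m_inv_closed[OF sub h])
    then have 2: "keys (McLain_inv h) \<subseteq> Phi \<inter> \<Lambda> \<times> \<Lambda>"
      using \<Delta>(2) by (auto simp: K_def \<Delta>_def)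
    show ?thesis using McLain_keys_mult[OF T 1 2] by (auto simp: Y(2) row_act_def keys_restr)
  qed
  have "keys w \<subseteq> Om"
  proof
    fix X assume X: "X \<in> keys w"
    show "X \<in> Om"
    proof (rule ccontr)
      assume nOm: "X \<notin> Om"
      have Xr: "X \<in> rows D" using X wV by (auto simp: V_simps)
      have "lookup w X = 0"
      proof (rule non_Omega_coeff_0[OF wV Xr nOm])
        fix c b and r :: 'r
        assume c: "c \<in> snd ` keys X" and b: "b \<in> snd ` D" and h: "single (c, b) r \<in> H"
        have "c \<in> \<Lambda>" using keys_w[OF X] c by auto
        moreover have "b \<in> \<Lambda>" unfolding \<Lambda>_def using b by auto
        ultimately have "single (c, b) r \<in> K" using h by (auto simp: K_def \<Delta>_def H_eq split: if_splits)
        then show "act V (single (c, b) r) w = scale (lam (single (c, b) r)) w"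
          by (rule act_w)
      qed
      then show False using X by (simp add: in_keys_iff)
    qed
  qed
  then show ?thesis using w nz unfolding semi_invariants_eq by blast
qed

section \<open>Endomorphisms and Frobenius reciprocity\<close>

lemma hom_V_iff: "\<phi> \<in> gmodule_hom M V V \<longleftrightarrow> (\<forall>x\<in>carrier V. \<phi> x \<in> carrier V)
    \<and> (\<forall>x\<in>carrier V. \<forall>y\<in>carrier V. \<phi> (x + y) = \<phi> x + \<phi> y)
    \<and> (\<forall>c. \<forall>x\<in>carrier V. \<phi> (scale c x) = scale c (\<phi> x))
    \<and> (\<forall>g\<in>carrier M. \<forall>x\<in>carrier V. \<phi> (act V g x) = act V g (\<phi> x))"
  unfolding gmodule_hom_iff V_simps ..

lemma hom_VD:
  assumes "\<phi> \<in> gmodule_hom M V V" "x \<in> carrier V"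
  shows "\<phi> x \<in> carrier V" "y \<in> carrier V \<Longrightarrow> \<phi> (x + y) = \<phi> x + \<phi> y" "\<phi> (scale c x) = scale c (\<phi> x)"
    "g \<in> carrier M \<Longrightarrow> \<phi> (act V g x) = act V g (\<phi> x)"
  using assms unfolding hom_V_iff by auto

lemma hom_V_zero: "\<phi> \<in> gmodule_hom M V V \<Longrightarrow> \<phi> 0 = 0"
  using gmodule_hom_zero[OF V_gmodule V_gmodule, of \<phi>] by (simp add: V_simps)

lemma V_sum: "(\<And>a. a \<in> A \<Longrightarrow> x a \<in> carrier V) \<Longrightarrow> (\<Sum>a\<in>A. x a) \<in> carrier V"
  unfolding V_simps mem_Collect_eq by (rule keys_sum_subset)

lemma hom_V_sum:
  assumes \<phi>: "\<phi> \<in> gmodule_hom M V V" and x: "\<And>a. a \<in> A \<Longrightarrow> x a \<in> carrier V"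
  shows "\<phi> (\<Sum>a\<in>A. x a) = (\<Sum>a\<in>A. \<phi> (x a))"
  using x
  by (induction A rule: infinite_finite_induct) (simp_all add: hom_V_zero[OF \<phi>] hom_VD(2)[OF \<phi>] V_sum)

lemma V_expand:
  assumes "v \<in> carrier V"
  shows "(\<Sum>X\<in>keys v. scale (lookup v X) (act V (McLain_inv X) (\<delta> 0))) = v"
proof -
  have "(\<Sum>X\<in>keys v. scale (lookup v X) (act V (McLain_inv X) (\<delta> 0)))
    = (\<Sum>X\<in>keys v. single X (lookup v X))"
    by (rule sum.cong[OF refl], subst act_inv_delta_0) (use assms in \<open>auto simp: V_simps\<close>)
  then show ?thesis by (simp only: pm_expand)
qed

lemma hom_V_formula:
  assumes \<phi>: "\<phi> \<in> gmodule_hom M V V" and v: "v \<in> carrier V"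
  shows "\<phi> v = (\<Sum>X\<in>keys v. scale (lookup v X) (act V (McLain_inv X) (\<phi> (\<delta> 0))))"
proof -
  have XM: "McLain_inv X \<in> carrier M" if "X \<in> keys v" for X
    using that v rows_carrier[of X D] by (auto simp: V_simps)
  have 1: "act V (McLain_inv X) (\<delta> 0) \<in> carrier V" if "X \<in> keys v" for X
    by (rule act_V[OF XM[OF that] delta_V[OF zero_rows]])
  have 2: "scale c (act V (McLain_inv X) (\<delta> 0)) \<in> carrier V" if "X \<in> keys v" for X c
    using 1[OF that] by (simp add: V_simps keys_subset(1))
  have "\<phi> v = (\<Sum>X\<in>keys v. \<phi> (scale (lookup v X) (act V (McLain_inv X) (\<delta> 0))))"
    using hom_V_sum[OF \<phi> 2, of "keys v" "\<lambda>X. X" "lookup v"] V_expand[OF v] by simp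
  also have "\<dots> = (\<Sum>X\<in>keys v. scale (lookup v X) (act V (McLain_inv X) (\<phi> (\<delta> 0))))"
    by (rule sum.cong[OF refl]) (use hom_VD(3)[OF \<phi> 1] hom_VD(4)[OF \<phi> delta_V[OF zero_rows] XM] in \<open>simp del: single_one\<close>)
  finally show ?thesis .
qed

lemma hom_V_ext:
  assumes "\<phi> \<in> gmodule_hom M V V" "\<phi>' \<in> gmodule_hom M V V" "\<phi> (\<delta> 0) = \<phi>' (\<delta> 0)" "v \<in> carrier V"
  shows "\<phi> v = \<phi>' v"
  using hom_V_formula[OF assms(1,4)] hom_V_formula[OF assms(2,4)] assms(3) by simp

lemma hom_V_semi:
  assumes \<phi>: "\<phi> \<in> gmodule_hom M V V" and v: "v \<in> semi_invariants"
  shows "\<phi> v \<in> semi_invariants"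
proof -
  have vV: "v \<in> carrier V" by (rule semi_V[OF v])
  have "act V h (\<phi> v) = scale (lam h) (\<phi> v)" if h: "h \<in> H" for h
  proof -
    have "act V h (\<phi> v) = \<phi> (act V h v)" using hom_VD(4)[OF \<phi> vV, of h] h H_M by auto
    also have "\<dots> = scale (lam h) (\<phi> v)"
      using v h hom_VD(3)[OF \<phi> vV] by (simp add: semi_invariants_def)
    finally show ?thesis .
  qed
  then show ?thesis using hom_VD(1)[OF \<phi> vV] by (simp add: semi_invariants_def)
qed

lemma delta_0_semi: "\<delta> 0 \<in> semi_invariants"
  unfolding semi_invariants_eq by simp

text \<open>Frobenius reciprocity. As \<delta> X = X\<inverse> \<delta> 0, the image of \<delta> X
  has to be X\<inverse> v. If m moves the index X to Y, then m X\<inverse> = Y\<inverse> h with h in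
  H, and h acts on v by the same scalar as on \<delta> 0, namely \<open>row_coeff D f m X\<close>;
  this gives equivariance.\<close>

lemma hom_V_exists:
  assumes v: "v \<in> semi_invariants"
  obtains \<phi> where "\<phi> \<in> gmodule_hom M V V" "\<phi> (\<delta> 0) = v"
proof
  define \<phi> where "\<phi> = plin (\<lambda>X. act V (McLain_inv X) v)"
  have vV: "v \<in> carrier V" by (rule semi_V[OF v])
  have actX: "act V (McLain_inv X) v \<in> carrier V" if "X \<in> rows D" for X
    using act_V[OF _ vV] rows_carrier[OF that] by simp
  have "McLain_inv (0 :: 'l \<times> 'l \<Rightarrow>\<^sub>0 'r) = 0" using McLain.inv_one unfolding McLain_simps(3) .
  then show "\<phi> (\<delta> 0) = v"
    using act_one[OF vV] by (simp add: \<phi>_def McLain_simps(3) del: single_one)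
  have basis: "scale (row_coeff D f m X) (act V (McLain_inv (row_act D m X)) v) = act V m (act V (McLain_inv X) v)"
    if m: "m \<in> carrier M" and X: "X \<in> rows D" for m X
  proof -
    let ?Y = "row_act D m X" and ?c = "row_coeff D f m X"
    have Y: "?Y \<in> rows D" by (rule row_act_mem)
    have c: "X \<in> carrier M" "?Y \<in> carrier M" "McLain_inv X \<in> carrier M" "McLain_inv ?Y \<in> carrier M"
      using rows_carrier[OF X] rows_carrier[OF Y] by auto
    define h where "h = ?Y \<otimes>\<^bsub>M\<^esub> (m \<otimes>\<^bsub>M\<^esub> McLain_inv X)"
    have hM: "h \<in> carrier M" unfolding h_def using c m by simp
    have z: "\<delta> 0 \<in> carrier V" by (rule delta_V[OF zero_rows])
    have "act V h (\<delta> 0) = act V ?Y (act V m (act V (McLain_inv X) (\<delta> 0)))"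
      unfolding h_def using c m z act_V by (simp add: act_mult del: single_one)
    also have "\<dots> = act V ?Y (scale ?c (act V (McLain_inv ?Y) (\<delta> 0)))"
      unfolding act_inv_delta_0[OF X] act_inv_delta_0[OF Y] by (simp add: act_single)
    also have "\<dots> = scale ?c (\<delta> 0)"
      unfolding act_lin(2) using act_inv[OF c(4) z] c by simp
    finally have h0: "single (restr \<Theta> (McLain_inv h)) (lam (- McLain_inv h)) = single 0 ?c"
      unfolding act_delta_0[OF hM] by (simp del: single_one)
    then have "restr \<Theta> (McLain_inv h) = 0"
      using row_coeff_nonzero by (metis keys_single singleton_inject empty_not_insert)
    then have "keys (McLain_inv h) \<inter> \<Theta> = {}" by (metis keys_restr keys_zero)
    moreover have "keys (McLain_inv h) \<subseteq> Phi"
      using McLain.inv_closed[OF hM] by (simp add: McLain_simps(1))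
    ultimately have "McLain_inv h \<in> H" unfolding H_eq Gamma_set_eq by (rule subset_Diff_disjoint)
    then have hH: "h \<in> H" using inv_H[of "McLain_inv h"] hM by simp
    have "lam h = ?c"
    proof -
      have "act V h (\<delta> 0) = single 0 (lam h)"
        using act_H_Om[OF hH, of 0 1] by (simp del: single_one)
      then show ?thesis using h0 unfolding act_delta_0[OF hM] by (metis lookup_single_eq)
    qed
    then have vh: "act V h v = scale ?c v" using v hH by (simp add: semi_invariants_def)
    have "m \<otimes>\<^bsub>M\<^esub> McLain_inv X = McLain_inv ?Y \<otimes>\<^bsub>M\<^esub> h"
      unfolding h_def using c m by (simp flip: McLain.m_assoc)
    then have "act V m (act V (McLain_inv X) v) = act V (McLain_inv ?Y) (act V h v)"
      using act_mult[OF m c(3) vV] act_mult[OF c(4) hM vV] by simp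
    then show ?thesis unfolding vh act_lin(2) by simp
  qed
  show "\<phi> \<in> gmodule_hom M V V"
    unfolding hom_V_iff
  proof (intro conjI ballI allI)
    fix x assume x: "x \<in> carrier V"
    show "\<phi> x \<in> carrier V" unfolding V_simps mem_Collect_eq \<phi>_def
      by (rule keys_plin) (use actX x in \<open>auto simp: V_simps\<close>)
    fix g assume g: "g \<in> carrier M"
    have "\<phi> (act V g x) = plin (\<lambda>X. act V g (act V (McLain_inv X) v)) x"
      unfolding \<phi>_def row_module_simps(5)[of D f g] plin_plin
      by (rule plin_cong) (use basis[OF g] x in \<open>auto simp: V_simps row_module_simps(5)\<close>)
    also have "\<dots> = act V g (\<phi> x)"
      unfolding \<phi>_def plin_def act_lin(4) act_lin(2) ..
    finally show "\<phi> (act V g x) = act V g (\<phi> x)" .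
  qed (simp_all add: \<phi>_def plin_add plin_scale)
qed

end

section \<open>Splitting fields\<close>

lemma (in vectorspace) lincomb_singleton:
  assumes "a \<in> {e} \<rightarrow> carrier K" "e \<in> carrier V"
  shows "lincomb a {e} = a e \<odot>\<^bsub>V\<^esub> e"
  using assms by (simp add: lincomb_def)

text \<open>Replaces the dimension by an explicit description of the carrier. It is used in both
  directions: for the line required by \<open>lies_over\<close> and for the endomorphism space given
  by the splitting hypothesis.\<close>

lemma edim_eq_1_iff:
  fixes E :: "('f::field, 'v, 'y) module_scheme"
  assumes E: "vectorspace class_ring E" and e: "e \<in> carrier E" "e \<noteq> \<zero>\<^bsub>E\<^esub>"
  shows "edim E = 1 \<longleftrightarrow> carrier E = range (\<lambda>c. c \<odot>\<^bsub>E\<^esub> e)"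
proof -
  interpret E: vectorspace class_ring E by (rule E)
  have span: "E.span {e} = range (\<lambda>c. c \<odot>\<^bsub>E\<^esub> e)"
  proof -
    have "E.span {e} = {E.lincomb a {e} | a. a \<in> {e} \<rightarrow> carrier (class_ring :: 'f ring)}"
      by (rule E.finite_span) (use e in auto)
    also have "\<dots> = range (\<lambda>c. c \<odot>\<^bsub>E\<^esub> e)"
    proof (intro equalityI subsetI)
      fix x assume "x \<in> range (\<lambda>c. c \<odot>\<^bsub>E\<^esub> e)"
      then obtain c where c: "x = c \<odot>\<^bsub>E\<^esub> e" by auto
      have "x = E.lincomb (\<lambda>_. c) {e}" using E.lincomb_singleton[of "\<lambda>_. c" e] e c by simp
      then show "x \<in> {E.lincomb a {e} | a. a \<in> {e} \<rightarrow> carrier (class_ring :: 'f ring)}" by auto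
    qed (use E.lincomb_singleton[of _ e] e in auto)
    finally show ?thesis .
  qed
  have li: "E.lin_indpt {e}"
  proof (rule E.finite_lin_indpt2)
    fix a :: "'v \<Rightarrow> 'f" assume a: "a \<in> {e} \<rightarrow> carrier class_ring" and "E.lincomb a {e} = \<zero>\<^bsub>E\<^esub>"
    then have 0: "a e \<odot>\<^bsub>E\<^esub> e = \<zero>\<^bsub>E\<^esub>" using E.lincomb_singleton[of a e] e by simp
    have "a e = 0"
    proof (rule ccontr)
      assume nz: "a e \<noteq> 0"
      have "e = (inverse (a e) * a e) \<odot>\<^bsub>E\<^esub> e" using nz e E.smult_one[of e] by simp
      also have "\<dots> = inverse (a e) \<odot>\<^bsub>E\<^esub> (a e \<odot>\<^bsub>E\<^esub> e)" using E.smult_assoc1[of "inverse (a e)" "a e" e] e by simp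
      also have "\<dots> = \<zero>\<^bsub>E\<^esub>" unfolding 0 using E.smult_r_null[of "inverse (a e)"] by simp
      finally show False using e by simp
    qed
    then show "\<forall>v\<in>{e}. a v = \<zero>\<^bsub>class_ring\<^esub>" by simp
  qed (use e in auto)
  show ?thesis
  proof
    assume "edim E = 1"
    then have dim: "E.fin_dim" "E.dim = 1"
      by (auto simp: edim_def one_enat_def split: if_splits)
    have "E.basis {e}" by (rule E.dim_li_is_basis) (use dim e li in auto)
    then show "carrier E = range (\<lambda>c. c \<odot>\<^bsub>E\<^esub> e)" using span by (simp add: E.basis_def)
  next
    assume c: "carrier E = range (\<lambda>c. c \<odot>\<^bsub>E\<^esub> e)"
    have "E.basis {e}" unfolding E.basis_def using li span c e by simp
    then have "E.dim = 1" using E.dim_basis[of "{e}"] by simp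
    moreover have "E.fin_dim" unfolding E.fin_dim_def using span c e by (intro exI[of _ "{e}"]) simp
    ultimately show "edim E = 1" by (simp add: edim_def one_enat_def)
  qed
qed

lemma hom_space_vectorspace:
  fixes X :: "('f::field, 'v, 'g, 'y) gmodule_scheme"
  assumes X: "gmodule G X"
  shows "vectorspace class_ring (hom_space G X X)"
proof -
  interpret X: vectorspace class_ring X by (rule gmodule_vectorspace[OF X])
  let ?Z = "\<lambda>x\<in>carrier X. \<zero>\<^bsub>X\<^esub>"
  have mem: "p \<in> carrier (hom_space G X X) \<longleftrightarrow> p \<in> extensional (carrier X)
    \<and> (\<forall>x\<in>carrier X. p x \<in> carrier X)
    \<and> (\<forall>x\<in>carrier X. \<forall>y\<in>carrier X. p (x \<oplus>\<^bsub>X\<^esub> y) = p x \<oplus>\<^bsub>X\<^esub> p y)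
    \<and> (\<forall>c. \<forall>x\<in>carrier X. p (c \<odot>\<^bsub>X\<^esub> x) = c \<odot>\<^bsub>X\<^esub> p x)
    \<and> (\<forall>g\<in>carrier G. \<forall>x\<in>carrier X. p (act X g x) = act X g (p x))" for p
    by (auto simp: hom_space_def gmodule_hom_iff)
  have smult_closed: "c \<odot>\<^bsub>X\<^esub> x \<in> carrier X" if "x \<in> carrier X" for c x
    using X.smult_closed[of c x] that by simp
  note smult = X.smult_l_distr[simplified] X.smult_r_distr[simplified] X.smult_assoc1[simplified]
  have comm: "c \<odot>\<^bsub>X\<^esub> (d \<odot>\<^bsub>X\<^esub> x) = d \<odot>\<^bsub>X\<^esub> (c \<odot>\<^bsub>X\<^esub> x)" if "x \<in> carrier X" for c d x
    using that by (simp flip: smult(3) add: mult.commute)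
  have ops: "p \<oplus>\<^bsub>hom_space G X X\<^esub> q = (\<lambda>x\<in>carrier X. p x \<oplus>\<^bsub>X\<^esub> q x)"
    "c \<odot>\<^bsub>hom_space G X X\<^esub> p = (\<lambda>x\<in>carrier X. c \<odot>\<^bsub>X\<^esub> p x)" "\<zero>\<^bsub>hom_space G X X\<^esub> = ?Z" for p q c
    by (simp_all add: hom_space_def)
  have ext: "p = q" if "p \<in> extensional (carrier X)" "q \<in> extensional (carrier X)"
    "\<And>x. x \<in> carrier X \<Longrightarrow> p x = q x" for p q :: "'v \<Rightarrow> 'v"
    by (rule extensionalityI[OF that])
  have act0: "act X g \<zero>\<^bsub>X\<^esub> = \<zero>\<^bsub>X\<^esub>" if "g \<in> carrier G" for g
    using gmodule_act(3)[OF X that X.zero_closed, of 0] gmodule_act(1)[OF X that X.zero_closed]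
      X.smult_l_null by simp
  show ?thesis
  proof (rule vs_criteria)
    show "field (class_ring :: 'f ring)" by unfold_locales
    show "\<zero>\<^bsub>hom_space G X X\<^esub> \<in> carrier (hom_space G X X)"
      unfolding ops mem using gmodule_act(1)[OF X] act0 smult_closed X.smult_r_null by simp
    show "\<forall>v w. v \<in> carrier (hom_space G X X) \<and> w \<in> carrier (hom_space G X X)
        \<longrightarrow> v \<oplus>\<^bsub>hom_space G X X\<^esub> w \<in> carrier (hom_space G X X)"
      unfolding ops mem using gmodule_act[OF X] smult_closed smult
      by (auto simp: X.a_ac)
    show clos: "\<forall>c v. c \<in> carrier (class_ring :: 'f ring) \<and> v \<in> carrier (hom_space G X X)
        \<longrightarrow> c \<odot>\<^bsub>hom_space G X X\<^esub> v \<in> carrier (hom_space G X X)"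
      unfolding ops mem using gmodule_act[OF X] smult_closed smult(2) comm by auto
    show "\<forall>v\<in>carrier (hom_space G X X). \<exists>w\<in>carrier (hom_space G X X).
        v \<oplus>\<^bsub>hom_space G X X\<^esub> w = \<zero>\<^bsub>hom_space G X X\<^esub>"
    proof
      fix v assume v: "v \<in> carrier (hom_space G X X)"
      have "v x \<oplus>\<^bsub>X\<^esub> (-1) \<odot>\<^bsub>X\<^esub> v x = \<zero>\<^bsub>X\<^esub>" if "x \<in> carrier X" for x
      proof -
        have vx: "v x \<in> carrier X" using v that unfolding mem by blast
        have "v x \<oplus>\<^bsub>X\<^esub> (-1) \<odot>\<^bsub>X\<^esub> v x = (1 + (-1)) \<odot>\<^bsub>X\<^esub> v x"
          using smult(1)[of "v x" 1 "-1"] vx X.smult_one[of "v x"] by simp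
        then show ?thesis using X.smult_l_null[OF vx] by simp
      qed
      then have "v \<oplus>\<^bsub>hom_space G X X\<^esub> ((-1) \<odot>\<^bsub>hom_space G X X\<^esub> v) = \<zero>\<^bsub>hom_space G X X\<^esub>"
        unfolding ops by (intro restrict_ext) simp
      moreover have "(-1) \<odot>\<^bsub>hom_space G X X\<^esub> v \<in> carrier (hom_space G X X)" using clos v by simp
      ultimately show "\<exists>w\<in>carrier (hom_space G X X). v \<oplus>\<^bsub>hom_space G X X\<^esub> w = \<zero>\<^bsub>hom_space G X X\<^esub>" by blast
    qed
    show "\<forall>v w. v \<in> carrier (hom_space G X X) \<and> w \<in> carrier (hom_space G X X)
        \<longrightarrow> v \<oplus>\<^bsub>hom_space G X X\<^esub> w = w \<oplus>\<^bsub>hom_space G X X\<^esub> v"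
      unfolding ops mem by (auto intro!: restrict_ext simp: X.a_comm)
    show "\<forall>v w x. v \<in> carrier (hom_space G X X) \<and> w \<in> carrier (hom_space G X X) \<and> x \<in> carrier (hom_space G X X)
        \<longrightarrow> v \<oplus>\<^bsub>hom_space G X X\<^esub> w \<oplus>\<^bsub>hom_space G X X\<^esub> x = v \<oplus>\<^bsub>hom_space G X X\<^esub> (w \<oplus>\<^bsub>hom_space G X X\<^esub> x)"
      unfolding ops mem by (auto intro!: restrict_ext simp: X.a_assoc)
    show "\<forall>v\<in>carrier (hom_space G X X). v \<oplus>\<^bsub>hom_space G X X\<^esub> \<zero>\<^bsub>hom_space G X X\<^esub> = v"
      unfolding ops Ball_def mem by (auto intro!: ext)
    show "\<forall>a b v. a \<in> carrier (class_ring :: 'f ring) \<and> b \<in> carrier class_ring \<and> v \<in> carrier (hom_space G X X)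
        \<longrightarrow> (a \<otimes>\<^bsub>class_ring\<^esub> b) \<odot>\<^bsub>hom_space G X X\<^esub> v = a \<odot>\<^bsub>hom_space G X X\<^esub> (b \<odot>\<^bsub>hom_space G X X\<^esub> v)"
      unfolding ops mem using smult(3) by (auto intro!: restrict_ext)
    show "\<forall>v\<in>carrier (hom_space G X X). \<one>\<^bsub>class_ring :: 'f ring\<^esub> \<odot>\<^bsub>hom_space G X X\<^esub> v = v"
      unfolding ops Ball_def mem using X.smult_one by (auto intro!: ext)
    show "\<forall>a b v. a \<in> carrier (class_ring :: 'f ring) \<and> b \<in> carrier class_ring \<and> v \<in> carrier (hom_space G X X)
        \<longrightarrow> (a \<oplus>\<^bsub>class_ring\<^esub> b) \<odot>\<^bsub>hom_space G X X\<^esub> v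
          = a \<odot>\<^bsub>hom_space G X X\<^esub> v \<oplus>\<^bsub>hom_space G X X\<^esub> b \<odot>\<^bsub>hom_space G X X\<^esub> v"
      unfolding ops mem using smult(1) by (auto intro!: restrict_ext)
    show "\<forall>a v w. a \<in> carrier (class_ring :: 'f ring) \<and> v \<in> carrier (hom_space G X X) \<and> w \<in> carrier (hom_space G X X)
        \<longrightarrow> a \<odot>\<^bsub>hom_space G X X\<^esub> (v \<oplus>\<^bsub>hom_space G X X\<^esub> w)
          = a \<odot>\<^bsub>hom_space G X X\<^esub> v \<oplus>\<^bsub>hom_space G X X\<^esub> a \<odot>\<^bsub>hom_space G X X\<^esub> w"
      unfolding ops mem using smult(2) by (auto intro!: restrict_ext)
  qed
qed

text \<open>The identity is a nonzero vector of the one-dimensional space of endomorphisms, so it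
  spans that space.\<close>

lemma intertwining_number_1_scalar:
  fixes X :: "('f::field, 'v, 'g, 'y) gmodule_scheme"
  assumes X: "gmodule G X" and nz: "carrier X \<noteq> {\<zero>\<^bsub>X\<^esub>}" and one: "intertwining_number G X X = 1"
    and \<phi>: "\<phi> \<in> gmodule_hom G X X"
  obtains c where "\<And>x. x \<in> carrier X \<Longrightarrow> \<phi> x = c \<odot>\<^bsub>X\<^esub> x"
proof -
  let ?E = "hom_space G X X" and ?id = "\<lambda>x\<in>carrier X. x"
  interpret X: vectorspace class_ring X by (rule gmodule_vectorspace[OF X])
  have sc: "c \<odot>\<^bsub>X\<^esub> x \<in> carrier X" if "x \<in> carrier X" for c x
    using X.smult_closed[of c x] that by simp
  have id: "?id \<in> carrier ?E"
    using gmodule_act(1)[OF X] sc by (auto simp: hom_space_def gmodule_hom_iff)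
  obtain x where x: "x \<in> carrier X" "x \<noteq> \<zero>\<^bsub>X\<^esub>" using nz gmodule_zero[OF X] by blast
  have "?id x \<noteq> \<zero>\<^bsub>?E\<^esub> x" using x by (simp add: hom_space_def)
  then have "?id \<noteq> \<zero>\<^bsub>?E\<^esub>" by metis
  then have E: "carrier ?E = range (\<lambda>c. c \<odot>\<^bsub>?E\<^esub> ?id)"
    using edim_eq_1_iff[OF hom_space_vectorspace[OF X] id] one by (simp add: intertwining_number_def)
  have "restrict \<phi> (carrier X) \<in> carrier ?E"
    using \<phi> gmodule_act(1)[OF X] sc by (auto simp: hom_space_def gmodule_hom_iff)
  then obtain c where c: "restrict \<phi> (carrier X) = c \<odot>\<^bsub>?E\<^esub> ?id" unfolding E by auto
  have "\<phi> x = c \<odot>\<^bsub>X\<^esub> x" if "x \<in> carrier X" for x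
    using fun_cong[OF c, of x] that by (simp add: hom_space_def)
  then show thesis by (rule that)
qed

context basic_data
begin

section \<open>Multiplicity free basic modules\<close>

text \<open>An element of M lies in I when its \<Theta>-part is supported in \<Omega>. As X lies in
  I, the product X m\<inverse> is in I if and only if m is. So I consists of the elements that keep
  an index of the \<lambda>-space inside \<Omega>.\<close>

lemma row_act_Om_iff:
  assumes m: "m \<in> carrier M" and X: "X \<in> Om"
  shows "row_act D m X \<in> Om \<longleftrightarrow> m \<in> I"
proof -
  have XI: "X \<in> I" "X \<in> carrier M" using X Om_I Om_M by auto
  let ?y = "X \<otimes>\<^bsub>M\<^esub> McLain_inv m"
  have y: "?y \<in> carrier M" using XI m by simp
  have 1: "row_act D m X \<in> Om \<longleftrightarrow> ?y \<in> I"
  proof -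
    have "keys ?y \<inter> \<Theta> \<subseteq> \<Omega> \<longleftrightarrow> keys ?y \<subseteq> \<Gamma> \<union> \<Omega>"
      using y Omega_subset_Theta[of D] by (auto simp: Gamma_set_eq McLain_simps(1))
    then show ?thesis by (simp add: I_eq row_act_def keys_restr)
  qed
  have 2: "?y \<in> I \<longleftrightarrow> McLain_inv m \<in> I"
  proof
    assume "?y \<in> I"
    then have "McLain_inv X \<otimes>\<^bsub>M\<^esub> ?y \<in> I"
      using subgroup.m_closed[OF I_subgroup subgroup.m_inv_closed[OF I_subgroup XI(1)]] by blast
    then show "McLain_inv m \<in> I" using XI m by (simp flip: McLain.m_assoc)
  qed (rule subgroup.m_closed[OF I_subgroup XI(1)])
  have 3: "McLain_inv m \<in> I \<longleftrightarrow> m \<in> I"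
    using subgroup.m_inv_closed[OF I_subgroup, of m] subgroup.m_inv_closed[OF I_subgroup, of "McLain_inv m"] m by auto
  show ?thesis using 1 2 3 by simp
qed

lemma semi_expand_act:
  assumes w: "w \<in> semi_invariants"
  shows "act V m w = (\<Sum>X\<in>keys w. single (row_act D m X) (lookup w X * row_coeff D f m X))"
  by (simp add: row_module_simps(5) plin_def)

lemma act_I_semi:
  assumes "x \<in> I" "w \<in> semi_invariants"
  shows "act V x w \<in> semi_invariants"
  unfolding semi_invariants_eq semi_expand_act[OF assms(2)] mem_Collect_eq[of _ "\<lambda>v. keys v \<subseteq> Om"]
proof (rule keys_sum_subset)
  fix X assume "X \<in> keys w"
  then have "X \<in> Om" using assms(2) unfolding semi_invariants_eq by blast
  then have "row_act D x X \<in> Om" using row_act_Om_iff[of x X] assms(1) I_M by blast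
  then show "keys (single (row_act D x X) (lookup w X * row_coeff D f x X)) \<subseteq> Om"
    by simp
qed

text \<open>A translate of a vector of the \<lambda>-space by an element outside I has no component
  in that space. This is the Mackey-type separation on which \<open>submodule_over\<close>
  rests.\<close>

lemma restr_act_semi:
  assumes m: "m \<in> carrier M" and w: "w \<in> semi_invariants"
  shows "restr Om (act V m w) = (if m \<in> I then act V m w else 0)"
proof (cases "m \<in> I")
  case True
  then show ?thesis using act_I_semi[OF True w] by (simp add: semi_invariants_eq restr_id)
next
  case False
  have "restr Om (single (row_act D m X) c) = (0 :: _ \<Rightarrow>\<^sub>0 'f)"
    if "X \<in> keys w" for X and c :: 'f
  proof -
    have "X \<in> Om" using w that unfolding semi_invariants_eq by blast
    then have "row_act D m X \<notin> Om" using row_act_Om_iff[OF m] False by blast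
    then show ?thesis by (intro poly_mapping_eqI) (auto simp: lookup_restr lookup_single when_def)
  qed
  then show ?thesis using False unfolding semi_expand_act[OF w] restr_linear(3) by simp
qed

text \<open>
  The module induced from an \<open>I\<close>-submodule \<open>W\<close> of the semi-invariants meets the semi-invariants
  in \<open>W\<close>; instead of the induced module take the largest submodule that projects into \<open>W\<close>.
\<close>

lemma submodule_over:
  assumes W: "W \<subseteq> semi_invariants" "0 \<in> W" "\<And>u v. u \<in> W \<Longrightarrow> v \<in> W \<Longrightarrow> u + v \<in> W"
    "\<And>c u. u \<in> W \<Longrightarrow> scale c u \<in> W" "\<And>x u. x \<in> I \<Longrightarrow> u \<in> W \<Longrightarrow> act V x u \<in> W"
  obtains N where "gsubmodule M V N" "W \<subseteq> N" "N \<inter> semi_invariants \<subseteq> W"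
proof
  let ?N = "{v \<in> carrier V. \<forall>g\<in>carrier M. restr Om (act V g v) \<in> W}"
  show "gsubmodule M V ?N"
    unfolding gsub_iff
  proof (intro conjI ballI allI)
    show "0 \<in> ?N" using W(2) by (simp add: V_simps act_lin(3) restr_linear(2))
    show "u + v \<in> ?N" if "u \<in> ?N" "v \<in> ?N" for u v
      using that W(3) by (auto simp: act_lin(1) restr_linear(1) V_simps intro!: keys_subset(2) del: subsetI)
    show "scale c u \<in> ?N" if "u \<in> ?N" for c u
      using that W(4) by (auto simp: act_lin(2) restr_scale V_simps intro!: keys_subset(1) del: subsetI)
    show "act V g u \<in> ?N" if "g \<in> carrier M" "u \<in> ?N" for g u
    proof -
      have "restr Om (act V h (act V g u)) \<in> W" if h: "h \<in> carrier M" for h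
        using act_mult[OF h \<open>g \<in> carrier M\<close>, of u] \<open>u \<in> ?N\<close> McLain.m_closed[OF h \<open>g \<in> carrier M\<close>] by auto
      then show ?thesis using that act_V by auto
    qed
  qed auto
  show "W \<subseteq> ?N"
  proof
    fix w assume w: "w \<in> W"
    then have "w \<in> semi_invariants" using W(1) by blast
    then show "w \<in> ?N" using w W(2,5) semi_V restr_act_semi by auto
  qed
  show "?N \<inter> semi_invariants \<subseteq> W"
  proof
    fix v assume v: "v \<in> ?N \<inter> semi_invariants"
    then have vV: "v \<in> carrier V" by blast
    have "restr Om (act V \<one>\<^bsub>M\<^esub> v) \<in> W" using v McLain.one_closed by blast
    moreover have "restr Om v = v" using v by (simp add: semi_invariants_eq restr_id)
    ultimately show "v \<in> W" using act_one[OF vV] by simp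
  qed
qed

text \<open>Uniqueness of the components of a vector makes them additive, homogeneous and
  equivariant.\<close>

lemma decomposition_projections:
  assumes S: "irreducible_decomposition M V S"
  obtains \<pi> where "\<And>U. U \<in> S \<Longrightarrow> \<pi> U \<in> gmodule_hom M V V"
    and "\<And>U v. U \<in> S \<Longrightarrow> v \<in> carrier V \<Longrightarrow> \<pi> U v \<in> U"
    and "\<And>v. v \<in> carrier V \<Longrightarrow> (\<Sum>U\<in>S. \<pi> U v) = v"
    and "\<And>U W u. \<lbrakk>U \<in> S; W \<in> S; u \<in> U\<rbrakk> \<Longrightarrow> \<pi> W u = (if W = U then u else 0)"
proof -
  have fin: "finite S" and sub: "\<And>U. U \<in> S \<Longrightarrow> gsubmodule M V U"
    and dec: "\<And>v. v \<in> carrier V \<Longrightarrow> \<exists>!u. u \<in> (\<Pi>\<^sub>E U\<in>S. U) \<and> v = (\<Oplus>\<^bsub>V\<^esub>U\<in>S. u U)"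
    using S by (auto simp: irreducible_decomposition_def)
  have sum: "(\<Oplus>\<^bsub>V\<^esub>U\<in>S. u U) = (\<Sum>U\<in>S. u U)" if "\<And>U. U \<in> S \<Longrightarrow> u U \<in> U" for u
    by (rule pm_space_finsum[OF row_module_pm_space fin]) (use that gsubD(1)[OF sub] in blast)
  define t where "t v = (THE u. u \<in> (\<Pi>\<^sub>E U\<in>S. U) \<and> v = (\<Oplus>\<^bsub>V\<^esub>U\<in>S. u U))" for v
  have t: "t v \<in> (\<Pi>\<^sub>E U\<in>S. U)" "v = (\<Oplus>\<^bsub>V\<^esub>U\<in>S. t v U)" if "v \<in> carrier V" for v
    using theI'[OF dec[OF that]] unfolding t_def by auto
  have tU: "t v U \<in> U" if "v \<in> carrier V" "U \<in> S" for v U using t(1)[OF that(1)] that(2) by auto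
  have tsum: "(\<Sum>U\<in>S. t v U) = v" if "v \<in> carrier V" for v
    using sum[of "t v"] tU[OF that] t(2)[OF that] by simp
  have uniq: "t v U = u U" if v: "v \<in> carrier V" and u: "\<And>U. U \<in> S \<Longrightarrow> u U \<in> U" "v = (\<Sum>U\<in>S. u U)" and U: "U \<in> S"
    for v u U
  proof -
    let ?u = "restrict u S"
    have "?u \<in> (\<Pi>\<^sub>E U\<in>S. U)" using u(1) by auto
    moreover have "v = (\<Oplus>\<^bsub>V\<^esub>U\<in>S. ?u U)" using sum[of ?u] u by simp
    ultimately have "t v = ?u" using dec[OF v] t[OF v] by blast
    then show ?thesis using U by simp
  qed
  define \<pi> where "\<pi> U v = t v U" for U v
  show thesis
  proof (rule that[of \<pi>])
    fix U assume U: "U \<in> S"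
    show "\<pi> U \<in> gmodule_hom M V V"
      unfolding hom_V_iff
    proof (intro conjI ballI allI)
      fix v assume v: "v \<in> carrier V"
      show "\<pi> U v \<in> carrier V" unfolding \<pi>_def by (rule gsubD(1)[OF sub[OF U] tU[OF v U]])
      show "\<pi> U (scale c v) = scale c (\<pi> U v)" for c unfolding \<pi>_def
      proof (rule uniq[OF _ _ _ U])
        show "scale c v \<in> carrier V" using v by (auto simp: V_simps intro!: keys_subset del: subsetI)
        show "scale c v = (\<Sum>U\<in>S. scale c (t v U))" using tsum[OF v] by (simp flip: scale_sum)
      qed (rule gsubD(4)[OF sub tU[OF v]])
      show "\<pi> U (act V g v) = act V g (\<pi> U v)" if g: "g \<in> carrier M" for g unfolding \<pi>_def
      proof (rule uniq[OF _ _ _ U])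
        show "act V g v \<in> carrier V" by (rule act_V[OF g v])
        show "act V g v = (\<Sum>U\<in>S. act V g (t v U))" using tsum[OF v] by (simp flip: act_lin(4))
      qed (rule gsubD(5)[OF sub g tU[OF v]])
      show "\<pi> U (v + w) = \<pi> U v + \<pi> U w" if w: "w \<in> carrier V" for w unfolding \<pi>_def
      proof (rule uniq[OF _ _ _ U])
        show "v + w \<in> carrier V" using v w by (auto simp: V_simps intro!: keys_subset del: subsetI)
        show "v + w = (\<Sum>U\<in>S. t v U + t w U)" using tsum[OF v] tsum[OF w] by (simp add: sum.distrib)
      qed (rule gsubD(3)[OF sub tU[OF v] tU[OF w]])
    qed
  next
    fix U v assume "U \<in> S" "v \<in> carrier V"
    then show "\<pi> U v \<in> U" unfolding \<pi>_def by (rule tU[rotated])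
  next
    fix v assume "v \<in> carrier V"
    then show "(\<Sum>U\<in>S. \<pi> U v) = v" unfolding \<pi>_def by (rule tsum)
  next
    fix U W u assume U: "U \<in> S" "W \<in> S" "u \<in> U"
    show "\<pi> W u = (if W = U then u else 0)" unfolding \<pi>_def
    proof (rule uniq[OF gsubD(1)[OF sub[OF U(1)] U(3)] _ _ U(2), where u = "\<lambda>W. if W = U then u else 0"])
      show "(if W = U then u else 0) \<in> W" if "W \<in> S" for W
        using gsubD(2)[OF sub[OF that]] U(3) by simp
      show "u = (\<Sum>W\<in>S. if W = U then u else 0)" using fin U(1) by simp
    qed
  qed
qed

lemma irreducible_sub_iff:
  assumes "gsubmodule M V U"
  shows "irreducible_gmodule M (V\<lparr>carrier := U\<rparr>) \<longleftrightarrow> U \<noteq> {0} \<and>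
    (\<forall>W. W \<subseteq> U \<and> gsubmodule M V W \<longrightarrow> W = {0} \<or> W = U)"
  using irreducible_gsubmodule_iff[OF V_gmodule assms] by (simp add: V_simps)

lemma irreducible_subD:
  assumes "gsubmodule M V U" "irreducible_gmodule M (V\<lparr>carrier := U\<rparr>)" "W \<subseteq> U" "gsubmodule M V W"
  shows "W = {0} \<or> W = U"
  using assms(2-4) unfolding irreducible_sub_iff[OF assms(1)] by meson

lemma schur_zero:
  assumes U: "gsubmodule M V U" "irreducible_gmodule M (V\<lparr>carrier := U\<rparr>)"
    and W: "gsubmodule M V W" "irreducible_gmodule M (V\<lparr>carrier := W\<rparr>)"
    and noniso: "\<not> gmodule_iso M (V\<lparr>carrier := U\<rparr>) (V\<lparr>carrier := W\<rparr>)"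
    and \<phi>: "\<phi> \<in> gmodule_hom M V V" "\<And>u. u \<in> U \<Longrightarrow> \<phi> u \<in> W" and u: "u \<in> U"
  shows "\<phi> u = 0"
proof (rule ccontr)
  assume nz: "\<phi> u \<noteq> 0"
  note UV = gsubD(1)[OF U(1)]
  define K where "K = {x \<in> U. \<phi> x = 0}"
  have "gsubmodule M V K"
    unfolding gsub_iff K_def
    using UV gsubD(2-5)[OF U(1)] hom_VD[OF \<phi>(1) UV] hom_V_zero[OF \<phi>(1)] act_lin(3)
    by (auto)
  moreover have "K \<subseteq> U" by (auto simp: K_def)
  ultimately have "K = {0} \<or> K = U" by (rule irreducible_subD[OF U, rotated])
  moreover have "u \<notin> K" using nz by (simp add: K_def)
  ultimately have "K = {0}" using u by blast
  then have ker: "x = 0" if "x \<in> U" "\<phi> x = 0" for x using that by (auto simp: K_def)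
  have inj: "inj_on \<phi> U"
  proof (rule inj_onI)
    fix x y assume xy: "x \<in> U" "y \<in> U" "\<phi> x = \<phi> y"
    have m: "scale (-1) y \<in> U" by (rule gsubD(4)[OF U(1) xy(2)])
    have "\<phi> (x + scale (-1) y) = \<phi> x + scale (-1) (\<phi> y)"
      using hom_VD(2)[OF \<phi>(1) UV[OF xy(1)] UV[OF m]] hom_VD(3)[OF \<phi>(1) UV[OF xy(2)]] by simp
    then have "\<phi> (x + scale (-1) y) = 0" using xy(3) by (simp add: scale_minus_one)
    moreover have "x + scale (-1) y \<in> U" by (rule gsubD(3)[OF U(1) xy(1) m])
    ultimately have "x + scale (-1) y = 0" by (rule ker[rotated])
    then show "x = y" by (simp add: scale_minus_one)
  qed
  have "gsubmodule M V (\<phi> ` U)" by (rule gsubmodule_image[OF V_gmodule V_gmodule \<phi>(1) U(1)])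
  moreover have "\<phi> ` U \<subseteq> W" using \<phi>(2) by blast
  ultimately have "\<phi> ` U = {0} \<or> \<phi> ` U = W"
    by (rule irreducible_subD[OF W, rotated])
  then have "\<phi> ` U = W" using imageI[OF u, of \<phi>] nz by auto
  then have "bij_betw \<phi> U W" using inj by (simp add: bij_betw_def)
  moreover have "\<phi> \<in> gmodule_hom M (V\<lparr>carrier := U\<rparr>) (V\<lparr>carrier := W\<rparr>)"
    using gmodule_hom_restrict[OF V_gmodule V_gmodule \<phi>(1) U(1)] \<open>\<phi> ` U = W\<close> by simp
  ultimately show False using noniso by (auto simp: gmodule_iso_def)
qed

lemma multiplicity_free_imp_commute:
  assumes split: "splitting_field_over (M\<lparr>carrier := I\<rparr>) H (basic_character D f)"
    and mf: "multiplicity_free M V" and x: "x \<in> I" and y: "y \<in> I"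
  shows "act V (x \<otimes>\<^bsub>M\<^esub> y) (\<delta> 0) = act V (y \<otimes>\<^bsub>M\<^esub> x) (\<delta> 0)"
proof -
  obtain S where S: "irreducible_decomposition M V S"
    using mf unfolding multiplicity_free_def by (elim conjE exE)
  have noniso: "\<not> gmodule_iso M (V\<lparr>carrier := U\<rparr>) (V\<lparr>carrier := W\<rparr>)" if "U \<in> S" "W \<in> S" "U \<noteq> W" for U W
    using mf S that unfolding multiplicity_free_def by (elim conjE) (drule spec, erule (1) impE, simp)
  have fin: "finite S" and sub: "\<And>U. U \<in> S \<Longrightarrow> gsubmodule M V U"
    and irr: "\<And>U. U \<in> S \<Longrightarrow> irreducible_gmodule M (V\<lparr>carrier := U\<rparr>)"
    using S by (auto simp: irreducible_decomposition_def)
  obtain \<pi> where \<pi>: "\<And>U. U \<in> S \<Longrightarrow> \<pi> U \<in> gmodule_hom M V V"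
    and \<pi>U: "\<And>U v. U \<in> S \<Longrightarrow> v \<in> carrier V \<Longrightarrow> \<pi> U v \<in> U"
    and \<pi>sum: "\<And>v. v \<in> carrier V \<Longrightarrow> (\<Sum>U\<in>S. \<pi> U v) = v"
    and \<pi>id: "\<And>U W u. \<lbrakk>U \<in> S; W \<in> S; u \<in> U\<rbrakk> \<Longrightarrow> \<pi> W u = (if W = U then u else 0)"
    using decomposition_projections[OF S] by blast
  let ?G = "M\<lparr>carrier := I\<rparr>"
  have VI: "gmodule ?G V" by (rule gmodule_restrict_group[OF V_gmodule I_subgroup])
  have d0: "\<delta> 0 \<in> carrier V" by (rule delta_V[OF zero_rows])
  define u where "u U = \<pi> U (\<delta> 0)" for U
  have u: "u U \<in> U" "u U \<in> semi_invariants" if "U \<in> S" for U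
    unfolding u_def by (rule \<pi>U[OF that d0], rule hom_V_semi[OF \<pi>[OF that] delta_0_semi])
  have usum: "(\<Sum>U\<in>S. u U) = \<delta> 0" unfolding u_def by (rule \<pi>sum[OF d0])
  have scalar: "\<exists>c. \<phi> (u U) = scale c (u U)"
    if U: "U \<in> S" and \<phi>: "\<phi> \<in> gmodule_hom M V V" "\<And>v. v \<in> U \<Longrightarrow> \<phi> v \<in> U" for U \<phi>
  proof -
    let ?W = "U \<inter> semi_invariants"
    let ?X = "V\<lparr>carrier := ?W\<rparr>"
    have semi_closed: "0 \<in> semi_invariants" "a + b \<in> semi_invariants" "scale c a \<in> semi_invariants"
      if "a \<in> semi_invariants" "b \<in> semi_invariants" for a b c
      using that unfolding semi_invariants_eq by (auto intro!: keys_subset del: subsetI)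
    have Wclosed: "0 \<in> ?W" "a + b \<in> ?W" "scale c a \<in> ?W" "z \<in> I \<Longrightarrow> act V z a \<in> ?W"
      if "a \<in> ?W" "b \<in> ?W" for a b c z
      using that semi_closed[of a b] gsubD(2-5)[OF sub[OF U]] act_I_semi I_M by auto
    obtain w where w: "w \<in> ?W" "w \<noteq> 0"
      using submodule_semi_invariant[OF sub[OF U]] irr[OF U] unfolding irreducible_sub_iff[OF sub[OF U]] by blast
    have subI: "gsubmodule ?G V ?W"
      unfolding gsubmodule_iff[OF VI] V_simps(2-4)
      using Wclosed w semi_V by (simp add: subset_iff)
    have irrI: "irreducible_gmodule ?G ?X"
      unfolding irreducible_gsubmodule_iff[OF VI subI] V_simps(2)
    proof (intro conjI allI impI)
      show "?W \<noteq> {0}" using w by blast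
      fix W' assume W': "W' \<subseteq> ?W \<and> gsubmodule ?G V W'"
      then have W'c: "0 \<in> W'" "\<And>a b. a \<in> W' \<Longrightarrow> b \<in> W' \<Longrightarrow> a + b \<in> W'" "\<And>c a. a \<in> W' \<Longrightarrow> scale c a \<in> W'"
        "\<And>z a. z \<in> I \<Longrightarrow> a \<in> W' \<Longrightarrow> act V z a \<in> W'"
        unfolding gsubmodule_iff[OF VI] V_simps(2-4) by auto
      \<comment> \<open>N converts the I-submodule W' of the \<lambda>-part of U into the
        M-submodule U \<inter> N of U, so irreducibility of U over M passes to its \<lambda>-part
        over I.\<close>
      obtain N where N: "gsubmodule M V N" "W' \<subseteq> N" "N \<inter> semi_invariants \<subseteq> W'"
        by (rule submodule_over[of W']) (use W' W'c in auto)
      have "gsubmodule M V (U \<inter> N)"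
        using sub[OF U] N(1) unfolding gsub_iff by auto
      then have "U \<inter> N = {0} \<or> U \<inter> N = U"
        by (rule irreducible_subD[OF sub[OF U] irr[OF U] Int_lower1])
      then show "W' = {0} \<or> W' = ?W"
      proof
        assume "U \<inter> N = {0}"
        then show ?thesis using W' N(2) W'c(1) by blast
      next
        assume "U \<inter> N = U"
        then show ?thesis using W' N(3) by blast
      qed
    qed
    have over: "lies_over H (basic_character D f) ?X"
      unfolding lies_over_def
    proof (intro exI conjI ballI)
      let ?L = "range (\<lambda>c. scale c w)"
      have XI: "gmodule ?G ?X" by (rule gmodule_gsubmodule[OF VI subI])
      have Lsub: "?L \<subseteq> ?W" using Wclosed(3)[OF w(1) w(1)] by blast
      have "module class_ring ?X" using gmodule_vectorspace[OF XI] by (simp add: vectorspace_def)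
      then have "submodule class_ring ?L ?X"
      proof (rule submodule.intro)
        show "?L \<subseteq> carrier ?X" using Lsub by simp
        show "a \<oplus>\<^bsub>?X\<^esub> b \<in> ?L" if "a \<in> ?L" "b \<in> ?L" for a b
          using that by (auto simp: V_simps simp flip: scale_add_left)
        show "\<zero>\<^bsub>?X\<^esub> \<in> ?L" by (rule range_eqI[of _ _ 0]) (simp add: V_simps)
        show "c \<odot>\<^bsub>?X\<^esub> a \<in> ?L" if "a \<in> ?L" for c a using that by (auto simp: V_simps)
      qed
      then show Ls: "VectorSpace.subspace class_ring ?L ?X"
        using gmodule_vectorspace[OF XI] by (simp add: subspace_def)
      have "vectorspace class_ring (?X\<lparr>carrier := ?L\<rparr>)"
        by (rule vectorspace.subspace_is_vs[OF gmodule_vectorspace[OF XI] Ls])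
      moreover have "w \<in> ?L" by (rule range_eqI[of _ _ 1]) simp
      ultimately show "edim (?X\<lparr>carrier := ?L\<rparr>) = 1"
        using edim_eq_1_iff[of "?X\<lparr>carrier := ?L\<rparr>" w] w(2) by (simp add: V_simps)
      fix h v assume h: "h \<in> H" and v: "v \<in> ?L"
      then have "v \<in> semi_invariants" using Lsub by blast
      then show "act ?X h v = basic_character D f h \<odot>\<^bsub>?X\<^esub> v"
        using h basic_character_eq[OF h] by (simp add: semi_invariants_def V_simps)
    qed
    \<comment> \<open>The splitting hypothesis speaks of modules on finitely supported functions on
      the type of M. The indices of the model have that type, so its submodules are admissible
      without passing to an isomorphic copy.\<close>
    have one: "intertwining_number ?G ?X ?X = 1"
      using split irrI over unfolding splitting_field_over_def by blast
    have "\<phi> \<in> gmodule_hom ?G ?X ?X"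
      unfolding gmodule_hom_iff
      using \<phi>(2) hom_V_semi[OF \<phi>(1)] hom_VD[OF \<phi>(1) semi_V] semi_V I_M by (auto simp: V_simps(2-4))
    then obtain c where "\<And>v. v \<in> carrier ?X \<Longrightarrow> \<phi> v = c \<odot>\<^bsub>?X\<^esub> v"
      using intertwining_number_1_scalar[OF gmodule_gsubmodule[OF VI subI] _ one] w by (auto simp: V_simps)
    then have "\<phi> (u U) = scale c (u U)" using u[OF U] by (simp add: V_simps)
    then show ?thesis by blast
  qed
  have eig: "\<exists>c. v = (\<Sum>U\<in>S. scale (c U) (u U))" if v: "v \<in> semi_invariants" for v
  proof -
    obtain \<phi> where \<phi>: "\<phi> \<in> gmodule_hom M V V" "\<phi> (\<delta> 0) = v" by (rule hom_V_exists[OF v])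
    \<comment> \<open>By Schur's lemma the components of \<phi> a in the other summands vanish,
      since no other summand is isomorphic to U.\<close>
    have pres: "\<phi> a \<in> U" if U: "U \<in> S" and a: "a \<in> U" for U a
    proof -
      have aV: "a \<in> carrier V" by (rule gsubD(1)[OF sub[OF U] a])
      have "\<pi> W (\<phi> a) = 0" if W: "W \<in> S" "W \<noteq> U" for W
      proof -
        have "(\<pi> W \<circ> \<phi>) a = 0"
        proof (rule schur_zero[OF sub[OF U] irr[OF U] sub[OF W(1)] irr[OF W(1)] _ _ _ a])
          show "\<not> gmodule_iso M (V\<lparr>carrier := U\<rparr>) (V\<lparr>carrier := W\<rparr>)" using noniso[OF U W(1)] W(2) by blast
          show "\<pi> W \<circ> \<phi> \<in> gmodule_hom M V V" by (rule gmodule_hom_comp[OF \<phi>(1) \<pi>[OF W(1)]])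
          fix b assume "b \<in> U"
          then have "\<phi> b \<in> carrier V" using hom_VD(1)[OF \<phi>(1)] gsubD(1)[OF sub[OF U]] by blast
          then show "(\<pi> W \<circ> \<phi>) b \<in> W" using \<pi>U[OF W(1)] by simp
        qed
        then show ?thesis by simp
      qed
      then have "(\<Sum>W\<in>S. \<pi> W (\<phi> a)) = (\<Sum>W\<in>S. if W = U then \<pi> U (\<phi> a) else 0)"
        by (intro sum.cong) auto
      then have "\<phi> a = \<pi> U (\<phi> a)" using \<pi>sum[OF hom_VD(1)[OF \<phi>(1) aV]] fin U by simp
      then show ?thesis using \<pi>U[OF U hom_VD(1)[OF \<phi>(1) aV]] by simp
    qed
    have "\<forall>U\<in>S. \<exists>c. \<phi> (u U) = scale c (u U)" using scalar[OF _ \<phi>(1) pres] by blast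
    then obtain c where c: "\<And>U. U \<in> S \<Longrightarrow> \<phi> (u U) = scale (c U) (u U)" by metis
    have "v = \<phi> (\<Sum>U\<in>S. u U)" using usum \<phi>(2) by simp
    also have "\<dots> = (\<Sum>U\<in>S. \<phi> (u U))" by (rule hom_V_sum[OF \<phi>(1)]) (use u semi_V in blast)
    also have "\<dots> = (\<Sum>U\<in>S. scale (c U) (u U))" using c by simp
    finally show ?thesis by blast
  qed
  \<comment> \<open>The translate of \<open>u U\<close> by an element of I lies in U and, by
    \<open>eig\<close>, in the span of the vectors \<open>u W\<close>; projecting to U leaves a
    multiple of \<open>u U\<close>.\<close>
  have eigI: "\<exists>c. act V z (u U) = scale c (u U)" if z: "z \<in> I" and U: "U \<in> S" for z U
  proof -
    have s: "act V z (u U) \<in> semi_invariants" by (rule act_I_semi[OF z u(2)[OF U]])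
    have aU: "act V z (u U) \<in> U" using gsubD(5)[OF sub[OF U] _ u(1)[OF U]] z I_M by blast
    obtain c where c: "act V z (u U) = (\<Sum>W\<in>S. scale (c W) (u W))" using eig[OF s] by blast
    have uV: "scale a (u W) \<in> carrier V" if "W \<in> S" for W a
      using gsubD(1)[OF sub[OF that] gsubD(4)[OF sub[OF that] u(1)[OF that]]] .
    have "act V z (u U) = \<pi> U (act V z (u U))" using \<pi>id[OF U U aU] by simp
    also have "\<dots> = (\<Sum>W\<in>S. \<pi> U (scale (c W) (u W)))"
      unfolding c by (rule hom_V_sum[OF \<pi>[OF U] uV])
    also have "\<dots> = (\<Sum>W\<in>S. if W = U then scale (c U) (u U) else 0)"
      by (rule sum.cong[OF refl], subst \<pi>id[OF _ U]) (use gsubD(4)[OF sub u(1)] in auto)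
    also have "\<dots> = scale (c U) (u U)" using fin U by simp
    finally show ?thesis by blast
  qed
  then obtain cx where cx: "\<And>U. U \<in> S \<Longrightarrow> act V x (u U) = scale (cx U) (u U)" using x by metis
  obtain cy where cy: "\<And>U. U \<in> S \<Longrightarrow> act V y (u U) = scale (cy U) (u U)" using eigI y by metis
  have M: "x \<in> carrier M" "y \<in> carrier M" using x y I_M by auto
  have uV: "u U \<in> carrier V" if "U \<in> S" for U by (rule semi_V[OF u(2)[OF that]])
  have "act V (x \<otimes>\<^bsub>M\<^esub> y) (u U) = act V (y \<otimes>\<^bsub>M\<^esub> x) (u U)" if U: "U \<in> S" for U
    using act_mult[OF M uV[OF U]] act_mult[OF M(2,1) uV[OF U]] cx[OF U] cy[OF U]
    by (simp add: act_lin(2) mult.commute)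
  then show ?thesis unfolding usum[symmetric] act_lin(4) by simp
qed

end

lemma J_mult_single:
  "J_mult (single (a, b) r) (single (c, d) s)
    = (if b = c then single (a, d) (r * s) else (0 :: 'l \<times> 'l \<Rightarrow>\<^sub>0 'r::ring_1))"
  by (cases "r = 0"; cases "s = 0") (auto simp: J_mult_def)

context basic_data
begin

section \<open>The quotient \<open>I/H\<close>\<close>

lemma restr_H_mult:
  assumes "h \<in> H" "y \<in> carrier M"
  shows "restr \<Theta> (h \<otimes>\<^bsub>M\<^esub> y) = restr \<Theta> y"
proof -
  have "restr \<Theta> h = 0"
    using assms(1) by (intro poly_mapping_eqI) (auto simp: H_eq Gamma_set_eq lookup_restr in_keys_iff)
  then show ?thesis
    using restr_Theta_mult[of h y D] assms H_M McLain.l_one[OF assms(2)] by (auto simp: McLain_simps(3))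
qed

text \<open>With \<open>restr_H_mult\<close> this says that truncated rows separate precisely the
  cosets H x.\<close>

lemma restr_Theta_eqD:
  assumes x: "x \<in> carrier M" and y: "y \<in> carrier M" and eq: "restr \<Theta> x = restr \<Theta> y"
  shows "x \<otimes>\<^bsub>M\<^esub> McLain_inv y \<in> H"
proof -
  let ?z = "x \<otimes>\<^bsub>M\<^esub> McLain_inv y"
  have z: "?z \<in> carrier M" using x y by simp
  have "restr \<Theta> ?z = restr \<Theta> (y \<otimes>\<^bsub>M\<^esub> McLain_inv y)"
    using restr_Theta_mult[of x "McLain_inv y" D] restr_Theta_mult[of y "McLain_inv y" D] x y eq by simp
  also have "\<dots> = 0" using y by (simp add: McLain_simps(3) restr_id)
  finally have "keys ?z \<inter> \<Theta> = {}" by (metis keys_restr keys_zero)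
  moreover have "keys ?z \<subseteq> Phi" using z by (simp add: McLain_simps(1))
  ultimately show ?thesis unfolding H_eq Gamma_set_eq by (rule subset_Diff_disjoint)
qed

lemma Omega_D:
  assumes "(a, c) \<in> \<Omega>"
  obtains b d where "(a, b) \<in> D" "(c, d) \<in> D" "a < c" "c < b" "b < d"
  using assms by (auto simp: Omega_set_def)

text \<open>In a product term at (a, b) with b up to the end of row a, the left factor sits at some
  (a, c) with c before that end, hence outside \<Gamma>; for x in I it must be in \<Omega>. Then row
  c ends after row a, which puts (c, b) into \<Theta>. The bound b \<le> e includes the position of
  D, as the coefficients require.\<close>

lemma keys_J_mult_I:
  assumes x: "x \<in> I" and y: "y \<in> carrier M" and ab: "(a, e) \<in> D" "b \<le> e" "(a, b) \<in> keys (J_mult x y)"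
  obtains c where "(a, c) \<in> \<Omega>" "(c, b) \<in> \<Theta>" "(c, b) \<in> keys y"
proof -
  obtain c where c: "(a, c) \<in> keys x" "(c, b) \<in> keys y"
    using ab(3) by (rule keys_J_mult)
  have "c < b" using c(2) y by (auto simp: McLain_simps(1) Phi_def)
  then have "(a, c) \<notin> \<Gamma>"
    using Theta_iff[OF ab(1), of c] ab(2) by (auto simp: Gamma_set_eq Phi_def)
  then have om: "(a, c) \<in> \<Omega>" using c(1) x by (auto simp: I_eq)
  then obtain b' d where bd: "(a, b') \<in> D" "(c, d) \<in> D" "b' < d" by (rule Omega_D)
  have "b' = e" by (rule D_fst[OF bd(1) ab(1)])
  then have "(c, b) \<in> \<Theta>" using Theta_iff[OF bd(2), of b] \<open>c < b\<close> ab(2) bd(3) by auto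
  then show thesis using om c(2) that by blast
qed

lemma restr_mult_H:
  assumes x: "x \<in> I" and h: "h \<in> H"
  shows "restr \<Theta> (x \<otimes>\<^bsub>M\<^esub> h) = restr \<Theta> x"
  unfolding restr_eq_iff
proof
  fix k assume k: "k \<in> \<Theta>"
  then obtain a b e where ab: "k = (a, b)" "(a, e) \<in> D" "b < e" by (auto simp: Theta_set_def)
  have hk: "p \<notin> \<Theta>" if "p \<in> keys h" for p using h that by (auto simp: H_eq Gamma_set_eq)
  have "(a, b) \<notin> keys (J_mult x h)"
  proof
    assume "(a, b) \<in> keys (J_mult x h)"
    then show False
      using keys_J_mult_I[OF x _ ab(2), of h b] h H_M ab(3) hk by (metis less_imp_le subsetD)
  qed
  then show "lookup (x \<otimes>\<^bsub>M\<^esub> h) k = lookup x k"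
    using hk[of k] k by (auto simp: McLain_simps lookup_add ab(1) in_keys_iff)
qed

text \<open>For x in I the elements x h and x have the same truncated rows by
  \<open>restr_mult_H\<close>, so x h x\<inverse> is in H.\<close>

lemma H_normal: "H \<lhd> (M\<lparr>carrier := I\<rparr>)"
proof -
  interpret G: Group.group "M\<lparr>carrier := I\<rparr>"
    by (rule subgroup.subgroup_is_group[OF I_subgroup group_McLain])
  show ?thesis
    unfolding G.normal_inv_iff
  proof (intro conjI ballI)
    show "subgroup H (M\<lparr>carrier := I\<rparr>)" by (rule McLain.subgroup_incl[OF H_subgroup I_subgroup H_I])
    fix x h assume xh: "x \<in> carrier (M\<lparr>carrier := I\<rparr>)" "h \<in> H"
    then have x: "x \<in> I" "x \<in> carrier M" using I_M by auto
    have "x \<otimes>\<^bsub>M\<^esub> h \<otimes>\<^bsub>M\<^esub> McLain_inv x \<in> H"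
      by (rule restr_Theta_eqD[OF _ x(2) restr_mult_H[OF x(1) xh(2)]]) (use x xh(2) H_M in auto)
    then show "x \<otimes>\<^bsub>M\<lparr>carrier := I\<rparr>\<^esub> h \<otimes>\<^bsub>M\<lparr>carrier := I\<rparr>\<^esub> inv\<^bsub>M\<lparr>carrier := I\<rparr>\<^esub> x \<in> H"
      using McLain.m_inv_consistent[OF I_subgroup x(1)] by simp
  qed
qed

lemma comm_group_iff:
  "comm_group ((M\<lparr>carrier := I\<rparr>) Mod H) \<longleftrightarrow>
    (\<forall>x\<in>I. \<forall>y\<in>I. restr \<Theta> (x \<otimes>\<^bsub>M\<^esub> y) = restr \<Theta> (y \<otimes>\<^bsub>M\<^esub> x))"
proof -
  let ?G = "M\<lparr>carrier := I\<rparr>"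
  interpret G: Group.group ?G
    by (rule subgroup.subgroup_is_group[OF I_subgroup group_McLain])
  interpret N: normal H ?G by (rule H_normal)
  have rc: "carrier (?G Mod H) = (\<lambda>x. H #>\<^bsub>?G\<^esub> x) ` I" by (auto simp: FactGroup_def RCOSETS_def)
  have cA: "H #>\<^bsub>?G\<^esub> x \<in> carrier (?G Mod H)" if "x \<in> I" for x unfolding rc using that by (rule imageI)
  have mult: "(H #>\<^bsub>?G\<^esub> x) \<otimes>\<^bsub>?G Mod H\<^esub> (H #>\<^bsub>?G\<^esub> y) = H #>\<^bsub>?G\<^esub> (x \<otimes>\<^bsub>M\<^esub> y)" if "x \<in> I" "y \<in> I" for x y
    using N.rcos_sum[of x y] that by (simp add: FactGroup_def)
  have closed: "x \<otimes>\<^bsub>M\<^esub> y \<in> I" if "x \<in> I" "y \<in> I" for x y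
    by (rule subgroup.m_closed[OF I_subgroup that])
  have eq_iff: "H #>\<^bsub>?G\<^esub> x = H #>\<^bsub>?G\<^esub> y \<longleftrightarrow> restr \<Theta> x = restr \<Theta> y" if xy: "x \<in> I" "y \<in> I" for x y
  proof
    have xyM: "x \<in> carrier M" "y \<in> carrier M" using xy I_M by auto
    assume "H #>\<^bsub>?G\<^esub> x = H #>\<^bsub>?G\<^esub> y"
    moreover have "x \<in> H #>\<^bsub>?G\<^esub> x" using G.rcos_self[of x H] xy N.subgroup_axioms by simp
    ultimately obtain h where "h \<in> H" "x = h \<otimes>\<^bsub>M\<^esub> y" by (auto simp: r_coset_def)
    then show "restr \<Theta> x = restr \<Theta> y" using restr_H_mult xyM by simp
  next
    have xyM: "x \<in> carrier M" "y \<in> carrier M" using xy I_M by auto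
    assume "restr \<Theta> x = restr \<Theta> y"
    then have "x \<otimes>\<^bsub>M\<^esub> McLain_inv y \<in> H" by (rule restr_Theta_eqD[OF xyM])
    moreover have "x = (x \<otimes>\<^bsub>M\<^esub> McLain_inv y) \<otimes>\<^bsub>M\<^esub> y" using xyM by (simp add: McLain.m_assoc)
    ultimately have "x \<in> H #>\<^bsub>?G\<^esub> y" by (auto simp: r_coset_def)
    then show "H #>\<^bsub>?G\<^esub> x = H #>\<^bsub>?G\<^esub> y"
      using G.repr_independence[of x H y] xy N.subgroup_axioms by simp
  qed
  have grp: "Group.group (?G Mod H)" by (rule N.factorgroup_is_group)
  show ?thesis
  proof
    assume "comm_group (?G Mod H)"
    then interpret C: comm_group "?G Mod H" .
    show "\<forall>x\<in>I. \<forall>y\<in>I. restr \<Theta> (x \<otimes>\<^bsub>M\<^esub> y) = restr \<Theta> (y \<otimes>\<^bsub>M\<^esub> x)"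
    proof (intro ballI)
      fix x y assume xy: "x \<in> I" "y \<in> I"
      have "(H #>\<^bsub>?G\<^esub> x) \<otimes>\<^bsub>?G Mod H\<^esub> (H #>\<^bsub>?G\<^esub> y) = (H #>\<^bsub>?G\<^esub> y) \<otimes>\<^bsub>?G Mod H\<^esub> (H #>\<^bsub>?G\<^esub> x)"
        by (rule C.m_comm[OF cA[OF xy(1)] cA[OF xy(2)]])
      then have "H #>\<^bsub>?G\<^esub> (x \<otimes>\<^bsub>M\<^esub> y) = H #>\<^bsub>?G\<^esub> (y \<otimes>\<^bsub>M\<^esub> x)"
        unfolding mult[OF xy] mult[OF xy(2,1)] .
      then show "restr \<Theta> (x \<otimes>\<^bsub>M\<^esub> y) = restr \<Theta> (y \<otimes>\<^bsub>M\<^esub> x)" using eq_iff closed xy by simp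
    qed
  next
    assume *: "\<forall>x\<in>I. \<forall>y\<in>I. restr \<Theta> (x \<otimes>\<^bsub>M\<^esub> y) = restr \<Theta> (y \<otimes>\<^bsub>M\<^esub> x)"
    show "comm_group (?G Mod H)"
    proof (rule group.group_comm_groupI[OF grp])
      fix A B assume "A \<in> carrier (?G Mod H)" "B \<in> carrier (?G Mod H)"
      then obtain x y where xy: "x \<in> I" "y \<in> I" "A = H #>\<^bsub>?G\<^esub> x" "B = H #>\<^bsub>?G\<^esub> y" unfolding rc by auto
      then show "A \<otimes>\<^bsub>?G Mod H\<^esub> B = B \<otimes>\<^bsub>?G Mod H\<^esub> A"
        using mult eq_iff closed * by simp
    qed
  qed
qed

lemma chain_setI:
  assumes "(a, c) \<in> \<Omega>" "(c, b) \<in> \<Omega>"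
  shows "(a, b) \<in> chain_set \<Omega>"
proof -
  have "a < b" using assms by (auto simp: Omega_set_def)
  then show ?thesis using assms
    by (auto simp: chain_set_def Phi_def less_Suc_eq intro!: exI[of _ "[a, c, b]"])
qed

text \<open>By \<open>keys_J_mult_I\<close> a product term at a position of \<Theta> comes from two
  consecutive roots of \<Omega>; their composite is in \<open>chain_set \<Omega>\<close> and would
  lie in \<Gamma>. So modulo H multiplication in I is addition of truncated rows.\<close>

lemma restr_mult_commute:
  assumes chain: "chain_set \<Omega> \<subseteq> \<Gamma>" and x: "x \<in> I" and y: "y \<in> I"
  shows "restr \<Theta> (x \<otimes>\<^bsub>M\<^esub> y) = restr \<Theta> (x + y)"
  unfolding restr_eq_iff
proof
  fix k assume k: "k \<in> \<Theta>"
  then obtain a b e where ab: "k = (a, b)" "(a, e) \<in> D" "b < e" by (auto simp: Theta_set_def)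
  have "(a, b) \<notin> keys (J_mult x y)"
  proof
    assume J: "(a, b) \<in> keys (J_mult x y)"
    obtain c where c: "(a, c) \<in> \<Omega>" "(c, b) \<in> \<Theta>" "(c, b) \<in> keys y"
      by (rule keys_J_mult_I[OF x _ ab(2) _ J]) (use y I_M ab(3) in auto)
    then have "(c, b) \<in> \<Omega>" using y by (auto simp: I_eq Gamma_set_eq)
    then have "(a, b) \<in> \<Gamma>" using chain_setI[OF c(1)] chain by blast
    then show False using k by (simp add: ab(1) Gamma_set_eq)
  qed
  then show "lookup (x \<otimes>\<^bsub>M\<^esub> y) k = lookup (x + y) k"
    by (simp add: McLain_simps lookup_add ab(1) in_keys_iff)
qed

lemma single_I: "p \<in> \<Omega> \<Longrightarrow> single p r \<in> I"
  by (simp add: I_eq)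

lemma chain_subset_iff:
  "chain_set \<Omega> \<subseteq> \<Gamma> \<longleftrightarrow> (\<forall>x\<in>I. \<forall>y\<in>I. restr \<Theta> (x \<otimes>\<^bsub>M\<^esub> y) = restr \<Theta> (y \<otimes>\<^bsub>M\<^esub> x))"
proof
  assume "chain_set \<Omega> \<subseteq> \<Gamma>"
  then show "\<forall>x\<in>I. \<forall>y\<in>I. restr \<Theta> (x \<otimes>\<^bsub>M\<^esub> y) = restr \<Theta> (y \<otimes>\<^bsub>M\<^esub> x)"
    using restr_mult_commute by (simp add: add.commute)
next
  assume comm: "\<forall>x\<in>I. \<forall>y\<in>I. restr \<Theta> (x \<otimes>\<^bsub>M\<^esub> y) = restr \<Theta> (y \<otimes>\<^bsub>M\<^esub> x)"
  show "chain_set \<Omega> \<subseteq> \<Gamma>"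
  proof
    fix p assume "p \<in> chain_set \<Omega>"
    then obtain a b \<gamma>s where p: "p = (a, b)" "(a, b) \<in> Phi" "length \<gamma>s \<ge> 3" "hd \<gamma>s = a" "last \<gamma>s = b"
      and step: "\<And>i. Suc i < length \<gamma>s \<Longrightarrow> (\<gamma>s ! i, \<gamma>s ! Suc i) \<in> \<Omega>"
      by (auto simp: chain_set_def)
    have mono: "\<gamma>s ! 2 \<le> \<gamma>s ! (2 + j)" if "2 + j < length \<gamma>s" for j
      using that
    proof (induction j)
      case (Suc j)
      then have "\<gamma>s ! (2 + j) < \<gamma>s ! (2 + Suc j)" using step[of "2 + j"] by (auto simp: Omega_set_def)
      then show ?case using Suc by simp
    qed simp
    have ne: "\<gamma>s \<noteq> []" using p(3) by auto
    \<comment> \<open>Two steps of the chain are enough: they lead to d \<le> b, so (a, d) is in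
      \<Theta> whenever (a, b) is not in \<Gamma>.\<close>
    define c d where "c = \<gamma>s ! 1" and "d = \<gamma>s ! 2"
    have "d \<le> b"
    proof -
      have "\<gamma>s ! 2 \<le> \<gamma>s ! (2 + (length \<gamma>s - 3))" by (rule mono) (use p(3) in simp)
      moreover have "2 + (length \<gamma>s - 3) = length \<gamma>s - 1" using p(3) by simp
      moreover have "b = \<gamma>s ! (length \<gamma>s - 1)" using p(5) last_conv_nth[OF ne] by simp
      ultimately show ?thesis by (simp only: d_def)
    qed
    have ac: "(a, c) \<in> \<Omega>" using step[of 0] p(3,4) ne by (simp add: c_def hd_conv_nth)
    have cd: "(c, d) \<in> \<Omega>" using step[of 1] p(3) by (simp add: c_def d_def numeral_2_eq_2)
    have lt: "a < c" "c < d" using ac cd by (auto simp: Omega_set_def)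
    show "p \<in> \<Gamma>"
    proof (rule ccontr)
      assume "p \<notin> \<Gamma>"
      then obtain e where e: "(a, e) \<in> D" "b < e" using p by (auto simp: Gamma_set_eq Theta_set_def)
      then have ad: "(a, d) \<in> \<Theta>" using Theta_iff[OF e(1), of d] lt \<open>d \<le> b\<close> by auto
      \<comment> \<open>In the order \<open>?x\<close>, \<open>?y\<close> the product has entry 1 at
        (a, d), in the other order entry 0.\<close>
      let ?x = "single (a, c) (1 :: 'r)" and ?y = "single (c, d) (1 :: 'r)"
      have "restr \<Theta> (?x \<otimes>\<^bsub>M\<^esub> ?y) = restr \<Theta> (?y \<otimes>\<^bsub>M\<^esub> ?x)"
        using comm single_I[OF ac] single_I[OF cd] by blast
      then have "lookup (?x \<otimes>\<^bsub>M\<^esub> ?y) (a, d) = lookup (?y \<otimes>\<^bsub>M\<^esub> ?x) (a, d)"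
        using ad by (simp add: restr_eq_iff)
      moreover have "d \<noteq> a" using lt by auto
      ultimately show False
        using lt by (simp add: McLain_simps J_mult_single lookup_add lookup_single)
    qed
  qed
qed

text \<open>The two sides of \<open>comm\<close> are multiples of basis vectors. Equality of their
  indices is commutativity of I/H, which yields the first claim; equality of their scalars excludes
  special triples, for which a product term falls on a position of D.\<close>

lemma commute_imp_conditions:
  assumes comm: "\<And>x y. \<lbrakk>x \<in> I; y \<in> I\<rbrakk> \<Longrightarrow> act V (x \<otimes>\<^bsub>M\<^esub> y) (\<delta> 0) = act V (y \<otimes>\<^bsub>M\<^esub> x) (\<delta> 0)"
  shows "chain_set \<Omega> \<subseteq> \<Gamma>" and "\<not> special_triple D"
proof -
  have *: "restr \<Theta> (x \<otimes>\<^bsub>M\<^esub> y) = restr \<Theta> (y \<otimes>\<^bsub>M\<^esub> x) \<and> lam (- (x \<otimes>\<^bsub>M\<^esub> y)) = lam (- (y \<otimes>\<^bsub>M\<^esub> x))"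
    if xy: "x \<in> I" "y \<in> I" for x y
  proof -
    have M: "x \<in> carrier M" "y \<in> carrier M" using xy I_M by auto
    \<comment> \<open>\<open>act_delta_0\<close> expresses the action of an element through its
      inverse, so \<open>comm\<close> is applied to the inverses of x and y.\<close>
    have inv: "McLain_inv (McLain_inv y \<otimes>\<^bsub>M\<^esub> McLain_inv x) = x \<otimes>\<^bsub>M\<^esub> y"
      "McLain_inv (McLain_inv x \<otimes>\<^bsub>M\<^esub> McLain_inv y) = y \<otimes>\<^bsub>M\<^esub> x"
      using M by (simp_all add: McLain.inv_mult_group)
    have "McLain_inv x \<in> I" "McLain_inv y \<in> I" using subgroup.m_inv_closed[OF I_subgroup] xy by auto
    then have "act V (McLain_inv y \<otimes>\<^bsub>M\<^esub> McLain_inv x) (\<delta> 0) = act V (McLain_inv x \<otimes>\<^bsub>M\<^esub> McLain_inv y) (\<delta> 0)"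
      by (intro comm)
    then have eq: "single (restr \<Theta> (x \<otimes>\<^bsub>M\<^esub> y)) (lam (- (x \<otimes>\<^bsub>M\<^esub> y)))
      = single (restr \<Theta> (y \<otimes>\<^bsub>M\<^esub> x)) (lam (- (y \<otimes>\<^bsub>M\<^esub> x)))"
      using M by (simp add: act_delta_0 inv del: single_one)
    have nz: "lam z \<noteq> 0" for z
      unfolding lam_def using D_facts(1) linear_characterD(2)[OF linear] by simp
    have "restr \<Theta> (x \<otimes>\<^bsub>M\<^esub> y) = restr \<Theta> (y \<otimes>\<^bsub>M\<^esub> x)"
      using arg_cong[OF eq, of keys] nz by simp
    then show ?thesis using eq by (metis lookup_single_eq)
  qed
  then show "chain_set \<Omega> \<subseteq> \<Gamma>" unfolding chain_subset_iff by blast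
  show "\<not> special_triple D"
  proof
    assume "special_triple D"
    then obtain a1 b1 a2 b2 a3 b3 where t: "(a1, b1) \<in> D" "(a2, b2) \<in> D" "(a3, b3) \<in> D"
      "a1 < a2" "a2 < a3" "a3 = b1" "b1 < b2" "b2 < b3"
      unfolding special_triple_def by blast
    have om: "(a1, a2) \<in> \<Omega>" "(a2, b1) \<in> \<Omega>"
      using t Omega_setI[of a1 b1 D a2 b2] Omega_setI[of a2 b2 D a3 b3] by auto
    have "f (a1, b1) (1 * (- r)) = 1" for r
    proof -
      \<comment> \<open>Both roots are in \<Omega>, and their composite is the position (a1, b1) of
        D. Only the product in this order has an entry there, so the scalars differ by f (a1, b1) (-
        r), and commutativity would make this character trivial on R.\<close>
      let ?x = "single (a1, a2) (1 :: 'r)" and ?y = "single (a2, b1) r"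
      have notD: "d \<noteq> (a1, a2)" "d \<noteq> (a2, b1)" if "d \<in> D" for d
        using om Omega_subset_Theta D_not_Theta[OF that] by blast+
      have "lam (- (?x \<otimes>\<^bsub>M\<^esub> ?y)) = (\<Prod>d\<in>D. if d = (a1, b1) then f (a1, b1) (- r) else 1)"
        unfolding lam_def
        by (rule prod.cong[OF refl])
          (use notD linear_characterD(3)[OF linear] in \<open>auto simp: McLain_simps J_mult_single lookup_add lookup_minus lookup_single when_def\<close>)
      also have "\<dots> = f (a1, b1) (- r)" using D_facts(1) t(1) by (simp add: prod.delta)
      finally have 1: "lam (- (?x \<otimes>\<^bsub>M\<^esub> ?y)) = f (a1, b1) (- r)" .
      have "b1 \<noteq> a1" using t by auto
      then have "lam (- (?y \<otimes>\<^bsub>M\<^esub> ?x)) = (\<Prod>d\<in>D. 1)"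
        unfolding lam_def
        by (intro prod.cong[OF refl])
          (use notD linear_characterD(3)[OF linear] in \<open>auto simp: McLain_simps J_mult_single lookup_add lookup_minus lookup_single when_def\<close>)
      then show ?thesis using *[OF single_I[OF om(1)] single_I[OF om(2)], of 1 r] 1 by simp
    qed
    then have "f (a1, b1) (1 * r) = 1" for r using minus_minus[of r] by metis
    then have "(1 :: 'r) = 0" by (rule right_primitive_eq_0[OF primitive[OF t(1)]])
    then show False by simp
  qed
qed

end

context basic_data
begin

section \<open>The commutative case\<close>

text \<open>
  If \<open>chain_set \<Omega> \<subseteq> \<Gamma>\<close> and there is no special triple, then \<open>I\<close> acts on the semi-invariants as the
  elementary group \<open>R\<^sup>\<Omega>\<close> acts on its regular module, and the characters \<open>a \<mapsto> \<mu> (b a)\<close> diagonalize it.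
\<close>

lemma finite_Omega: "finite \<Omega>"
  by (rule finite_subset[of _ "fst ` D \<times> fst ` D"]) (use D_facts(1) in \<open>auto simp: Omega_set_def intro: rev_image_eqI\<close>)

lemma finite_Om: "finite Om"
  by (rule card_poly_mapping_supported(1)[OF finite_Omega finite_R])

lemma semi_sum_delta:
  assumes "v \<in> semi_invariants"
  shows "(\<Sum>a\<in>Om. single a (lookup v a)) = v"
proof -
  have "(\<Sum>a\<in>Om. single a (lookup v a))
    = (\<Sum>a\<in>keys v. single a (lookup v a))"
    by (rule sum.mono_neutral_right)
      (use assms finite_Om in \<open>auto simp: semi_invariants_eq in_keys_iff\<close>)
  then show ?thesis by (simp only: pm_expand)
qed

context
  assumes chain: "chain_set \<Omega> \<subseteq> \<Gamma>" and no_triple: "\<not> special_triple D"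
begin

text \<open>The index is handled by \<open>restr_mult_commute\<close>. A product term at (a, b)
  \<in> D would come from (a, c), (c, b) \<in> \<Omega>, and then the elements of D starting at a, c
  and b form a special triple; so the coefficient is 1.\<close>

lemma translation:
  assumes X: "X \<in> Om" and Y: "Y \<in> Om"
  shows "act V (McLain_inv Y) (\<delta> X) = \<delta> (X + Y)"
proof -
  have I: "X \<in> I" "Y \<in> I" "Y \<in> carrier M" using X Y Om_I Om_M by auto
  have inv: "McLain_inv (McLain_inv Y) = Y" using I by simp
  have XY: "X + Y \<in> Om" using X Y Poly_Mapping.keys_add[of X Y] by auto
  have "row_act D (McLain_inv Y) X = X + Y"
    unfolding row_act_def inv restr_mult_commute[OF chain I(1,2)]
    by (rule restr_id) (use XY Om_rows in blast)
  moreover have "row_coeff D f (McLain_inv Y) X = 1"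
    unfolding row_coeff_def inv
  proof (rule prod.neutral, rule ballI)
    fix d assume d: "d \<in> D"
    obtain a b where ab: "d = (a, b)" by fastforce
    have "(a, b) \<notin> keys (J_mult X Y)"
    proof
      assume J: "(a, b) \<in> keys (J_mult X Y)"
      have abD: "(a, b) \<in> D" using d ab by simp
      obtain c where c: "(a, c) \<in> \<Omega>" "(c, b) \<in> \<Theta>" "(c, b) \<in> keys Y"
        by (rule keys_J_mult_I[OF I(1,3) abD order_refl J]) blast
      have cb: "(c, b) \<in> \<Omega>" using c(3) Y by auto
      obtain b' g where 1: "(a, b') \<in> D" "(c, g) \<in> D" "a < c" "c < b'" "b' < g" using c(1) by (rule Omega_D)
      obtain g' h where 2: "(c, g') \<in> D" "(b, h) \<in> D" "c < b" "b < g'" "g' < h" using cb by (rule Omega_D)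
      have "b' = b" "g' = g" using D_fst[OF 1(1) abD] D_fst[OF 2(1) 1(2)] by auto
      then have "special_triple D"
        unfolding special_triple_def using abD 1 2 by blast
      then show False using no_triple by simp
    qed
    moreover have rXY: "X \<in> rows D" "Y \<in> rows D" using X Y Om_rows by auto
    ultimately have "lookup (X \<otimes>\<^bsub>M\<^esub> Y) d = 0"
      using lookup_rows_D[OF D_facts(4) d rXY(1)] lookup_rows_D[OF D_facts(4) d rXY(2)]
      by (simp add: McLain_simps lookup_add ab in_keys_iff)
    then show "f d (- lookup (X \<otimes>\<^bsub>M\<^esub> Y) d) = 1" using linear_characterD(3)[OF linear[OF d]] by simp
  qed
  ultimately show ?thesis by (simp add: act_single)
qed

section \<open>Endomorphisms of the model in the commutative case\<close>

lemma inv_V: "X \<in> Om \<Longrightarrow> McLain_inv X \<in> carrier M"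
  using Om_M by auto

lemma hom_delta:
  assumes \<phi>: "\<phi> \<in> gmodule_hom M V V" and X: "X \<in> Om"
  shows "\<phi> (\<delta> X) = act V (McLain_inv X) (\<phi> (\<delta> 0))"
proof -
  have "\<delta> X = act V (McLain_inv X) (\<delta> 0)" using act_inv_delta_0[of X] X Om_rows by auto
  then show ?thesis using hom_VD(4)[OF \<phi> delta_V[OF zero_rows] inv_V[OF X]] by metis
qed

lemma hom_semi_sum:
  assumes \<phi>: "\<phi> \<in> gmodule_hom M V V" and v: "v \<in> semi_invariants"
  shows "\<phi> v = (\<Sum>a\<in>Om. scale (lookup v a) (act V (McLain_inv a) (\<phi> (\<delta> 0))))"
proof -
  have dV: "\<delta> a \<in> carrier V" if "a \<in> Om" for a using that Om_rows by (intro delta_V) blast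
  have sV: "scale c (\<delta> a) \<in> carrier V" if "a \<in> Om" for a c using dV[OF that] by (simp add: V_simps)
  have "v = (\<Sum>a\<in>Om. scale (lookup v a) (\<delta> a))" using semi_sum_delta[OF v] by simp
  then have "\<phi> v = \<phi> (\<Sum>a\<in>Om. scale (lookup v a) (\<delta> a))" by simp
  also have "\<dots> = (\<Sum>a\<in>Om. \<phi> (scale (lookup v a) (\<delta> a)))"
    by (rule hom_V_sum[OF \<phi> sV])
  also have "\<dots> = (\<Sum>a\<in>Om. scale (lookup v a) (act V (McLain_inv a) (\<phi> (\<delta> 0))))"
    by (rule sum.cong[OF refl]) (simp only: hom_VD(3)[OF \<phi> dV] hom_delta[OF \<phi>])
  finally show ?thesis .
qed

text \<open>By \<open>translation\<close> the coefficients of \<phi> (\<psi> (\<delta> 0)) are the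
  convolution of those of \<psi> (\<delta> 0) and \<phi> (\<delta> 0) on an abelian group, which is
  symmetric. Since \<delta> 0 generates the module, this settles all vectors.\<close>

lemma endomorphisms_commute:
  assumes \<phi>: "\<phi> \<in> gmodule_hom M V V" and \<psi>: "\<psi> \<in> gmodule_hom M V V" and v: "v \<in> carrier V"
  shows "\<phi> (\<psi> v) = \<psi> (\<phi> v)"
proof -
  have dbl: "\<phi> (\<psi> (\<delta> 0)) = (\<Sum>a\<in>Om. \<Sum>c\<in>Om.
      single (a + c) (lookup (\<psi> (\<delta> 0)) a * lookup (\<phi> (\<delta> 0)) c))"
    if \<phi>: "\<phi> \<in> gmodule_hom M V V" and \<psi>: "\<psi> \<in> gmodule_hom M V V" for \<phi> \<psi>
  proof -
    have s: "\<phi> (\<delta> 0) \<in> semi_invariants" by (rule hom_V_semi[OF \<phi> delta_0_semi])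
    have "act V (McLain_inv a) (\<phi> (\<delta> 0)) = (\<Sum>c\<in>Om. single (a + c) (lookup (\<phi> (\<delta> 0)) c))"
      if a: "a \<in> Om" for a
    proof -
      have "act V (McLain_inv a) (\<phi> (\<delta> 0))
        = act V (McLain_inv a) (\<Sum>c\<in>Om. scale (lookup (\<phi> (\<delta> 0)) c) (\<delta> c))"
        using semi_sum_delta[OF s] by simp
      also have "\<dots> = (\<Sum>c\<in>Om. scale (lookup (\<phi> (\<delta> 0)) c) (\<delta> (c + a)))"
        unfolding act_lin(4) act_lin(2) by (rule sum.cong[OF refl]) (simp only: translation[OF _ a])
      also have "\<dots> = (\<Sum>c\<in>Om. single (a + c) (lookup (\<phi> (\<delta> 0)) c))"
        by (simp add: add.commute)
      finally show ?thesis .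
    qed
    then have "\<phi> (\<psi> (\<delta> 0)) = (\<Sum>a\<in>Om. scale (lookup (\<psi> (\<delta> 0)) a)
        (\<Sum>c\<in>Om. single (a + c) (lookup (\<phi> (\<delta> 0)) c)))"
      unfolding hom_semi_sum[OF \<phi> hom_V_semi[OF \<psi> delta_0_semi]] by (intro sum.cong refl) simp
    then show ?thesis by (simp add: scale_sum)
  qed
  have "\<phi> (\<psi> (\<delta> 0)) = \<psi> (\<phi> (\<delta> 0))"
    unfolding dbl[OF \<phi> \<psi>] dbl[OF \<psi> \<phi>]
    by (subst sum.swap) (simp add: add.commute mult.commute)
  then have "(\<phi> \<circ> \<psi>) v = (\<psi> \<circ> \<phi>) v"
    by (intro hom_V_ext[OF gmodule_hom_comp[OF \<psi> \<phi>] gmodule_hom_comp[OF \<phi> \<psi>] _ v]) simp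
  then show ?thesis by simp
qed

text \<open>An isomorphism \<open>r\<close> from U to another summand W extends by the projection to
  U to an endomorphism of the whole module. It commutes with that projection, so r u = (r \<circ>
  \<pi> U) (\<pi> U u) = \<pi> U (r u) = 0.\<close>

lemma decomposition_noniso:
  assumes S: "irreducible_decomposition M V S" and UW: "U \<in> S" "W \<in> S" "U \<noteq> W"
  shows "\<not> gmodule_iso M (V\<lparr>carrier := U\<rparr>) (V\<lparr>carrier := W\<rparr>)"
proof
  assume "gmodule_iso M (V\<lparr>carrier := U\<rparr>) (V\<lparr>carrier := W\<rparr>)"
  then obtain r where r: "r \<in> gmodule_hom M (V\<lparr>carrier := U\<rparr>) (V\<lparr>carrier := W\<rparr>)" "bij_betw r U W"
    by (auto simp: gmodule_iso_def)
  have sub: "gsubmodule M V U" "gsubmodule M V W" and irr: "irreducible_gmodule M (V\<lparr>carrier := U\<rparr>)"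
    using S UW by (auto simp: irreducible_decomposition_def)
  obtain \<pi> where \<pi>: "\<And>U. U \<in> S \<Longrightarrow> \<pi> U \<in> gmodule_hom M V V"
    and \<pi>U: "\<And>U v. U \<in> S \<Longrightarrow> v \<in> carrier V \<Longrightarrow> \<pi> U v \<in> U"
    and "\<And>v. v \<in> carrier V \<Longrightarrow> (\<Sum>U\<in>S. \<pi> U v) = v"
    and \<pi>id: "\<And>U W u. \<lbrakk>U \<in> S; W \<in> S; u \<in> U\<rbrakk> \<Longrightarrow> \<pi> W u = (if W = U then u else 0)"
    using decomposition_projections[OF S] by blast
  have rW: "r u \<in> W" if "u \<in> U" for u
    using r(1) that by (auto simp: gmodule_hom_iff V_simps)
  have r_add: "r (u + u') = r u + r u'" if "u \<in> U" "u' \<in> U" for u u'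
    using r(1) that by (auto simp: gmodule_hom_iff V_simps)
  have r_scale: "r (scale c u) = scale c (r u)" if "u \<in> U" for u c
    using r(1) that by (auto simp: gmodule_hom_iff V_simps)
  have r_act: "r (act V g u) = act V g (r u)" if "g \<in> carrier M" "u \<in> U" for g u
    using r(1) that by (auto simp: gmodule_hom_iff V_simps)
  have \<phi>: "r \<circ> \<pi> U \<in> gmodule_hom M V V"
    unfolding hom_V_iff
  proof (intro conjI ballI allI)
    fix v assume v: "v \<in> carrier V"
    note \<pi>v = \<pi>U[OF UW(1) v]
    show "(r \<circ> \<pi> U) v \<in> carrier V" using gsubD(1)[OF sub(2) rW[OF \<pi>v]] by simp
    show "(r \<circ> \<pi> U) (v + w) = (r \<circ> \<pi> U) v + (r \<circ> \<pi> U) w" if w: "w \<in> carrier V" for w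
      using r_add[OF \<pi>v \<pi>U[OF UW(1) w]] hom_VD(2)[OF \<pi>[OF UW(1)] v w] by simp
    show "(r \<circ> \<pi> U) (scale c v) = scale c ((r \<circ> \<pi> U) v)" for c
      using r_scale[OF \<pi>v] hom_VD(3)[OF \<pi>[OF UW(1)] v] by simp
    show "(r \<circ> \<pi> U) (act V g v) = act V g ((r \<circ> \<pi> U) v)" if g: "g \<in> carrier M" for g
      using r_act[OF g \<pi>v] hom_VD(4)[OF \<pi>[OF UW(1)] v g] by simp
  qed
  have r0: "r u = 0" if u: "u \<in> U" for u
  proof -
    have uV: "u \<in> carrier V" by (rule gsubD(1)[OF sub(1) u])
    have "(r \<circ> \<pi> U) (\<pi> U u) = \<pi> U ((r \<circ> \<pi> U) u)"
      by (rule endomorphisms_commute[OF \<phi> \<pi>[OF UW(1)] uV])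
    then show ?thesis using \<pi>id[OF UW(1) UW(1) u] \<pi>id[OF UW(2) UW(1) rW[OF u]] UW(3) by simp
  qed
  have inj: "inj_on r U" using r(2) by (simp add: bij_betw_def)
  have "u = 0" if "u \<in> U" for u
    using inj_onD[OF inj _ that gsubD(2)[OF sub(1)]] r0[OF that] r0[OF gsubD(2)[OF sub(1)]] by simp
  then have "U = {0}" using gsubD(2)[OF sub(1)] by blast
  then show False using irr unfolding irreducible_sub_iff[OF sub(1)] by simp
qed

text \<open>The vectors \<open>w b\<close> are the eigenvectors of the translations, one for each
  character \<kappa> b of the elements supported in \<Omega>. Row orthogonality makes the
  endomorphisms \<open>e b\<close> with \<delta> 0 \<mapsto> w b orthogonal idempotents, column
  orthogonality makes their sum the identity, and the summands are their images.\<close>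

lemma decomposition_exists: "\<exists>S. irreducible_decomposition M V S"
proof -
  obtain d where d: "d \<in> D" using D_facts(2) by blast
  \<comment> \<open>One primitive character of R suffices: the index b of \<kappa> b supplies the
    variation.\<close>
  define \<mu> where "\<mu> = f d"
  have \<mu>: "right_primitive \<mu>" unfolding \<mu>_def by (rule primitive[OF d])
  note lin = linear_characterD[OF right_primitive_linear[OF \<mu>]]
  let ?l = lookup
  define \<kappa> where "\<kappa> b a = (\<Prod>p\<in>\<Omega>. \<mu> (?l b p * ?l a p))" for b a :: "'l \<times> 'l \<Rightarrow>\<^sub>0 'r"
  define N where "N = (of_nat (card (UNIV :: 'r set)) :: 'f) ^ card \<Omega>"
  have N: "N \<noteq> 0" unfolding N_def using card_R_nonzero by simp
  have \<kappa>_add: "\<kappa> b (a + c) = \<kappa> b a * \<kappa> b c" for a b c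
    by (simp add: \<kappa>_def lookup_add distrib_left lin(1) prod.distrib)
  have \<kappa>_0: "\<kappa> b 0 = 1" for b by (simp add: \<kappa>_def lin(3))
  have Om_eq: "a = b \<longleftrightarrow> (\<forall>p\<in>\<Omega>. ?l a p = ?l b p)" if "a \<in> Om" "b \<in> Om" for a b
  proof
    assume "\<forall>p\<in>\<Omega>. ?l a p = ?l b p"
    then have "restr \<Omega> a = restr \<Omega> b" by (simp add: restr_eq_iff)
    then show "a = b" using that by (simp add: restr_id)
  qed simp
  have prod_if: "(\<Prod>p\<in>\<Omega>. if P p then of_nat (card (UNIV :: 'r set)) else (0 :: 'f)) = (if \<forall>p\<in>\<Omega>. P p then N else 0)" for P
    using finite_Omega by (auto simp: N_def intro!: prod_zero)
  have row: "(\<Sum>a\<in>Om. \<kappa> c a * \<kappa> b (- a)) = (if b = c then N else 0)" if "b \<in> Om" "c \<in> Om" for b c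
  proof -
    have "\<kappa> c a * \<kappa> b (- a) = (\<Prod>p\<in>\<Omega>. \<mu> ((?l c p - ?l b p) * ?l a p))" for a
      by (simp add: \<kappa>_def left_diff_distrib flip: prod.distrib lin(1))
    then have "(\<Sum>a\<in>Om. \<kappa> c a * \<kappa> b (- a)) = (\<Prod>p\<in>\<Omega>. \<Sum>r\<in>UNIV. \<mu> ((?l c p - ?l b p) * r))"
      using sum_supported_prod[OF finite_Omega finite_R, of "\<lambda>p r. \<mu> ((?l c p - ?l b p) * r)"] by simp
    also have "\<dots> = (if \<forall>p\<in>\<Omega>. ?l c p - ?l b p = 0 then N else 0)"
      unfolding character_sum_row[OF finite_R \<mu>] prod_if ..
    also have "\<dots> = (if b = c then N else 0)" using Om_eq[OF that] by auto
    finally show ?thesis .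
  qed
  have column: "(\<Sum>b\<in>Om. \<kappa> b a) = (if a = 0 then N else 0)" if "a \<in> Om" for a
  proof -
    have "(\<Sum>b\<in>Om. \<kappa> b a) = (\<Prod>p\<in>\<Omega>. \<Sum>r\<in>UNIV. \<mu> (r * ?l a p))"
      unfolding \<kappa>_def using sum_supported_prod[OF finite_Omega finite_R, of "\<lambda>p r. \<mu> (r * ?l a p)"] by simp
    also have "\<dots> = (if \<forall>p\<in>\<Omega>. ?l a p = 0 then N else 0)"
      unfolding character_sum_column[OF finite_R \<mu>] prod_if ..
    also have "\<dots> = (if a = 0 then N else 0)" using Om_eq[OF that, of 0] by auto
    finally show ?thesis .
  qed
  \<comment> \<open>Division by N, the number of elements supported in \<Omega>, makes
    \<open>e b\<close> idempotent.\<close>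
  define w where "w b = (\<Sum>a\<in>Om. scale (\<kappa> b a / N) (\<delta> a))" for b
  have w_semi: "w b \<in> semi_invariants" for b
    unfolding w_def semi_invariants_eq mem_Collect_eq[of _ "\<lambda>v. keys v \<subseteq> Om"]
    by (rule keys_sum_subset) simp
  have lookup_w: "?l (w b) a = \<kappa> b a / N" if "a \<in> Om" for a b
    using that finite_Om by (simp add: w_def lookup_sum lookup_single when_def)
  have act_w: "act V (McLain_inv Y) (w b) = scale (\<kappa> b (- Y)) (w b)" if Y: "Y \<in> Om" for Y b
  proof -
    have "act V (McLain_inv Y) (w b) = (\<Sum>a\<in>Om. scale (\<kappa> b a / N) (\<delta> (a + Y)))"
      unfolding w_def act_lin(4) act_lin(2) by (rule sum.cong[OF refl]) (simp only: translation[OF _ Y])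
    also have "\<dots> = (\<Sum>a\<in>Om. scale (\<kappa> b (a - Y) / N) (\<delta> a))"
    proof (rule sum.reindex_bij_witness[of _ "\<lambda>a. a - Y" "\<lambda>a. a + Y"])
      fix a assume "a \<in> Om"
      then show "a - Y \<in> Om" "a + Y \<in> Om"
        using Y keys_diff[of a Y] Poly_Mapping.keys_add[of a Y] by auto
    qed simp_all
    also have "\<dots> = scale (\<kappa> b (- Y)) (w b)"
      using \<kappa>_add[of b _ "- Y"] by (simp add: w_def scale_sum mult.commute)
    finally show ?thesis .
  qed
  have "\<exists>\<phi>. \<phi> \<in> gmodule_hom M V V \<and> \<phi> (\<delta> 0) = w b" for b
    by (rule hom_V_exists[OF w_semi[of b]]) blast
  then obtain e where e: "\<And>b. e b \<in> gmodule_hom M V V" "\<And>b. e b (\<delta> 0) = w b" by metis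
  \<comment> \<open>As \<open>w b\<close> is an eigenvector of the translations, \<open>e b\<close>
    sends a vector of the \<lambda>-space to a multiple of \<open>w b\<close>; the scalar is a
    Fourier coefficient of that vector.\<close>
  have e_semi: "e b v = scale (\<Sum>a\<in>Om. ?l v a * \<kappa> b (- a)) (w b)" if v: "v \<in> semi_invariants" for v b
  proof -
    have "e b v = (\<Sum>a\<in>Om. scale (?l v a * \<kappa> b (- a)) (w b))"
      unfolding hom_semi_sum[OF e(1) v] e(2) by (rule sum.cong[OF refl]) (simp add: act_w)
    also have "\<dots> = scale (\<Sum>a\<in>Om. ?l v a * \<kappa> b (- a)) (w b)"
      by (rule poly_mapping_eqI) (simp add: lookup_sum sum_distrib_right)
    finally show ?thesis .
  qed
  have e_w: "e b (w c) = (if b = c then w b else 0)" if bc: "b \<in> Om" "c \<in> Om" for b c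
  proof -
    have "(\<Sum>a\<in>Om. ?l (w c) a * \<kappa> b (- a)) = (\<Sum>a\<in>Om. \<kappa> c a * \<kappa> b (- a)) / N"
      unfolding sum_divide_distrib by (rule sum.cong[OF refl]) (simp add: lookup_w)
    then show ?thesis using N unfolding e_semi[OF w_semi] row[OF bc] by simp
  qed
  have ee: "e b (e c v) = (if b = c then e b v else 0)" if bc: "b \<in> Om" "c \<in> Om" and v: "v \<in> carrier V" for b c v
  proof (cases "b = c")
    case True
    have "(e b \<circ> e c) v = e b v"
      by (rule hom_V_ext[OF gmodule_hom_comp[OF e(1) e(1)] e(1) _ v]) (simp add: e(2) e_w[OF bc(2) bc(2)] True del: single_one)
    then show ?thesis using True by simp
  next
    case False
    have zero: "(\<lambda>_. 0) \<in> gmodule_hom M V V" unfolding hom_V_iff by (simp add: V_simps act_lin(3))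
    have "(e b \<circ> e c) v = (\<lambda>_. 0) v"
      by (rule hom_V_ext[OF gmodule_hom_comp[OF e(1) e(1)] zero _ v]) (simp add: e(2) e_w[OF bc] False del: single_one)
    then show ?thesis using False by simp
  qed
  have esum: "(\<Sum>b\<in>Om. e b v) = v" if v: "v \<in> carrier V" for v
  proof -
    have sum_hom: "(\<lambda>v. \<Sum>b\<in>Om. e b v) \<in> gmodule_hom M V V"
      unfolding hom_V_iff
      using V_sum[of Om "\<lambda>b. e b _"] hom_VD[OF e(1)]
      by (simp add: sum.distrib scale_sum act_lin(4))
    have id_hom: "(\<lambda>v. v) \<in> gmodule_hom M V V" unfolding hom_V_iff using act_V by simp
    \<comment> \<open>Fourier inversion at \<delta> 0; here the column sums enter. Both sides of the
      claim are values of endomorphisms, so comparing them at the generator is enough.\<close>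
    have "(\<Sum>b\<in>Om. e b (\<delta> 0)) = \<delta> 0"
    proof (rule poly_mapping_eqI)
      fix X
      show "?l (\<Sum>b\<in>Om. e b (\<delta> 0)) X = ?l (\<delta> 0) X"
      proof (cases "X \<in> Om")
        case True
        have "?l (\<Sum>b\<in>Om. e b (\<delta> 0)) X = (\<Sum>b\<in>Om. \<kappa> b X) / N"
          by (simp add: e(2) lookup_sum lookup_w[OF True] sum_divide_distrib del: single_one)
        then show ?thesis using column[OF True] N by (auto simp: lookup_single when_def simp del: single_one)
      next
        case False
        have "?l (w b) X = 0" for b using w_semi[of b] False by (auto simp: semi_invariants_eq in_keys_iff)
        moreover have "X \<noteq> 0" using False by auto
        ultimately show ?thesis by (simp add: e(2) lookup_sum lookup_single when_def del: single_one)
      qed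
    qed
    then show ?thesis using hom_V_ext[OF sum_hom id_hom _ v] by simp
  qed
  define U where "U b = e b ` carrier V" for b
  have carrier_sub: "gsubmodule M V (carrier V)"
    unfolding gsub_iff using act_V by (auto simp: V_simps intro!: keys_subset del: subsetI)
  have sub: "gsubmodule M V (U b)" for b
    unfolding U_def by (rule gsubmodule_image[OF V_gmodule V_gmodule e(1) carrier_sub])
  have U_id: "e b u = u" if "b \<in> Om" "u \<in> U b" for b u
    using that ee unfolding U_def by auto
  have eU: "e b v \<in> U b" if "v \<in> carrier V" for b v using that by (auto simp: U_def)
  have wU: "w b \<in> U b" for b using eU[OF delta_V[OF zero_rows, of 1], of b] e(2) by simp
  have w_nz: "w b \<noteq> 0" for b
  proof
    assume "w b = 0"
    then have "?l (w b) 0 = 0" by simp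
    then show False using lookup_w[of 0 b] \<kappa>_0 N by simp
  qed
  \<comment> \<open>A nonzero submodule of \<open>U b\<close> contains a nonzero vector u of the
    \<lambda>-space; since u = e b u, it is a multiple of \<open>w b\<close>, and \<open>w b\<close>
    generates \<open>U b\<close>.\<close>
  have irr: "irreducible_gmodule M (V\<lparr>carrier := U b\<rparr>)" if b: "b \<in> Om" for b
    unfolding irreducible_sub_iff[OF sub]
  proof (intro conjI allI impI)
    show "U b \<noteq> {0}" using wU w_nz by blast
    fix W assume W: "W \<subseteq> U b \<and> gsubmodule M V W"
    show "W = {0} \<or> W = U b"
    proof (rule disjCI)
      assume "W \<noteq> U b"
      show "W = {0}"
      proof (rule ccontr)
        assume "W \<noteq> {0}"
        then obtain u where u: "u \<in> W" "u \<in> semi_invariants" "u \<noteq> 0"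
          using submodule_semi_invariant[of W] W by blast
        define c where "c = (\<Sum>a\<in>Om. ?l u a * \<kappa> b (- a))"
        have uw: "u = scale c (w b)"
          using U_id[OF b, of u] u(1) W e_semi[OF u(2), of b] by (auto simp: c_def)
        then have "c \<noteq> 0" using u(3) by auto
        then have "w b = scale (inverse c) u" using uw by simp
        then have wW: "w b \<in> W" using gsubD(4)[OF conjunct2[OF W] u(1)] by metis
        have "e b v \<in> W" if v: "v \<in> carrier V" for v
          unfolding hom_V_formula[OF e(1) v] e(2)
        proof (rule gsub_sum[OF conjunct2[OF W]])
          fix X assume "X \<in> keys v"
          then have "X \<in> carrier M" using v rows_carrier[of X D] by (auto simp: V_simps)
          then show "scale (?l v X) (act V (McLain_inv X) (w b)) \<in> W"
            by (intro gsubD(4,5)[OF conjunct2[OF W]] wW) simp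
        qed
        then have "W = U b" using W by (auto simp: U_def)
        then show False using \<open>W \<noteq> U b\<close> by simp
      qed
    qed
  qed
  have inj: "inj_on U Om"
  proof (rule inj_onI)
    fix b c assume bc: "b \<in> Om" "c \<in> Om" "U b = U c"
    then have "w b \<in> U c" using wU[of b] by simp
    then have "e c (w b) = w b" by (rule U_id[OF bc(2)])
    then show "b = c" using e_w[OF bc(2,1)] w_nz[of b] by (auto split: if_splits)
  qed
  have "irreducible_decomposition M V (U ` Om)"
    unfolding irreducible_decomposition_def
  proof (intro conjI ballI)
    show "finite (U ` Om)" using finite_Om by simp
    show "gsubmodule M V A" "irreducible_gmodule M (V\<lparr>carrier := A\<rparr>)" if "A \<in> U ` Om" for A
      using that sub irr by auto
    fix v assume v: "v \<in> carrier V"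
    have sum: "(\<Oplus>\<^bsub>V\<^esub>A\<in>U ` Om. u A) = (\<Sum>b\<in>Om. u (U b))" if u: "u \<in> (\<Pi>\<^sub>E A\<in>U ` Om. A)" for u
    proof -
      have "u A \<in> carrier V" if "A \<in> U ` Om" for A
      proof -
        have "u A \<in> A" using u that by (rule PiE_mem)
        then show ?thesis using that gsubD(1)[OF sub] by auto
      qed
      then have "(\<Oplus>\<^bsub>V\<^esub>A\<in>U ` Om. u A) = (\<Sum>A\<in>U ` Om. u A)"
        using finite_Om by (intro pm_space_finsum[OF row_module_pm_space]) auto
      also have "\<dots> = (\<Sum>b\<in>Om. u (U b))" using inj by (simp add: sum.reindex)
      finally show ?thesis .
    qed
    define u where "u = (\<lambda>A\<in>U ` Om. e (the_inv_into Om U A) v)"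
    have uU: "u (U b) = e b v" if "b \<in> Om" for b
      using that the_inv_into_f_f[OF inj that] by (simp add: u_def)
    have uPi: "u \<in> (\<Pi>\<^sub>E A\<in>U ` Om. A)"
    proof (rule PiE_I)
      fix A assume "A \<in> U ` Om"
      then obtain b where "b \<in> Om" "A = U b" by auto
      then show "u A \<in> A" using uU eU[OF v] by simp
    qed (simp add: u_def)
    show "\<exists>!u. u \<in> (\<Pi>\<^sub>E A\<in>U ` Om. A) \<and> v = (\<Oplus>\<^bsub>V\<^esub>A\<in>U ` Om. u A)"
    proof (rule ex1I[of _ u])
      have "(\<Oplus>\<^bsub>V\<^esub>A\<in>U ` Om. u A) = v" unfolding sum[OF uPi] using uU esum[OF v] by simp
      then show "u \<in> (\<Pi>\<^sub>E A\<in>U ` Om. A) \<and> v = (\<Oplus>\<^bsub>V\<^esub>A\<in>U ` Om. u A)" using uPi by simp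
    next
      fix t assume t: "t \<in> (\<Pi>\<^sub>E A\<in>U ` Om. A) \<and> v = (\<Oplus>\<^bsub>V\<^esub>A\<in>U ` Om. t A)"
      have tU: "t (U b) \<in> U b" if "b \<in> Om" for b using PiE_mem[OF conjunct1[OF t], of "U b"] that by simp
      have tV: "t (U b) \<in> carrier V" if "b \<in> Om" for b by (rule gsubD(1)[OF sub tU[OF that]])
      have vt: "v = (\<Sum>c\<in>Om. t (U c))" using t sum by simp
      have "t (U b) = e b v" if b: "b \<in> Om" for b
      proof -
        have "e b v = (\<Sum>c\<in>Om. e b (t (U c)))" unfolding vt by (rule hom_V_sum[OF e(1) tV])
        also have "\<dots> = (\<Sum>c\<in>Om. if c = b then t (U b) else 0)"
        proof (rule sum.cong[OF refl])
          fix c assume c: "c \<in> Om"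
          have "e b (t (U c)) = e b (e c (t (U c)))" using U_id[OF c tU[OF c]] by simp
          also have "\<dots> = (if b = c then e b (t (U c)) else 0)" by (rule ee[OF b c tV[OF c]])
          finally show "e b (t (U c)) = (if c = b then t (U b) else 0)"
            using U_id[OF b tU[OF b]] by (cases "b = c") auto
        qed
        also have "\<dots> = t (U b)" using b finite_Om by simp
        finally show ?thesis by simp
      qed
      then have "t A = u A" if "A \<in> U ` Om" for A using that uU by auto
      moreover have "t \<in> extensional (U ` Om)" "u \<in> extensional (U ` Om)" using t uPi by (auto simp: PiE_def)
      ultimately show "t = u" by (intro extensionalityI[of t "U ` Om" u])
    qed
  qed
  then show ?thesis by blast
qed

lemma conditions_imp_multiplicity_free: "multiplicity_free M V"
  unfolding multiplicity_free_def using decomposition_exists decomposition_noniso by simp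

end

end

theorem theorem8p21:
  fixes D :: "('l::linorder \<times> 'l) set"
    and f :: "'l \<times> 'l \<Rightarrow> 'r::ring_1 \<Rightarrow> 'f::field"
  assumes "finite (UNIV :: 'r set)"
    and "\<exists>\<mu> :: 'r \<Rightarrow> 'f. right_primitive \<mu>"
    and "basic_subset D"
    and "\<forall>d\<in>D. right_primitive (f d)"
    and "splitting_field_over (McLain\<lparr>carrier := I_group D\<rparr>) (H_group D) (basic_character D f)"
    and "class.wellorder ((\<ge>) :: 'l \<Rightarrow> 'l \<Rightarrow> bool) (>)"
  shows "(multiplicity_free McLain (basic_module D f) \<longleftrightarrow>
            comm_group ((McLain\<lparr>carrier := I_group D\<rparr> :: ('l \<times> 'l \<Rightarrow>\<^sub>0 'r) monoid) Mod H_group D)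
            \<and> \<not> special_triple D)
       \<and> (comm_group ((McLain\<lparr>carrier := I_group D\<rparr> :: ('l \<times> 'l \<Rightarrow>\<^sub>0 'r) monoid) Mod H_group D)
            \<longleftrightarrow> chain_set (Omega_set D) \<subseteq> Gamma_set D)"
proof -
  interpret basic_data D f
    by unfold_locales (use assms in auto)
  have comm_iff: "comm_group ((M\<lparr>carrier := I\<rparr>) Mod H) \<longleftrightarrow> chain_set \<Omega> \<subseteq> \<Gamma>"
    unfolding comm_group_iff chain_subset_iff ..
  obtain p where B: "gmodule M (basic_module D f)" and p: "p \<in> gmodule_hom M (basic_module D f) V"
    "bij_betw p (carrier (basic_module D f)) (carrier V)"
    by (rule basic_module_iso[OF assms(3) linear])
  have "multiplicity_free M (basic_module D f) \<longleftrightarrow> multiplicity_free M V"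
    using multiplicity_free_iso[OF B V_gmodule p]
      multiplicity_free_iso[OF V_gmodule B gmodule_hom_inverse[OF B V_gmodule p] bij_betw_the_inv_into[OF p(2)]]
    by blast
  moreover have "multiplicity_free M V \<longleftrightarrow> chain_set \<Omega> \<subseteq> \<Gamma> \<and> \<not> special_triple D"
    using commute_imp_conditions[OF multiplicity_free_imp_commute[OF assms(5)]] conditions_imp_multiplicity_free
    by blast
  ultimately show ?thesis using comm_iff by blast
qed

end
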